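(* Let $X$ be a projective toric variety of dimension $n$ with $n\ge 3$. If an ample line bundle $L$ on $X$ satisfies $\dim \Gamma(X, L)\ge n+2$ and $\dim \Gamma(X, L^{\otimes(n-1)}\otimes \omega_X)=1$, then $L$ is normally generated.
   Context: Toric varieties are normal and are considered over $\mathbb{C}$. $\omega_X$ denotes the dualizing sheaf of $X$. An ample line bundle $L$ on $X$ is normally generated if the multiplication map $\Gamma(X, L^{\otimes k})\otimes \Gamma(X, L)\to \Gamma(X, L^{\otimes (k+1)})$ is surjective for all integers $k\ge 1$. *)

theory Defs
  imports
    "HOL-Analysis.Analysis"
    "HOL-Library.Poly_Mapping"
    "HOL-Computational_Algebra.Fraction_Field"
    "HOL-Algebra.Ideal"
begin

section \<open>Integral schemes as sets of local rings\<close>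

text \<open>
  An integral separated scheme of finite type over a field is determined by the set of the local
  rings of its points (the generic point included), viewed as subrings of its function field
  (Zariski, Chevalley). Such a set is used here as the scheme itself. The domain of definition of
  a rational function is open, and these sets form a subbasis of the Zariski topology.
\<close>

definition ring_of :: "'k::field set \<Rightarrow> 'k ring" where
  "ring_of A = \<lparr>carrier = A, monoid.mult = (*), one = 1, ring.zero = 0, add = (+)\<rparr>"

definition localization :: "'k::field set \<Rightarrow> 'k set \<Rightarrow> 'k set" where
  "localization A P = {a / b |a b. a \<in> A \<and> b \<in> A - P}"

definition Spec :: "'k::field set \<Rightarrow> 'k set set" where
  "Spec A = {localization A P |P. primeideal P (ring_of A)}"

definition zariski :: "'k::field set set \<Rightarrow> 'k set topology" where
  "zariski X = topology_generated_by {{R \<in> X. f \<in> R} |f. True}"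

text \<open>
  A local ring of the scheme belongs to a point of codimension one iff its maximal ideal has
  height one.
\<close>

definition codim_one :: "'k::field set \<Rightarrow> bool" where
  "codim_one R \<longleftrightarrow> (\<exists>P. maximalideal P (ring_of R) \<and> P \<noteq> {0} \<and>
     (\<forall>Q. primeideal Q (ring_of R) \<and> Q \<subset> P \<longrightarrow> Q = {0}))"

text \<open>
  A subsheaf of the constant sheaf of rational functions is given by its stalks, as a function
  from the local rings to sets of rational functions. On an integral scheme every line bundle is
  isomorphic to an invertible subsheaf of this kind, i.e. one that is locally generated by a single
  nonzero rational function. If one of the factors is invertible, the tensor product of two
  such subsheaves is their product inside the function field.
\<close>

type_synonym 'k subsheaf = "'k set \<Rightarrow> 'k set"

definition line_bundle :: "'k::field set set \<Rightarrow> 'k subsheaf \<Rightarrow> bool" where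
  "line_bundle X L \<longleftrightarrow> (\<forall>R\<in>X. \<exists>U g. openin (zariski X) U \<and> R \<in> U \<and> g \<noteq> 0 \<and>
     (\<forall>S\<in>U. L S = (\<lambda>a. g * a) ` S))"

definition global_sections :: "'k::field set set \<Rightarrow> 'k subsheaf \<Rightarrow> 'k set" where
  "global_sections X F = {f. \<forall>R\<in>X. f \<in> F R}"

definition submodule_generated :: "'k::field set \<Rightarrow> 'k set \<Rightarrow> 'k set" where
  "submodule_generated R G = {\<Sum>x\<in>T. c x * x |T c. finite T \<and> T \<subseteq> G \<and> c ` T \<subseteq> R}"

definition tensor :: "'k::field subsheaf \<Rightarrow> 'k subsheaf \<Rightarrow> 'k subsheaf" where
  "tensor F G = (\<lambda>R. submodule_generated R {a * b |a b. a \<in> F R \<and> b \<in> G R})"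

primrec tensor_power :: "'k::field subsheaf \<Rightarrow> nat \<Rightarrow> 'k subsheaf" where
  "tensor_power L 0 = (\<lambda>R. R)"
| "tensor_power L (Suc k) = tensor (tensor_power L k) L"


section \<open>The torus and its function field\<close>

text \<open>
  The character lattice \<open>M\<close> of the torus is the lattice of exponent vectors \<open>'n \<Rightarrow>\<^sub>0 int\<close>, of rank
  \<open>CARD('n)\<close>, and the function field is the fraction field of the group algebra of \<open>M\<close>
  over the complex numbers. The linear order on the coordinates only serves to make the
  library's instance of integral domains applicable to this group algebra.
\<close>

type_synonym 'n lattice = "'n \<Rightarrow>\<^sub>0 int"
type_synonym 'n laurent = "'n lattice \<Rightarrow>\<^sub>0 complex"
type_synonym 'n ratfun = "'n laurent fract"

definition const :: "complex \<Rightarrow> 'n::{finite,linorder} ratfun" where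
  "const c = Fract (Poly_Mapping.single 0 c) 1"

definition cscale :: "complex \<Rightarrow> 'n::{finite,linorder} ratfun \<Rightarrow> 'n ratfun" where
  "cscale c f = const c * f"

lemma const_add: "const (a + b) = const a + const b"
  by (simp add: const_def single_add)

lemma const_mult: "const (a * b) = const a * const b"
  by (simp add: const_def mult_single)

lemma const_one: "const 1 = 1"
  by (simp add: const_def One_fract_def)

interpretation ratfun: vector_space cscale
  by unfold_locales (simp_all add: cscale_def const_add const_mult const_one algebra_simps)

definition subalgebra :: "'n::{finite,linorder} ratfun set \<Rightarrow> bool" where
  "subalgebra A \<longleftrightarrow> range const \<subseteq> A \<and> (\<forall>a\<in>A. \<forall>b\<in>A. a + b \<in> A \<and> a * b \<in> A)"

text \<open>
  The logarithmic derivation \<open>x\<^sub>i \<partial>/\<partial>x\<^sub>i\<close>, which multiplies the monomial \<open>x\<^sup>m\<close> by the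
  \<open>i\<close>-th coordinate of \<open>m\<close>, first on Laurent polynomials and then on rational functions.
\<close>

definition laurent_deriv :: "'n \<Rightarrow> 'n::{finite,linorder} laurent \<Rightarrow> 'n laurent" where
  "laurent_deriv i p = Poly_Mapping.mapp (\<lambda>m c. of_int (Poly_Mapping.lookup m i) * c) p"

lemma lookup_laurent_deriv:
  "Poly_Mapping.lookup (laurent_deriv i p) m =
     of_int (Poly_Mapping.lookup m i) * Poly_Mapping.lookup p m"
  by (simp add: laurent_deriv_def lookup_mapp in_keys_iff when_def)

lemma laurent_deriv_add: "laurent_deriv i (p + q) = laurent_deriv i p + laurent_deriv i q"
  by (rule poly_mapping_eqI) (simp add: lookup_laurent_deriv lookup_add algebra_simps)

lemma laurent_deriv_single:
  "laurent_deriv i (Poly_Mapping.single m c) =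
     Poly_Mapping.single m (of_int (Poly_Mapping.lookup m i) * c)"
  by (rule poly_mapping_eqI) (simp add: lookup_laurent_deriv lookup_single when_def)

lemma laurent_induct:
  fixes p :: "'a \<Rightarrow>\<^sub>0 'b::ab_group_add"
  assumes "\<And>m c. P (Poly_Mapping.single m c)" "\<And>p q. P p \<Longrightarrow> P q \<Longrightarrow> P (p + q)"
  shows "P p"
proof (induction p rule: update_induct)
  case const
  show ?case
    using assms(1)[of undefined 0] by simp
next
  case (update f a b)
  have "Poly_Mapping.update a b f = f + Poly_Mapping.single a b"
  proof (rule poly_mapping_eqI)
    fix x
    show "Poly_Mapping.lookup (Poly_Mapping.update a b f) x =
      Poly_Mapping.lookup (f + Poly_Mapping.single a b) x"
      using update.hyps(1)
      by (cases "x = a") (simp_all add: lookup_update lookup_add lookup_single in_keys_iff)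
  qed
  then show ?case
    using assms update by simp
qed

lemma laurent_deriv_mult:
  "laurent_deriv i (p * q) = laurent_deriv i p * q + p * laurent_deriv i q"
proof (induction p rule: laurent_induct)
  case (1 m c)
  show ?case
  proof (induction q rule: laurent_induct)
    case (1 l d)
    show ?case
      by (simp add: laurent_deriv_single mult_single lookup_add distrib_right distrib_left
          mult.left_commute mult.assoc flip: single_add)
  next
    case (2 q q')
    then show ?case
      by (simp add: laurent_deriv_add distrib_left add_ac)
  qed
next
  case (2 p p')
  then show ?case
    by (simp add: laurent_deriv_add algebra_simps)
qed

lift_definition log_deriv :: "'n::{finite,linorder} \<Rightarrow> 'n ratfun \<Rightarrow> 'n ratfun" is
  "\<lambda>i (p, q). (laurent_deriv i p * q - p * laurent_deriv i q, q * q)"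
proof clarsimp
  fix i and p q r s :: "'n laurent"
  assume eq: "p * s = r * q"
  have D: "laurent_deriv i p * s + p * laurent_deriv i s =
    laurent_deriv i r * q + r * laurent_deriv i q"
    using arg_cong[OF eq, of "laurent_deriv i"] by (simp add: laurent_deriv_mult)
  have "(laurent_deriv i p * q - p * laurent_deriv i q) * (s * s) =
    q * s * (laurent_deriv i p * s) - (p * s) * s * laurent_deriv i q"
    by (simp add: algebra_simps)
  also have "laurent_deriv i p * s =
    laurent_deriv i r * q + r * laurent_deriv i q - p * laurent_deriv i s"
    using D by (metis add_diff_cancel_right')
  also have "q * s * (laurent_deriv i r * q + r * laurent_deriv i q - p * laurent_deriv i s) -
      (p * s) * s * laurent_deriv i q =
    q * q * s * laurent_deriv i r + r * q * s * laurent_deriv i q -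
      q * (p * s) * laurent_deriv i s - (p * s) * s * laurent_deriv i q"
    by (simp add: algebra_simps)
  also have "\<dots> = (laurent_deriv i r * s - r * laurent_deriv i s) * (q * q)"
    unfolding eq by (simp add: algebra_simps)
  finally show "(laurent_deriv i p * q - p * laurent_deriv i q) * (s * s) =
    (laurent_deriv i r * s - r * laurent_deriv i s) * (q * q)" .
qed

lemma log_deriv_Fract:
  "q \<noteq> 0 \<Longrightarrow> log_deriv i (Fract p q) =
     Fract (laurent_deriv i p * q - p * laurent_deriv i q) (q * q)"
  by (simp add: Fract_def log_deriv.abs_eq)


section \<open>Dualizing sheaf\<close>

text \<open>
  A rational \<open>n\<close>-form is written as \<open>f \<cdot> \<theta>\<close> with \<open>\<theta> = dx\<^sub>1/x\<^sub>1 \<and> \<dots> \<and> dx\<^sub>n/x\<^sub>n\<close> and identified with its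
  coefficient \<open>f\<close>. Since \<open>dg\<^sub>1 \<and> \<dots> \<and> dg\<^sub>n\<close> has the coefficient \<open>det (x\<^sub>i \<partial>g\<^sub>j/\<partial>x\<^sub>i)\<close>, the following is
  the module of \<open>n\<close>-forms that are regular at a codimension-one point of a normal variety.
\<close>

definition regular_forms :: "'n::{finite,linorder} ratfun set \<Rightarrow> 'n ratfun set" where
  "regular_forms R =
     submodule_generated R {det (\<chi> i j. log_deriv i (g j)) |g :: 'n \<Rightarrow> 'n ratfun. range g \<subseteq> R}"

text \<open>
  On a normal variety the dualizing sheaf is the sheaf \<open>\<O>(K)\<close> of rational \<open>n\<close>-forms without poles
  along prime divisors. It is given here by its stalks.
\<close>

definition dualizing_sheaf :: "'n::{finite,linorder} ratfun set set \<Rightarrow> 'n ratfun subsheaf" where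
  "dualizing_sheaf X = (\<lambda>R. {f. \<exists>U. openin (zariski X) U \<and> R \<in> U \<and>
     (\<forall>S\<in>U. codim_one S \<longrightarrow> f \<in> regular_forms S)})"


section \<open>Ample and normally generated line bundles\<close>

definition nonvanishing_locus :: "'k::field set set \<Rightarrow> 'k subsheaf \<Rightarrow> 'k \<Rightarrow> 'k set set" where
  "nonvanishing_locus X L s = {R \<in> X. L R = (\<lambda>a. s * a) ` R}"

text \<open>
  A finite set \<open>S\<close> of nonzero sections without common zeros defines a morphism to projective space,
  with homogeneous coordinates indexed by \<open>S\<close>, under which \<open>L\<close> is the pullback of \<open>\<O>(1)\<close>.
  It is a closed immersion iff, over the standard affine open set belonging to each \<open>s \<in> S\<close>, the
  nonvanishing locus of \<open>s\<close> is affine with coordinate ring generated by the ratios \<open>t / s\<close>.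
\<close>

definition very_ample :: "'n::{finite,linorder} ratfun set set \<Rightarrow> 'n ratfun subsheaf \<Rightarrow> bool" where
  "very_ample X L \<longleftrightarrow> line_bundle X L \<and>
     (\<exists>S. finite S \<and> 0 \<notin> S \<and> S \<subseteq> global_sections X L \<and>
       X = (\<Union>s\<in>S. nonvanishing_locus X L s) \<and>
       (\<forall>s\<in>S. nonvanishing_locus X L s = Spec (subalgebra hull {t / s |t. t \<in> S})))"

definition projective :: "'n::{finite,linorder} ratfun set set \<Rightarrow> bool" where
  "projective X \<longleftrightarrow> (\<exists>L. very_ample X L)"

text \<open>
  As usual for complete varieties, a line bundle is ample iff some positive power is very ample.
\<close>

definition ample :: "'n::{finite,linorder} ratfun set set \<Rightarrow> 'n ratfun subsheaf \<Rightarrow> bool" where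
  "ample X L \<longleftrightarrow> line_bundle X L \<and> (\<exists>k\<ge>1. very_ample X (tensor_power L k))"

text \<open>The complex span of the products of sections is the image of the multiplication map.\<close>

definition normally_generated ::
    "'n::{finite,linorder} ratfun set set \<Rightarrow> 'n ratfun subsheaf \<Rightarrow> bool" where
  "normally_generated X L \<longleftrightarrow> (\<forall>k\<ge>1.
     ratfun.span {s * t |s t. s \<in> global_sections X (tensor_power L k) \<and> t \<in> global_sections X L} =
     global_sections X (tensor_power L (k + 1)))"


section \<open>Toric varieties\<close>

text \<open>
  Cones live in \<open>N \<otimes> \<real>\<close>, with \<open>N\<close> the lattice of integer vectors, dual to \<open>M\<close>. The empty set
  has to be excluded, because it is a face of every convex set in the sense of \<open>face_of\<close>.
\<close>

definition pairing :: "'n::finite lattice \<Rightarrow> real^'n \<Rightarrow> real" where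
  "pairing m v = (\<Sum>i\<in>UNIV. of_int (Poly_Mapping.lookup m i) * v $ i)"

definition rational_cone :: "(real^'n) set \<Rightarrow> bool" where
  "rational_cone \<sigma> \<longleftrightarrow>
     (\<exists>S. finite S \<and> (\<forall>v\<in>S. \<forall>i. v $ i \<in> \<int>) \<and> \<sigma> = convex_cone hull S)"

definition strongly_convex :: "(real^'n) set \<Rightarrow> bool" where
  "strongly_convex \<sigma> \<longleftrightarrow> \<sigma> \<inter> uminus ` \<sigma> = {0}"

definition fan :: "(real^'n) set set \<Rightarrow> bool" where
  "fan \<Sigma> \<longleftrightarrow> finite \<Sigma> \<and> \<Sigma> \<noteq> {} \<and>
     (\<forall>\<sigma>\<in>\<Sigma>. rational_cone \<sigma> \<and> strongly_convex \<sigma>) \<and>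
     (\<forall>\<sigma>\<in>\<Sigma>. \<forall>\<tau>. \<tau> face_of \<sigma> \<and> \<tau> \<noteq> {} \<longrightarrow> \<tau> \<in> \<Sigma>) \<and>
     (\<forall>\<sigma>\<in>\<Sigma>. \<forall>\<tau>\<in>\<Sigma>. \<sigma> \<inter> \<tau> face_of \<sigma> \<and> \<sigma> \<inter> \<tau> face_of \<tau>)"

text \<open>The semigroup algebra of the lattice points of the dual cone.\<close>

definition cone_algebra :: "(real^'n::{finite,linorder}) set \<Rightarrow> 'n ratfun set" where
  "cone_algebra \<sigma> = {Fract p 1 |p. \<forall>m\<in>Poly_Mapping.keys p. \<forall>v\<in>\<sigma>. 0 \<le> pairing m v}"

text \<open>
  The affine toric varieties of the cones are glued along those of common faces. In terms of local
  rings this is the union, as points are identified iff they have the same local ring.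
\<close>

definition toric_variety :: "(real^'n::{finite,linorder}) set set \<Rightarrow> 'n ratfun set set" where
  "toric_variety \<Sigma> = (\<Union>\<sigma>\<in>\<Sigma>. Spec (cone_algebra \<sigma>))"

end

theory Submission
  imports Defs
begin

text \<open>
  Up to a rational function, \<open>L\<close> is given by a monomial \<open>x\<^bsup>m(\<sigma>)\<^esup>\<close> on the chart of every cone \<open>\<sigma>\<close>:
  it is trivial on the torus because polynomial rings have greatest common divisors, and
  the constant coefficient of \<open>1 = \<Sum>a\<^sub>i b\<^sub>i\<close>, with \<open>a\<^sub>i\<close> and \<open>b\<^sub>i\<close> in the fractional ideal of a chart and in
  its inverse, singles out \<open>m(\<sigma>)\<close>. The sections of \<open>L\<^bsup>k\<^esup>\<close> are then spanned by the lattice points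
  of \<open>k P\<close> for a polytope \<open>P\<close>, which is a full-dimensional lattice polytope as \<open>L\<close> is ample, and the
  interior lattice points of \<open>(n - 1) P\<close> give independent sections of \<open>L\<^bsup>n-1\<^esup> \<otimes> \<omega>\<close>; so there is at most
  one of them.

  It remains to subtract a lattice point of \<open>P\<close> from a given lattice point \<open>x\<close> of height \<open>K \<ge> 2\<close> in the
  cone over \<open>P\<close>. Take a lattice simplex in \<open>P\<close> with vertices \<open>v\<^sub>0, \<dots>, v\<^sub>n\<close> whose cone contains \<open>x\<close>. If no
  vertex can be subtracted, then \<open>\<Sum>v\<^sub>i - x\<close> is an interior lattice point of height \<open>n + 1 - K\<close>. For
  \<open>K > 2\<close>, adding lattice points of \<open>P\<close> produces several interior points of height \<open>n - 1\<close>. For \<open>K = 2\<close>,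
  \<open>\<Sum>v\<^sub>i\<close> is determined by \<open>x\<close>, which is impossible, as some vertex of the simplex may be
  exchanged for any further lattice point of \<open>P\<close>.
\<close>

section \<open>Lattice points of a polytope with one interior point in its dilate\<close>

text \<open>The polytope part works with the single point \<open>x\<close>, so Caratheodory's
  theorem supplies the simplex and no triangulation of \<open>P\<close> is used. For
  \<open>K = k + 1\<close> the coefficients of \<open>x\<close> are below 1 and sum to
  \<open>k + 1\<close>; the complementary ones are positive and sum to \<open>n - k\<close>. So an
  obstruction can occur only for \<open>k < n\<close>, and \<open>k - 1\<close> further lattice
  points raise the height to exactly \<open>n - 1\<close>, the power in the hypothesis.

  The obstacle on the geometric side is that a scheme is a bare set of local rings, so each fact
  about cones and polytopes has to be read off at a suitable point. The uniform device is the order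
  along a vector \<open>v\<close>: in a ring without functions of negative order, those of positive
  order form a prime, and localizing there gives a point at which orders can be compared. On a chart
  of a cone this leads to m(\<sigma>), on a chart of projective space to completeness of the fan,
  and for \<open>v\<close> in the relative interior of a full-dimensional cone to a vertex of
  \<open>P\<close>.

  Triviality on the torus uses gcds without prime factorization: an invertible ideal is principal as
  soon as gcds commute with multiplication by a fixed element.\<close>

abbreviation keys :: "('a \<Rightarrow>\<^sub>0 'b::zero) \<Rightarrow> 'a set" where "keys \<equiv> Poly_Mapping.keys"
abbreviation lookup :: "('a \<Rightarrow>\<^sub>0 'b::zero) \<Rightarrow> 'a \<Rightarrow> 'b" where "lookup \<equiv> Poly_Mapping.lookup"
abbreviation single :: "'a \<Rightarrow> 'b \<Rightarrow> 'a \<Rightarrow>\<^sub>0 'b::zero" where "single \<equiv> Poly_Mapping.single"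

definition lattice_vec :: "'n::finite lattice \<Rightarrow> real^'n" where
  "lattice_vec m = (\<chi> i. of_int (lookup m i))"

lemma pairing_eq_inner: "pairing m v = lattice_vec m \<bullet> v"
  by (simp add: pairing_def lattice_vec_def inner_vec_def)

lemma lattice_vec_add: "lattice_vec (a + b) = lattice_vec a + lattice_vec b"
  by (simp add: lattice_vec_def vec_eq_iff lookup_add)

lemma lattice_vec_diff: "lattice_vec (a - b) = lattice_vec a - lattice_vec b"
  by (simp add: lattice_vec_def vec_eq_iff lookup_minus)

lemma lattice_vec_zero: "lattice_vec 0 = 0"
  by (simp add: lattice_vec_def vec_eq_iff)

lemma lattice_vec_sum: "lattice_vec (sum f A) = (\<Sum>a\<in>A. lattice_vec (f a))"
  by (induction A rule: infinite_finite_induct) (simp_all add: lattice_vec_add lattice_vec_zero)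

lemma inj_lattice_vec: "inj lattice_vec"
  by (rule injI) (auto simp: lattice_vec_def vec_eq_iff intro!: poly_mapping_eqI)

lemma pairing_add: "pairing (a + b) v = pairing a v + pairing b v"
  by (simp add: pairing_eq_inner lattice_vec_add inner_left_distrib)

lemma pairing_diff: "pairing (a - b) v = pairing a v - pairing b v"
  by (simp add: pairing_eq_inner lattice_vec_diff inner_left_distrib inner_diff_left)

lemma pairing_minus: "pairing (- b) v = - pairing b v"
  using pairing_diff[of 0 b v] by (simp add: pairing_eq_inner lattice_vec_zero)

lemma pairing_zero: "pairing 0 v = 0"
  by (simp add: pairing_eq_inner lattice_vec_zero)

lemma pairing_sum: "pairing (sum f A) v = (\<Sum>a\<in>A. pairing (f a) v)"
  by (simp add: pairing_eq_inner lattice_vec_sum inner_sum_left)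

text \<open>Caratheodory's theorem with a full-dimensional simplex. A smallest subset
  \<open>C\<close> whose hull contains \<open>y\<close> is affinely independent, since otherwise
  Caratheodory would shrink it. It then extends within \<open>A\<close> to an affine basis, and
  \<open>y\<close> stays in the larger hull.\<close>

lemma affine_basis_of_convex_hull:
  fixes A :: "'a::euclidean_space set"
  assumes "y \<in> convex hull A" "affine hull A = UNIV"
  obtains B u where "finite B" "B \<subseteq> A" "card B = DIM('a) + 1" "affine hull B = UNIV"
    "\<And>b. b \<in> B \<Longrightarrow> 0 \<le> u b" "sum u B = 1" "(\<Sum>b\<in>B. u b *\<^sub>R b) = y"
proof -
  define P where "P = (\<lambda>n. \<exists>C. finite C \<and> C \<subseteq> A \<and> y \<in> convex hull C \<and> card C = n)"
  have "\<exists>n. P n"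
    using assms(1) unfolding P_def caratheodory_aff_dim[of A] by blast
  then have "P (LEAST n. P n)"
    by (metis LeastI)
  then obtain C where C: "finite C" "C \<subseteq> A" "y \<in> convex hull C" "card C = (LEAST n. P n)"
    unfolding P_def by blast
  have "\<not> affine_dependent C"
  proof
    assume "affine_dependent C"
    then have ne: "aff_dim C \<noteq> int (card C) - 1"
      using affine_independent_iff_card C(1) by blast
    have "aff_dim C \<le> int (card C) - 1"
      using aff_dim_le_card C(1) by blast
    with ne have lt: "aff_dim C + 1 < int (card C)" by linarith
    obtain C' where C': "finite C'" "C' \<subseteq> C" "card C' \<le> aff_dim C + 1" "y \<in> convex hull C'"
      using C(3) unfolding caratheodory_aff_dim[of C] by blast
    then have "P (card C')" using C(2) unfolding P_def by blast
    then have "card C \<le> card C'" using C(4) by (simp add: Least_le)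
    with lt C'(3) show False by linarith
  qed
  then obtain B where B: "\<not> affine_dependent B" "C \<subseteq> B" "B \<subseteq> A" "affine hull B = affine hull A"
    using extend_to_affine_basis C(2) by metis
  have fin: "finite B" using B(1) aff_independent_finite by blast
  have "aff_dim B = DIM('a)" using B(4) assms(2) by (metis aff_dim_UNIV aff_dim_affine_hull)
  then have card: "card B = DIM('a) + 1"
    using aff_dim_affine_independent[OF B(1)] by linarith
  have "y \<in> convex hull B" using C(3) B(2) hull_mono by blast
  then obtain u where "\<forall>b\<in>B. 0 \<le> u b" "sum u B = 1" "(\<Sum>b\<in>B. u b *\<^sub>R b) = y"
    unfolding convex_hull_finite[OF fin] by blast
  then show thesis using that[OF fin B(3) card] B(4) assms(2) by blast
qed

text \<open>The purely polyhedral core. Each pair \<open>(v, c)\<close> in \<open>D\<close> is an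
  inequality defining \<open>P\<close>, so that \<open>S k\<close> and \<open>I k\<close> are the
  lattice points of \<open>k P\<close> satisfying these inequalities weakly and strictly.
  \<open>D\<close> may be infinite: in the application it runs over all nonzero vectors of all
  cones.\<close>

lemma lattice_point_decomposition:
  fixes D :: "((real^'n::finite) \<times> real) set" and S I :: "nat \<Rightarrow> 'n lattice set"
  assumes n: "CARD('n) \<ge> 3"
    and S: "\<And>k. S k = {m. \<forall>(v, c)\<in>D. real k * c \<le> pairing m v}"
    and I: "\<And>k. I k = {m. \<forall>(v, c)\<in>D. real k * c < pairing m v}"
    and D: "\<And>v c. (v, c) \<in> D \<Longrightarrow> v \<noteq> 0"
    and hull: "\<And>k m. 1 \<le> k \<Longrightarrow> m \<in> S k \<Longrightarrow> (1 / real k) *\<^sub>R lattice_vec m \<in> convex hull lattice_vec ` S 1"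
    and aff: "affine hull lattice_vec ` S 1 = UNIV"
    and many: "CARD('n) + 2 \<le> card (S 1)"
    and unique: "\<And>a b. a \<in> I (CARD('n) - 1) \<Longrightarrow> b \<in> I (CARD('n) - 1) \<Longrightarrow> a = b"
    and k: "1 \<le> k" and x: "x \<in> S (k + 1)"
  shows "\<exists>p\<in>S 1. x - p \<in> S k"
proof (rule ccontr)
  assume neg: "\<not> (\<exists>p\<in>S 1. x - p \<in> S k)"
  define n where "n = CARD('n)"
  have finV: "finite (S 1)" using many card.infinite by fastforce
  \<comment> \<open>A lattice simplex whose cone contains \<open>x\<close>, with the coefficients of
    \<open>x\<close>. That \<open>B\<close> spans affinely is expressed by saying that no nonzero
    functional is constant on it; in this form it yields strict inequalities and survives the
    exchange of a vertex.\<close>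
  define cell where "cell = (\<lambda>B a. finite B \<and> B \<subseteq> S 1 \<and> card B = n + 1 \<and>
     (\<forall>v c. v \<noteq> 0 \<longrightarrow> (\<exists>b\<in>B. pairing b v \<noteq> c)) \<and>
     (\<forall>b\<in>B. 0 \<le> a b) \<and> sum a B = real k + 1 \<and>
     (\<Sum>b\<in>B. a b *\<^sub>R lattice_vec b) = lattice_vec x)"
  have pair: "pairing x v = (\<Sum>b\<in>B. a b * pairing b v)" if "cell B a" for B a v
  proof -
    have "pairing x v = (\<Sum>b\<in>B. a b *\<^sub>R lattice_vec b) \<bullet> v"
      using that by (simp add: pairing_eq_inner cell_def)
    then show ?thesis by (simp add: inner_sum_left pairing_eq_inner)
  qed
  \<comment> \<open>If \<open>a b\<close> were at least 1, subtracting \<open>b\<close> would leave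
    nonnegative weights of sum \<open>k\<close>, so that \<open>x - b\<close> would lie in
    \<open>S k\<close>.\<close>
  have less_one: "a b < 1" if B: "cell B a" "b \<in> B" for B a b
  proof (rule ccontr)
    assume "\<not> a b < 1"
    then have ge: "a b \<ge> 1" by simp
    have fin: "finite B" using B by (simp add: cell_def)
    have "real k * c \<le> pairing (x - b) v" if "(v, c) \<in> D" for v c
    proof -
      have *: "(\<Sum>b'\<in>B. (a b' - (if b' = b then 1 else 0)) * c)
          \<le> (\<Sum>b'\<in>B. (a b' - (if b' = b then 1 else 0)) * pairing b' v)"
      proof (rule sum_mono)
        fix b' assume b': "b' \<in> B"
        have "c \<le> pairing b' v" using B(1) b' that S[of 1] by (auto simp: cell_def)
        moreover have "0 \<le> a b' - (if b' = b then 1 else 0)"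
          using B(1) b' ge by (auto simp: cell_def)
        ultimately show "(a b' - (if b' = b then 1 else 0)) * c
            \<le> (a b' - (if b' = b then 1 else 0)) * pairing b' v"
          by (rule mult_left_mono)
      qed
      have "(\<Sum>b'\<in>B. (a b' - (if b' = b then 1 else 0)) * c) = real k * c"
        using B fin by (simp add: left_diff_distrib sum_subtractf if_distrib[of "\<lambda>z. z * c"] cong: if_cong)
          (simp add: cell_def flip: sum_distrib_right, simp add: algebra_simps)
      moreover have "(\<Sum>b'\<in>B. (a b' - (if b' = b then 1 else 0)) * pairing b' v) = pairing (x - b) v"
        using B fin by (simp add: left_diff_distrib sum_subtractf if_distrib[of "\<lambda>z. z * _"] pairing_diff pair[OF B(1)] cong: if_cong)
      ultimately show ?thesis using * by simp
    qed
    then have "x - b \<in> S k" by (auto simp: S)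
    with neg B show False by (auto simp: cell_def)
  qed
  \<comment> \<open>The weights \<open>1 - a b\<close> are positive and sum to
    \<open>(n + 1) - (k + 1)\<close>. Strictness holds because some vertex lies off the hyperplane
    of each inequality.\<close>
  have interior: "real n - real k > 0 \<and> (\<forall>(v, c)\<in>D. (real n - real k) * c < pairing (\<Sum>B - x) v)"
    if B: "cell B a" for B a
  proof
    have fin: "finite B" using B by (simp add: cell_def)
    have ne: "B \<noteq> {}" using B by (auto simp: cell_def)
    have pos: "0 < (\<Sum>b\<in>B. 1 - a b)"
      using fin ne less_one[OF B] by (intro sum_pos) auto
    have eq: "(\<Sum>b\<in>B. 1 - a b) = real n - real k"
      using B by (simp add: sum_subtractf cell_def)
    with pos show "real n - real k > 0" by simp
    show "\<forall>(v, c)\<in>D. (real n - real k) * c < pairing (\<Sum>B - x) v"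
    proof clarify
      fix v c assume vc: "(v, c) \<in> D"
      obtain b0 where b0: "b0 \<in> B" "pairing b0 v \<noteq> c"
        using B D[OF vc] unfolding cell_def by metis
      have ge: "c \<le> pairing b v" if "b \<in> B" for b
        using B that vc S[of 1] by (auto simp: cell_def)
      have "(\<Sum>b\<in>B. (1 - a b) * c) < (\<Sum>b\<in>B. (1 - a b) * pairing b v)"
      proof (rule sum_strict_mono_ex1[OF fin])
        show "\<forall>b\<in>B. (1 - a b) * c \<le> (1 - a b) * pairing b v"
          using ge less_one[OF B] by (auto intro!: mult_left_mono less_imp_le)
        show "\<exists>b\<in>B. (1 - a b) * c < (1 - a b) * pairing b v"
          using ge[OF b0(1)] b0 less_one[OF B b0(1)] by (intro bexI[of _ b0]) auto
      qed
      also have "\<dots> = pairing (\<Sum>B - x) v"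
        by (simp add: pairing_diff pairing_sum pair[OF B] left_diff_distrib sum_subtractf)
      finally show "(real n - real k) * c < pairing (\<Sum>B - x) v"
        by (simp only: eq flip: sum_distrib_right)
    qed
  qed
  obtain B0 u0 where B0: "finite B0" "B0 \<subseteq> lattice_vec ` S 1" "card B0 = n + 1"
      "affine hull B0 = UNIV" "\<And>b. b \<in> B0 \<Longrightarrow> 0 \<le> u0 b" "sum u0 B0 = 1"
      "(\<Sum>b\<in>B0. u0 b *\<^sub>R b) = (1 / real (k + 1)) *\<^sub>R lattice_vec x"
    using affine_basis_of_convex_hull[OF hull[OF _ x] aff] unfolding n_def by auto
  obtain B where B: "B \<subseteq> S 1" "B0 = lattice_vec ` B"
    using B0(2) subset_imageE by metis
  have inj: "inj_on lattice_vec B" for B :: "'n lattice set"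
    using inj_lattice_vec inj_on_subset by blast
  define a where "a = (\<lambda>b. real (k + 1) * u0 (lattice_vec b))"
  have finB: "finite B" using B B0(1) inj finite_image_iff by metis
  have sB: "cell B a"
  proof -
    have "card B = n + 1" using B0(3) B(2) inj card_image by metis
    moreover have "\<exists>b\<in>B. pairing b v \<noteq> c" if "v \<noteq> 0" for v c
    proof (rule ccontr)
      assume "\<not> ?thesis"
      then have "B0 \<subseteq> {y. v \<bullet> y = c}" using B by (auto simp: pairing_eq_inner inner_commute)
      then have "affine hull B0 \<subseteq> {y. v \<bullet> y = c}"
        using affine_hyperplane by (rule hull_minimal)
      then have *: "\<And>y. v \<bullet> y = c" using B0(4) by auto
      from *[of 0] *[of v] that show False by simp
    qed
    moreover have "sum a B = real k + 1"
      using B0(6) unfolding B(2) a_def by (simp add: sum.reindex[OF inj] flip: sum_distrib_left)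
    moreover have "(\<Sum>b\<in>B. a b *\<^sub>R lattice_vec b) = lattice_vec x"
    proof -
      have "(\<Sum>b\<in>B. a b *\<^sub>R lattice_vec b) = real (k + 1) *\<^sub>R (\<Sum>b\<in>B0. u0 b *\<^sub>R b)"
        unfolding B(2) a_def by (simp add: sum.reindex[OF inj] scaleR_right.sum)
      also have "\<dots> = lattice_vec x" unfolding B0(7) by simp
      finally show ?thesis .
    qed
    ultimately show ?thesis
      using finB B B0(5) by (auto simp: cell_def a_def)
  qed
  note iB = interior[OF sB]
  have kn: "k < n" using iB by linarith
  show False
  proof (cases "k = 1")
    case False
    then have k2: "k \<ge> 2" using k by simp
    \<comment> \<open>The complementary point has height \<open>n - k\<close>, so
      \<open>k - 1\<close> copies of \<open>p\<close> bring it to \<open>n - 1\<close>. As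
      \<open>k - 1\<close> is positive here, different \<open>p\<close> give different
      points.\<close>
    have in_I: "(\<Sum>B - x) + (\<Sum>i<k-1. p) \<in> I (n - 1)" if p: "p \<in> S 1" for p
    proof -
      have "real (n - 1) * c < pairing ((\<Sum>B - x) + (\<Sum>i<k-1. p)) v" if vc: "(v, c) \<in> D" for v c
      proof -
        have 1: "(real n - real k) * c < pairing (\<Sum>B - x) v" using iB vc by auto
        have "c \<le> pairing p v" using p vc S[of 1] by auto
        then have "real (k - 1) * c \<le> real (k - 1) * pairing p v" by (simp add: mult_left_mono)
        also have "\<dots> = pairing (\<Sum>i<k-1. p) v" unfolding pairing_sum by simp
        finally have "(real n - real k + real (k - 1)) * c < pairing ((\<Sum>B - x) + (\<Sum>i<k-1. p)) v"
          using 1 unfolding pairing_add distrib_right by linarith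
        moreover have "real n - real k + real (k - 1) = real (n - 1)" using kn k by simp
        ultimately show ?thesis by simp
      qed
      then show ?thesis by (auto simp: I)
    qed
    have "\<not> card (S 1) \<le> Suc 0" using many by simp
    then obtain p q where pq: "p \<in> S 1" "q \<in> S 1" "p \<noteq> q"
      unfolding card_le_Suc0_iff_eq[OF finV] by blast
    have "(\<Sum>i<k-1. p) = (\<Sum>i<k-1. q)"
      using unique[OF in_I[OF pq(1), unfolded n_def] in_I[OF pq(2), unfolded n_def]] by simp
    from arg_cong[OF this, of lattice_vec]
    have "real (k - 1) *\<^sub>R lattice_vec p = real (k - 1) *\<^sub>R lattice_vec q"
      unfolding lattice_vec_sum by (simp only: sum_constant_scaleR card_lessThan)
    then have "lattice_vec p = lattice_vec q" using k2 by simp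
    with pq(3) inj_lattice_vec show False by (auto dest: injD)
  next
    case True
    have "\<not> S 1 \<subseteq> B"
    proof
      assume "S 1 \<subseteq> B"
      then have "card (S 1) \<le> card B" using finB card_mono by blast
      with many sB show False by (simp add: cell_def n_def)
    qed
    then obtain u where u: "u \<in> S 1" "u \<notin> B" by blast
    have "lattice_vec u \<in> affine hull B0" using B0(4) by simp
    then obtain d0 where d0: "sum d0 B0 = 1" "(\<Sum>b\<in>B0. d0 b *\<^sub>R b) = lattice_vec u"
      unfolding affine_hull_finite[OF B0(1)] by blast
    define d where "d = d0 \<circ> lattice_vec"
    have d1: "sum d B = 1" using d0(1) unfolding B(2) d_def by (simp add: sum.reindex[OF inj])
    have du: "(\<Sum>b\<in>B. d b *\<^sub>R lattice_vec b) = lattice_vec u"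
      using d0(2) unfolding B(2) d_def by (simp add: sum.reindex[OF inj])
    \<comment> \<open>The minimum ratio test of the simplex method, with \<open>d\<close> the affine
      coordinates of \<open>u\<close>. Giving \<open>u\<close> the weight \<open>t\<close> and
      replacing \<open>a\<close> by \<open>a - t * d\<close> does not change \<open>x\<close>. The
      minimal ratio \<open>t\<close> keeps all weights nonnegative and makes that of
      \<open>b0\<close> zero, so \<open>u\<close> can take the place of \<open>b0\<close>.\<close>
    define P where "P = {b\<in>B. d b > 0}"
    have "P \<noteq> {}"
    proof
      assume "P = {}"
      then have "sum d B \<le> 0" unfolding P_def by (intro sum_nonpos) force
      with d1 show False by simp
    qed
    moreover have finP: "finite P" using finB unfolding P_def by simp
    ultimately obtain b0 where b0: "b0 \<in> P" "\<And>b. b \<in> P \<Longrightarrow> a b0 / d b0 \<le> a b / d b"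
      using ex_is_arg_min_if_finite[of P "\<lambda>b. a b / d b"] by (auto simp: is_arg_min_linorder)
    define t where "t = a b0 / d b0"
    have b0B: "b0 \<in> B" "d b0 > 0" using b0 by (auto simp: P_def)
    have a0: "0 \<le> a b" if "b \<in> B" for b using sB that by (simp add: cell_def)
    have t0: "t \<ge> 0" using a0 b0B by (simp add: t_def)
    have nonneg: "0 \<le> a b - t * d b" if b: "b \<in> B" for b
    proof (cases "d b > 0")
      case True
      then have "t \<le> a b / d b" using b0(2) b by (auto simp: P_def t_def)
      with True show ?thesis by (simp add: field_simps)
    next
      case False
      then have "t * d b \<le> 0" using t0 by (simp add: mult_nonneg_nonpos)
      with a0[OF b] show ?thesis by linarith
    qed
    have zero: "a b0 - t * d b0 = 0" using b0B by (simp add: t_def)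
    define B' where "B' = insert u (B - {b0})"
    define a' where "a' = (\<lambda>b. if b = u then t else a b - t * d b)"
    have u_nB: "u \<notin> B - {b0}" using u by simp
    have sum_B': "(\<Sum>b\<in>B'. f b) = f u + (\<Sum>b\<in>B - {b0}. f b)" for f :: "'n lattice \<Rightarrow> 'z::comm_monoid_add"
      unfolding B'_def using finB u_nB by simp
    have a'_B: "a' b = a b - t * d b" if "b \<in> B" for b using that u by (auto simp: a'_def)
    have a'_u: "a' u = t" by (simp add: a'_def)
    have "cell B' a'"
    proof -
      have "card B' = n + 1"
        using sB finB b0B u_nB by (simp add: B'_def cell_def card_Diff_singleton)
      moreover have "\<exists>b\<in>B'. pairing b v \<noteq> c" if "v \<noteq> 0" for v c
      proof (rule ccontr)
        assume "\<not> ?thesis"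
        then have c: "pairing u v = c" "\<And>b. b \<in> B - {b0} \<Longrightarrow> pairing b v = c" by (auto simp: B'_def)
        \<comment> \<open>As \<open>d b0\<close> is positive, the value of the functional at
          \<open>b0\<close> is determined by its values at \<open>u\<close> and at the remaining
          vertices, so it would be constant on all of \<open>B\<close>.\<close>
        have "c = (\<Sum>b\<in>B. d b *\<^sub>R lattice_vec b) \<bullet> v" unfolding du c(1)[symmetric] pairing_eq_inner ..
        also have "\<dots> = (\<Sum>b\<in>B. d b * pairing b v)" by (simp add: inner_sum_left pairing_eq_inner)
        also have "\<dots> = d b0 * pairing b0 v + (\<Sum>b\<in>B-{b0}. d b * c)"
          using finB b0B c(2) by (subst sum.remove[of B b0]) auto
        also have "(\<Sum>b\<in>B-{b0}. d b * c) = (1 - d b0) * c"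
          using d1 finB b0B by (simp add: sum.remove[of B b0 d] flip: sum_distrib_right)
        finally have "d b0 * (pairing b0 v - c) = 0"
          unfolding right_diff_distrib left_diff_distrib by linarith
        then have "pairing b0 v = c" using b0B by simp
        with c have "\<forall>b\<in>B. pairing b v = c" by blast
        with sB \<open>v \<noteq> 0\<close> show False unfolding cell_def by blast
      qed
      moreover have "sum a' B' = real k + 1"
      proof -
        have "sum a' B' = t + (\<Sum>b\<in>B - {b0}. a b - t * d b)"
          unfolding sum_B' by (auto simp: a'_B a'_u intro!: sum.cong)
        also have "\<dots> = t + (\<Sum>b\<in>B. a b - t * d b)"
          using finB b0B zero by (simp add: sum.remove[of B b0])
        also have "\<dots> = real k + 1"
          using sB d1 by (simp add: sum_subtractf cell_def flip: sum_distrib_left)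
        finally show ?thesis .
      qed
      moreover have "(\<Sum>b\<in>B'. a' b *\<^sub>R lattice_vec b) = lattice_vec x"
      proof -
        have "(\<Sum>b\<in>B'. a' b *\<^sub>R lattice_vec b)
            = t *\<^sub>R lattice_vec u + (\<Sum>b\<in>B - {b0}. (a b - t * d b) *\<^sub>R lattice_vec b)"
          unfolding sum_B' by (auto simp: a'_B a'_u intro!: sum.cong)
        also have "\<dots> = t *\<^sub>R lattice_vec u + (\<Sum>b\<in>B. (a b - t * d b) *\<^sub>R lattice_vec b)"
          using finB b0B zero by (simp add: sum.remove[of B b0])
        also have "(\<Sum>b\<in>B. (a b - t * d b) *\<^sub>R lattice_vec b) = lattice_vec x - t *\<^sub>R lattice_vec u"
          using sB unfolding du[symmetric] scaleR_right.sum
          by (simp add: scaleR_left_diff_distrib sum_subtractf cell_def)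
        finally show ?thesis by simp
      qed
      ultimately show ?thesis
        using finB u B(1) t0 nonneg by (auto simp: cell_def B'_def a'_def)
    qed
    from interior[OF this] iB have "\<Sum>B - x \<in> I (n - 1)" "\<Sum>B' - x \<in> I (n - 1)"
      using True kn by (auto simp: I of_nat_diff)
    then have "\<Sum>B - x = \<Sum>B' - x" using unique n_def by blast
    then have "\<Sum>B' = \<Sum>B" by (metis diff_add_cancel)
    moreover have "\<Sum>B' = u + \<Sum>(B - {b0})" using sum_B'[of "\<lambda>b. b"] by simp
    moreover have "\<Sum>B = b0 + \<Sum>(B - {b0})" using finB b0B by (simp add: sum.remove[of B b0])
    ultimately have "u = b0" by simp
    with u b0B show False by simp
  qed
qed

section \<open>Polynomials over subrings with greatest common divisors\<close>

locale subring_set =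
  fixes A :: "'a::comm_ring_1 set"
  assumes one_mem: "1 \<in> A"
    and diff_mem: "a \<in> A \<Longrightarrow> b \<in> A \<Longrightarrow> a - b \<in> A"
    and mult_mem: "a \<in> A \<Longrightarrow> b \<in> A \<Longrightarrow> a * b \<in> A"
begin

lemma zero_mem: "0 \<in> A"
  using diff_mem[OF one_mem one_mem] by simp

lemma uminus_mem: "a \<in> A \<Longrightarrow> - a \<in> A"
  using diff_mem[OF zero_mem] by simp

lemma add_mem: "a \<in> A \<Longrightarrow> b \<in> A \<Longrightarrow> a + b \<in> A"
  using diff_mem[OF _ uminus_mem, of a b] by simp

lemma sum_mem: "(\<And>x. x \<in> X \<Longrightarrow> f x \<in> A) \<Longrightarrow> sum f X \<in> A"
  by (induction X rule: infinite_finite_induct) (auto intro: zero_mem add_mem)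

lemma power_mem: "a \<in> A \<Longrightarrow> a ^ n \<in> A"
  by (induction n) (auto intro: one_mem mult_mem)

lemma prod_mem: "(\<And>x. x \<in> X \<Longrightarrow> f x \<in> A) \<Longrightarrow> prod f X \<in> A"
  by (induction X rule: infinite_finite_induct) (auto intro: one_mem mult_mem)

lemmas mem_intros = zero_mem one_mem uminus_mem add_mem diff_mem mult_mem sum_mem power_mem prod_mem

definition divides :: "'a \<Rightarrow> 'a \<Rightarrow> bool" where
  "divides a b \<longleftrightarrow> (\<exists>c\<in>A. b = a * c)"

lemma dividesI: "c \<in> A \<Longrightarrow> b = a * c \<Longrightarrow> divides a b"
  unfolding divides_def by blast

lemma divides_refl: "divides a a"
  by (rule dividesI[OF one_mem]) simp

lemma divides_zero: "divides a 0"
  by (rule dividesI[OF zero_mem]) simp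

lemma divides_trans: "divides a b \<Longrightarrow> divides b c \<Longrightarrow> divides a c"
  unfolding divides_def by (metis mult.assoc mult_mem)

lemma divides_mult: "divides a b \<Longrightarrow> c \<in> A \<Longrightarrow> divides a (b * c)"
  unfolding divides_def by (metis mult.assoc mult_mem)

lemma divides_mult2: "divides a b \<Longrightarrow> c \<in> A \<Longrightarrow> divides a (c * b)"
  using divides_mult by (simp add: mult.commute)

lemma divides_mult_mono:
  assumes "divides a b" "divides c d"
  shows "divides (a * c) (b * d)"
proof -
  obtain x y where "x \<in> A" "y \<in> A" "b = a * x" "d = c * y"
    using assms by (auto simp: divides_def)
  then show ?thesis by (intro dividesI[of "x * y"]) (auto intro: mult_mem simp: mult_ac)
qed

lemma divides_diff: "divides a b \<Longrightarrow> divides a c \<Longrightarrow> divides a (b - c)"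
  unfolding divides_def by (metis diff_mem right_diff_distrib)

lemma divides_add: "divides a b \<Longrightarrow> divides a c \<Longrightarrow> divides a (b + c)"
  unfolding divides_def by (metis add_mem distrib_left)

lemma divides_sum: "(\<And>x. x \<in> X \<Longrightarrow> divides a (f x)) \<Longrightarrow> divides a (sum f X)"
  by (induction X rule: infinite_finite_induct) (auto intro: divides_zero divides_add)

end

locale gcd_subring = subring_set A for A :: "'a::idom set" +
  assumes gcd_exists: "a \<in> A \<Longrightarrow> b \<in> A \<Longrightarrow>
    \<exists>d\<in>A. divides d a \<and> divides d b \<and> (\<forall>e\<in>A. divides e a \<longrightarrow> divides e b \<longrightarrow> divides e d)"
begin

lemma divides_cancel: "p \<noteq> 0 \<Longrightarrow> divides (p * a) (p * b) \<longleftrightarrow> divides a b"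
  unfolding divides_def by (auto simp: mult.assoc)

text \<open>In a domain with gcds, gcd(p a, p b) = p gcd(a, b). A gcd \<open>c\<close> of the
  multiples is divisible by \<open>p * d\<close>, say \<open>c = p * d * t\<close>; then
  \<open>d * t\<close> divides \<open>a\<close> and \<open>b\<close>, hence \<open>d\<close>, so
  that \<open>c\<close> divides \<open>p * d\<close>.\<close>

lemma strong_gcd_exists:
  assumes "a \<in> A" "b \<in> A"
  shows "\<exists>d\<in>A. divides d a \<and> divides d b \<and>
    (\<forall>e\<in>A. \<forall>p\<in>A. divides e (p * a) \<longrightarrow> divides e (p * b) \<longrightarrow> divides e (p * d))"
proof -
  obtain d where d: "d \<in> A" "divides d a" "divides d b"
      "\<And>e. e \<in> A \<Longrightarrow> divides e a \<Longrightarrow> divides e b \<Longrightarrow> divides e d"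
    using gcd_exists[OF assms] by blast
  have "divides e (p * d)" if e: "e \<in> A" "p \<in> A" "divides e (p * a)" "divides e (p * b)" for e p
  proof (cases "p = 0")
    case False
    obtain c where c: "c \<in> A" "divides c (p * a)" "divides c (p * b)"
        "\<And>e. e \<in> A \<Longrightarrow> divides e (p * a) \<Longrightarrow> divides e (p * b) \<Longrightarrow> divides e c"
      using gcd_exists[OF mult_mem[OF e(2) assms(1)] mult_mem[OF e(2) assms(2)]] by blast
    have "divides (p * d) c"
      using d e by (intro c(4)) (auto intro: mult_mem simp: divides_cancel False)
    then obtain t where t: "t \<in> A" "c = p * (d * t)" by (auto simp: divides_def mult.assoc)
    have "divides (d * t) a" "divides (d * t) b"
      using c(2,3) False unfolding t by (simp_all only: divides_cancel[OF False])
    then have "divides (d * t) d" using d(1) t(1) d(4) mult_mem by blast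
    then have "divides c (p * d)" using False by (simp add: t(2) divides_cancel)
    then show ?thesis using c(4) e divides_trans by blast
  qed (simp add: divides_zero)
  with d show ?thesis by blast
qed

text \<open>The multiplier \<open>p\<close> is carried along because both
  \<open>primitive_divides_const\<close> and \<open>invertible_ideal_principal\<close> depend on it.
  The empty set has gcd 0.\<close>

lemma finite_gcd_exists:
  assumes "finite F" "F \<subseteq> A"
  shows "\<exists>d\<in>A. (\<forall>x\<in>F. divides d x) \<and>
    (\<forall>e\<in>A. \<forall>p\<in>A. (\<forall>x\<in>F. divides e (p * x)) \<longrightarrow> divides e (p * d))"
  using assms
proof (induction F rule: finite_induct)
  case empty
  show ?case by (rule bexI[of _ 0]) (auto simp: divides_zero zero_mem)
next
  case (insert x F)
  then obtain d where d: "d \<in> A" "\<forall>x\<in>F. divides d x"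
      "\<forall>e\<in>A. \<forall>p\<in>A. (\<forall>x\<in>F. divides e (p * x)) \<longrightarrow> divides e (p * d)"
    by auto
  obtain c where c: "c \<in> A" "divides c x" "divides c d"
      "\<forall>e\<in>A. \<forall>p\<in>A. divides e (p * x) \<longrightarrow> divides e (p * d) \<longrightarrow> divides e (p * c)"
    using strong_gcd_exists[of x d] insert d by blast
  then show ?case using d divides_trans by (intro bexI[of _ c]) auto
qed

section \<open>Contents, Gauss's lemma and gcds of polynomials in one more variable\<close>

definition polys :: "'a poly set" where
  "polys = {p. \<forall>i. coeff p i \<in> A}"

definition primitive :: "'a poly \<Rightarrow> bool" where
  "primitive p \<longleftrightarrow> p \<in> polys \<and> (\<forall>e\<in>A. (\<forall>i. divides e (coeff p i)) \<longrightarrow> divides e 1)"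

sublocale poly: subring_set polys
proof
  fix p q assume "p \<in> polys" "q \<in> polys"
  then show "p - q \<in> polys" "p * q \<in> polys"
    by (auto simp: polys_def coeff_mult intro!: mem_intros)
qed (auto simp: polys_def zero_mem one_mem)

lemma smult_mem: "c \<in> A \<Longrightarrow> p \<in> polys \<Longrightarrow> smult c p \<in> polys"
  by (auto simp: polys_def mult_mem)

lemma monom_mem: "c \<in> A \<Longrightarrow> monom c n \<in> polys"
  by (auto simp: polys_def zero_mem)

lemma primitive_nonzero: "primitive p \<Longrightarrow> p \<noteq> 0"
  using zero_mem by (force simp: primitive_def divides_def)

text \<open>The constant is a gcd \<open>d\<close> of the coefficients. If \<open>e\<close> divides
  all quotients by \<open>d\<close>, then \<open>d * e\<close> divides all coefficients and hence
  \<open>d\<close>, so \<open>e\<close> is a unit.\<close>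

lemma smult_primitive_exists:
  assumes "p \<in> polys" "p \<noteq> 0"
  shows "\<exists>c q. c \<in> A \<and> c \<noteq> 0 \<and> primitive q \<and> p = smult c q \<and> degree q = degree p"
proof -
  define F where "F = coeff p ` {..degree p}"
  have F: "finite F" "F \<subseteq> A" using assms(1) by (auto simp: F_def primitive_def polys_def)
  obtain d where d: "d \<in> A" "\<forall>x\<in>F. divides d x"
      "\<And>e q. e \<in> A \<Longrightarrow> q \<in> A \<Longrightarrow> (\<forall>x\<in>F. divides e (q * x)) \<Longrightarrow> divides e (q * d)"
    using finite_gcd_exists[OF F] by blast
  have "lead_coeff p \<in> F" by (simp add: F_def)
  with d(2) assms(2) have d0: "d \<noteq> 0" by (force simp: divides_def)
  have "\<forall>i. \<exists>c\<in>A. coeff p i = d * c"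
  proof
    fix i
    show "\<exists>c\<in>A. coeff p i = d * c"
    proof (cases "i \<le> degree p")
      case True
      then show ?thesis using d(2) unfolding F_def divides_def by blast
    next
      case False
      then show ?thesis by (intro bexI[of _ 0]) (auto simp: coeff_eq_0 zero_mem)
    qed
  qed
  then obtain c where c: "\<And>i. c i \<in> A" "\<And>i. coeff p i = d * c i" by metis
  have "\<forall>\<^sub>\<infinity>i. c i = 0"
    using MOST_coeff_eq_0[of p] c(2) d0 by simp
  then have q: "coeff (Abs_poly c) = c" by (simp add: Abs_poly_inverse)
  have eq: "p = smult d (Abs_poly c)" by (rule poly_eqI) (simp add: q c)
  have "primitive (Abs_poly c)"
    unfolding primitive_def
  proof (intro conjI ballI impI)
    show "Abs_poly c \<in> polys" by (simp add: polys_def q c)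
    fix e assume e: "e \<in> A" "\<forall>i. divides e (coeff (Abs_poly c) i)"
    then have "\<forall>x\<in>F. divides (d * e) (1 * x)"
      unfolding F_def by (auto simp: q c divides_cancel d0)
    then have "divides (d * e) (d * 1)" using d(3)[of "d * e" 1] e d(1) by (simp add: mult_mem one_mem)
    then show "divides e 1" by (simp only: divides_cancel[OF d0])
  qed
  moreover have "degree (Abs_poly c) = degree p" using eq d0 by simp
  ultimately show ?thesis using eq d(1) d0 by blast
qed

text \<open>A gcd of the coefficients of \<open>p\<close> is a unit, and by the strong form of the
  gcd \<open>e\<close> divides \<open>c\<close> times it.\<close>

lemma primitive_divides_const:
  assumes "primitive p" "e \<in> A" "c \<in> A" "\<And>i. divides e (c * coeff p i)"
  shows "divides e c"
proof -
  define F where "F = coeff p ` {..degree p}"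
  have F: "finite F" "F \<subseteq> A" using assms(1) by (auto simp: F_def primitive_def polys_def)
  obtain d where d: "d \<in> A" "\<forall>x\<in>F. divides d x"
      "\<And>e q. e \<in> A \<Longrightarrow> q \<in> A \<Longrightarrow> (\<forall>x\<in>F. divides e (q * x)) \<Longrightarrow> divides e (q * d)"
    using finite_gcd_exists[OF F] by blast
  have "divides d (coeff p i)" for i
    using d(2) by (cases "i \<le> degree p") (auto simp: F_def coeff_eq_0 divides_zero)
  then have "divides d 1" using assms(1) d(1) by (auto simp: primitive_def)
  moreover have "divides e (c * d)" using d(3) assms by (auto simp: F_def)
  ultimately show ?thesis
    using divides_mult_mono[OF divides_refl, of d 1 c] divides_trans[of e "c * d" c] by simp
qed

text \<open>
  Gauss's lemma without prime factorizations: a common divisor of the coefficients of \<open>f g\<close> that divides the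
  leading coefficient of \<open>f\<close> also divides \<open>(f - lead term) g\<close>, to which induction applies.
\<close>

lemma coprime_lead_coeff:
  assumes f: "primitive f" and g: "primitive g" and d: "d \<in> A" "\<And>i. divides d (coeff (f * g) i)"
    and IH: "\<And>f1. primitive f1 \<Longrightarrow> degree f1 < degree f \<Longrightarrow> primitive (f1 * g)"
    and e: "e \<in> A" "divides e d" "divides e (lead_coeff f)"
  shows "divides e 1"
proof -
  define f0 where "f0 = f - monom (lead_coeff f) (degree f)"
  have fg: "f \<in> polys" "g \<in> polys" using f g by (auto simp: primitive_def)
  have lc: "lead_coeff f \<in> A" using fg by (auto simp: polys_def)
  have f0: "f0 \<in> polys" unfolding f0_def by (intro poly.diff_mem monom_mem fg lc)
  have "divides e (coeff f0 i)" for i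
  proof (cases "f0 = 0")
    case False
    then obtain c f1 where c: "c \<in> A" "c \<noteq> 0" "primitive f1" "f0 = smult c f1" "degree f1 = degree f0"
      using smult_primitive_exists[OF f0] by blast
    have deg: "degree f0 < degree f"
    proof -
      have "degree f0 \<le> degree f" unfolding f0_def
        by (intro degree_diff_le) (auto simp: degree_monom_le)
      moreover have "coeff f0 (degree f) = 0" by (simp add: f0_def)
      ultimately show ?thesis using False by (metis eq_zero_or_degree_less degree_0 le_neq_implies_less leading_coeff_0_iff)
    qed
    have prim: "primitive (f1 * g)" by (rule IH[OF c(3)]) (simp only: c(5) deg)
    have "divides e (coeff (f0 * g) i)" for i
    proof -
      have "f0 * g = f * g - smult (lead_coeff f) (monom 1 (degree f) * g)"
        by (simp add: f0_def left_diff_distrib smult_monom flip: mult_smult_left)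
      moreover have "divides e (lead_coeff f * coeff (monom 1 (degree f) * g) i)"
        using e(3) fg(2) by (intro divides_mult) (auto simp: coeff_monom_mult polys_def zero_mem)
      ultimately show ?thesis
        using divides_trans[OF e(2) d(2)[of i]] by (simp add: divides_diff)
    qed
    then have "divides e (c * coeff (f1 * g) i)" for i using c(4) by simp
    then have "divides e c" using primitive_divides_const[OF prim e(1) c(1)] by blast
    then show ?thesis using c by (auto simp: primitive_def polys_def intro: divides_mult)
  qed (simp add: divides_zero)
  moreover have "divides e (if i = degree f then lead_coeff f else 0)" for i
    using e(3) by (simp add: divides_zero)
  ultimately have "divides e (coeff f0 i + (if i = degree f then lead_coeff f else 0))" for i
    using divides_add by blast
  moreover have "coeff f0 i + (if i = degree f then lead_coeff f else 0) = coeff f i" for i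
    by (simp add: f0_def)
  ultimately have "divides e (coeff f i)" for i
    by metis
  then show ?thesis using f e(1) by (auto simp: primitive_def)
qed

text \<open>Let \<open>d\<close> divide all coefficients of the product. By
  \<open>coprime_lead_coeff\<close> a gcd of \<open>d\<close> and the leading coefficient of
  \<open>f\<close> is a unit. Since \<open>d\<close> divides the product of the two leading
  coefficients, it divides that of \<open>g\<close>, and the same lemma with the factors exchanged
  makes \<open>d\<close> a unit.\<close>

lemma primitive_mult:
  assumes "primitive f" "primitive g"
  shows "primitive (f * g)"
  using assms
proof (induction "degree f + degree g" arbitrary: f g rule: less_induct)
  case less
  have fg: "f \<in> polys" "g \<in> polys" using less.prems by (auto simp: primitive_def)
  show ?case
    unfolding primitive_def
  proof (intro conjI ballI impI)
    show "f * g \<in> polys" using fg by (rule poly.mult_mem)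
    fix d assume d: "d \<in> A" "\<forall>i. divides d (coeff (f * g) i)"
    have lc: "lead_coeff f \<in> A" "lead_coeff g \<in> A" using fg by (auto simp: polys_def)
    have 1: "divides e 1" if "e \<in> A" "divides e d" "divides e (lead_coeff f)" for e
      using coprime_lead_coeff[OF less.prems d(1)] d(2) less.hyps less.prems that by auto
    have 2: "divides e 1" if "e \<in> A" "divides e d" "divides e (lead_coeff g)" for e
      using coprime_lead_coeff[OF less.prems(2,1) d(1), of e] d(2) less.hyps less.prems that
      by (auto simp: mult.commute)
    obtain e where e: "e \<in> A" "divides e d" "divides e (lead_coeff f)"
        "\<And>c p. c \<in> A \<Longrightarrow> p \<in> A \<Longrightarrow> divides c (p * d) \<Longrightarrow> divides c (p * lead_coeff f) \<Longrightarrow> divides c (p * e)"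
      using strong_gcd_exists[OF d(1) lc(1)] by blast
    have "divides d (lead_coeff g * lead_coeff f)"
      using d(2) by (metis lead_coeff_mult mult.commute)
    then have "divides d (lead_coeff g * e)"
      using e(4) d(1) lc divides_mult2[OF divides_refl] by blast
    moreover have "divides (lead_coeff g * e) (lead_coeff g * 1)"
      using 1[OF e(1-3)] divides_mult_mono divides_refl by blast
    ultimately have "divides d (lead_coeff g)"
      using divides_trans[of d "lead_coeff g * e" "lead_coeff g * 1"] by simp
    then show "divides d 1" using 2[OF d(1) divides_refl] by blast
  qed
qed

lemma primitive_factor:
  assumes "primitive p" "q \<in> polys" "poly.divides q p"
  shows "primitive q"
  unfolding primitive_def
proof (intro conjI ballI impI)
  fix e assume e: "e \<in> A" "\<forall>i. divides e (coeff q i)"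
  obtain r where r: "r \<in> polys" "p = q * r" using assms(3) by (auto simp: poly.divides_def)
  have "divides e (coeff p i)" for i
    using e r(1) by (auto simp: r(2) coeff_mult polys_def intro!: divides_sum divides_mult)
  then show "divides e 1" using assms(1) e by (auto simp: primitive_def)
qed fact

text \<open>Comparison of contents. With the contents of quotient and \<open>h\<close> split off,
  \<open>c * c2\<close> times a primitive polynomial equals \<open>c'\<close> times the primitive
  polynomial \<open>e * q1\<close>; so \<open>c * c2\<close> and \<open>c'\<close> differ by a unit
  \<open>t\<close>, and \<open>c\<close> can be cancelled.\<close>

lemma primitive_divides_smult:
  assumes e: "primitive e" and c: "c \<in> A" "c \<noteq> 0" and h: "h \<in> polys"
    and dvd: "poly.divides e (smult c h)"
  shows "poly.divides e h"
proof (cases "h = 0")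
  case False
  obtain q where q: "q \<in> polys" "smult c h = e * q" using dvd by (auto simp: poly.divides_def)
  then have "q \<noteq> 0" using c False by auto
  then obtain c' q1 where q1: "c' \<in> A" "c' \<noteq> 0" "primitive q1" "q = smult c' q1"
    using smult_primitive_exists q by blast
  obtain c2 h1 where h1: "c2 \<in> A" "c2 \<noteq> 0" "primitive h1" "h = smult c2 h1"
    using smult_primitive_exists[OF h False] by blast
  have prim: "primitive (e * q1)" using primitive_mult e q1 by blast
  have eq: "smult (c * c2) h1 = smult c' (e * q1)" using q(2) q1 h1 by simp
  have cc: "c * c2 \<in> A" using c h1 by (simp add: mult_mem)
  have "divides c' (c * c2 * coeff h1 i)" for i
  proof -
    have "c * c2 * coeff h1 i = c' * coeff (e * q1) i" using arg_cong[OF eq, of "\<lambda>p. coeff p i"] by simp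
    moreover have "coeff (e * q1) i \<in> A" using prim by (auto simp: primitive_def polys_def)
    ultimately show ?thesis by (auto intro: dividesI)
  qed
  then have "divides c' (c * c2)" using primitive_divides_const[OF h1(3) q1(1) cc] by blast
  then obtain t where t: "t \<in> A" "c * c2 = c' * t" by (auto simp: divides_def)
  have eq2: "smult t h1 = e * q1"
  proof -
    have "smult c' (smult t h1) = smult c' (e * q1)" using eq t by simp
    then show ?thesis using q1(2) by (metis smult_cancel)
  qed
  have "divides t (coeff (e * q1) i)" for i
    using h1(3) unfolding eq2[symmetric] by (auto intro!: dividesI simp: primitive_def polys_def)
  then have "divides t 1" using prim t(1) by (auto simp: primitive_def)
  then obtain s where s: "s \<in> A" "1 = t * s" by (auto simp: divides_def)
  have "h = e * smult (c2 * s) q1"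
  proof -
    have "e * smult (c2 * s) q1 = smult (c2 * s) (smult t h1)" by (simp add: eq2)
    also have "\<dots> = smult (c2 * (t * s)) h1" by (simp add: mult_ac)
    also have "\<dots> = h" unfolding s(2)[symmetric] by (simp add: h1(4))
    finally show ?thesis by simp
  qed
  then show ?thesis using s h1 q1 by (intro poly.dividesI[of "smult (c2 * s) q1"])
    (auto intro!: smult_mem mult_mem simp: primitive_def)
qed (simp add: poly.divides_zero)

lemma pseudo_division:
  assumes g: "g \<in> polys" "g \<noteq> 0" and f: "f \<in> polys"
  shows "\<exists>c q r. c \<in> A \<and> c \<noteq> 0 \<and> q \<in> polys \<and> r \<in> polys \<and> smult c f = q * g + r \<and>
    (r = 0 \<or> degree r < degree g)"
  using f
proof (induction "degree f" arbitrary: f rule: less_induct)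
  case less
  show ?case
  proof (cases "f = 0 \<or> degree f < degree g")
    case True
    then show ?thesis
      by (intro exI[of _ 1] exI[of _ 0] exI[of _ f]) (use less in \<open>auto intro: one_mem poly.zero_mem\<close>)
  next
    case False
    define b where "b = lead_coeff g"
    define m where "m = monom (lead_coeff f) (degree f - degree g)"
    have b: "b \<in> A" "b \<noteq> 0" using g by (auto simp: b_def polys_def)
    have m: "m \<in> polys" using less(2) by (auto simp: m_def polys_def zero_mem)
    define f' where "f' = smult b f - m * g"
    have f': "f' \<in> polys" unfolding f'_def by (intro poly.mem_intros smult_mem b m less(2) g)
    have IH: "\<exists>c q r. c \<in> A \<and> c \<noteq> 0 \<and> q \<in> polys \<and> r \<in> polys \<and> smult c f' = q * g + r \<and>
        (r = 0 \<or> degree r < degree g)"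
    proof (cases "f' = 0")
      case True
      then show ?thesis
        by (intro exI[of _ 1] exI[of _ 0] exI[of _ 0]) (auto intro: one_mem poly.zero_mem)
    next
      case f'0: False
      have mg: "degree (m * g) \<le> degree f"
        using False degree_mult_le[of m g] degree_monom_le[of "lead_coeff f" "degree f - degree g"]
        unfolding m_def by linarith
      have "degree f' \<le> degree f" unfolding f'_def
        using mg by (intro degree_diff_le) (auto intro: degree_smult_le)
      moreover have "coeff f' (degree f) = 0"
        using False by (simp add: f'_def m_def coeff_monom_mult b_def)
      ultimately have "degree f' < degree f"
        using f'0 by (metis le_neq_implies_less leading_coeff_0_iff)
      then show ?thesis using less.hyps f' by blast
    qed
    then obtain c q r where cqr: "c \<in> A" "c \<noteq> 0" "q \<in> polys" "r \<in> polys" "smult c f' = q * g + r"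
        "r = 0 \<or> degree r < degree g" by blast
    have "smult (c * b) f = (q + smult c m) * g + r"
    proof -
      have "smult (c * b) f = smult c f' + smult c (m * g)" by (simp add: f'_def smult_diff_right)
      then show ?thesis by (simp add: cqr(5) distrib_right)
    qed
    moreover have "c * b \<in> A" "c * b \<noteq> 0" "q + smult c m \<in> polys"
      using cqr b m by (auto intro: mult_mem poly.add_mem smult_mem)
    ultimately show ?thesis using cqr by blast
  qed
qed

lemma primitive_const_unit:
  assumes "primitive g" "degree g = 0"
  shows "poly.divides g 1"
proof -
  obtain a where a: "g = [:a:]" using assms(2) degree_eq_zeroE by blast
  have "a \<in> A" using assms(1) unfolding primitive_def polys_def a by (auto split: nat.splits dest: spec[of _ 0])
  moreover have "divides a (coeff g i)" for i
    by (auto simp: a coeff_pCons divides_refl divides_zero split: nat.splits)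
  ultimately have "divides a 1" using assms(1) by (auto simp: primitive_def)
  then obtain b where "b \<in> A" "1 = a * b" by (auto simp: divides_def)
  then show ?thesis
    by (intro poly.dividesI[of "[:b:]"]) (auto simp: a polys_def coeff_pCons zero_mem one_pCons mult.commute split: nat.splits)
qed

text \<open>Euclid's algorithm with pseudo-remainders, each replaced by its primitive part. The
  constants introduced and dropped on the way do no harm, because divisors of primitive polynomials
  are primitive and \<open>primitive_divides_smult\<close> cancels constants.\<close>

lemma primitive_gcd_exists:
  assumes "primitive f" "primitive g"
  shows "\<exists>d\<in>polys. poly.divides d f \<and> poly.divides d g \<and>
    (\<forall>e\<in>polys. poly.divides e f \<longrightarrow> poly.divides e g \<longrightarrow> poly.divides e d)"
  using assms
proof (induction "degree g" arbitrary: f g rule: less_induct)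
  case less
  have fg: "f \<in> polys" "g \<in> polys" "g \<noteq> 0"
    using less.prems primitive_nonzero by (auto simp: primitive_def)
  show ?case
  proof (cases "degree g = 0")
    case True
    then have "poly.divides g 1" using primitive_const_unit less.prems by blast
    then have "poly.divides g p" if "p \<in> polys" for p
      using poly.divides_mult[OF _ that, of g 1] by simp
    then show ?thesis using fg poly.divides_refl by blast
  next
    case False
    obtain c q r where cqr: "c \<in> A" "c \<noteq> 0" "q \<in> polys" "r \<in> polys" "smult c f = q * g + r"
        "r = 0 \<or> degree r < degree g" using pseudo_division[OF fg(2,3,1)] by blast
    have r: "r = smult c f - q * g" using cqr(5) by simp
    have sm: "poly.divides e (smult a p)" if "poly.divides e p" "a \<in> A" for e a p
      using poly.divides_mult2[OF that(1), of "[:a:]"] that(2)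
      by (auto simp: polys_def coeff_pCons zero_mem split: nat.splits)
    have r_dvd: "poly.divides e r" if "poly.divides e f" "poly.divides e g" for e
      unfolding r using that cqr by (intro poly.divides_diff sm poly.divides_mult2)
    show ?thesis
    proof (cases "r = 0")
      case True
      then have "poly.divides g (smult c f)"
        using cqr by (intro poly.dividesI[of q]) (auto simp: mult.commute)
      then have "poly.divides g f"
        using primitive_divides_smult less.prems cqr fg by blast
      then show ?thesis using fg poly.divides_refl by blast
    next
      case False
      obtain a r1 where r1: "a \<in> A" "a \<noteq> 0" "primitive r1" "r = smult a r1" "degree r1 = degree r"
        using smult_primitive_exists[OF cqr(4) False] by blast
      have r1p: "r1 \<in> polys" using r1 by (simp add: primitive_def)
      have "degree r1 < degree g" using False cqr(6) r1(5) by argo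
      then obtain d where d: "d \<in> polys" "poly.divides d g" "poly.divides d r1"
          "\<And>e. e \<in> polys \<Longrightarrow> poly.divides e g \<Longrightarrow> poly.divides e r1 \<Longrightarrow> poly.divides e d"
        using less.hyps[of r1 g] less.prems r1 by blast
      have pd: "primitive d" using primitive_factor less.prems d by blast
      have "poly.divides d (smult c f)" unfolding cqr(5) r1(4)
        using d cqr r1 by (intro poly.divides_add sm poly.divides_mult2)
      then have df: "poly.divides d f" using primitive_divides_smult pd cqr fg by blast
      have "poly.divides e d" if e: "e \<in> polys" "poly.divides e f" "poly.divides e g" for e
      proof -
        have "primitive e" using primitive_factor less.prems e by blast
        moreover have "poly.divides e (smult a r1)" using r_dvd e r1 by simp
        ultimately have "poly.divides e r1" using primitive_divides_smult r1 r1p by blast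
        then show ?thesis using d e by blast
      qed
      then show ?thesis using d df by blast
    qed
  qed
qed

lemma poly_divides_const:
  assumes "primitive f" "c \<in> A" "e \<in> A" "p \<in> polys" "smult c f = smult e p"
  shows "divides e c"
proof -
  have "divides e (c * coeff f i)" for i
    using arg_cong[OF assms(5), of "\<lambda>p. coeff p i"] assms(4)
    by (auto intro!: dividesI simp: polys_def)
  then show ?thesis using primitive_divides_const assms by blast
qed

text \<open>A gcd is the gcd of the contents times the gcd of the primitive parts. A common divisor
  splits in the same way: its content is handled by \<open>poly_divides_const\<close>, its primitive
  part by \<open>primitive_divides_smult\<close>.\<close>

lemma gcd_subring_polys: "gcd_subring polys"
proof
  fix f g assume fg: "f \<in> polys" "g \<in> polys"
  show "\<exists>d\<in>polys. poly.divides d f \<and> poly.divides d g \<and>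
    (\<forall>e\<in>polys. poly.divides e f \<longrightarrow> poly.divides e g \<longrightarrow> poly.divides e d)"
  proof (cases "f = 0 \<or> g = 0")
    case True
    then show ?thesis using fg poly.divides_refl poly.divides_zero by blast
  next
    case False
    obtain a f1 where f1: "a \<in> A" "a \<noteq> 0" "primitive f1" "f = smult a f1"
      using smult_primitive_exists[OF fg(1)] False by blast
    obtain b g1 where g1: "b \<in> A" "b \<noteq> 0" "primitive g1" "g = smult b g1"
      using smult_primitive_exists[OF fg(2)] False by blast
    obtain d where d: "d \<in> polys" "poly.divides d f1" "poly.divides d g1"
        "\<And>e. e \<in> polys \<Longrightarrow> poly.divides e f1 \<Longrightarrow> poly.divides e g1 \<Longrightarrow> poly.divides e d"
      using primitive_gcd_exists[OF f1(3) g1(3)] by blast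
    obtain c where c: "c \<in> A" "divides c a" "divides c b"
        "\<And>e. e \<in> A \<Longrightarrow> divides e a \<Longrightarrow> divides e b \<Longrightarrow> divides e c"
      using gcd_exists[OF f1(1) g1(1)] by blast
    have sm: "poly.divides (smult x p) (smult y q)" if "divides x y" "poly.divides p q" for x y p q
    proof -
      obtain u v where "u \<in> A" "y = x * u" "v \<in> polys" "q = p * v"
        using \<open>divides x y\<close> \<open>poly.divides p q\<close> unfolding divides_def poly.divides_def by blast
      then show ?thesis by (intro poly.dividesI[of "smult u v"]) (auto intro: smult_mem simp: mult_ac)
    qed
    have "poly.divides e (smult c d)" if e: "e \<in> polys" "poly.divides e f" "poly.divides e g" for e
    proof -
      have "e \<noteq> 0" using e(2) False by (auto simp: poly.divides_def)
      then obtain x e1 where e1: "x \<in> A" "x \<noteq> 0" "primitive e1" "e = smult x e1"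
        using smult_primitive_exists[OF e(1)] by blast
      have *: "poly.divides e1 p \<and> divides x y"
        if h: "primitive p" "y \<in> A" "y \<noteq> 0" "poly.divides e (smult y p)" for p y
      proof
        obtain q where q: "q \<in> polys" "smult y p = smult x (e1 * q)"
          using h(4) by (auto simp: poly.divides_def e1(4))
        have e1p: "e1 \<in> polys" and pp: "p \<in> polys" using e1 h by (auto simp: primitive_def)
        have "poly.divides e1 (smult y p)"
          using q e1 by (intro poly.dividesI[of "smult x q"]) (auto intro: smult_mem)
        then show "poly.divides e1 p" using primitive_divides_smult e1 h pp by blast
        show "divides x y" using poly_divides_const[OF h(1,2) e1(1) poly.mult_mem[OF e1p q(1)] q(2)] .
      qed
      have "poly.divides e1 d" "divides x c"
        using *[OF f1(3,1,2)] *[OF g1(3,1,2)] e f1 g1 d(4) c(4) e1 by (auto simp: primitive_def)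
      then show ?thesis unfolding e1(4) by (intro sm)
    qed
    moreover have "poly.divides (smult c d) f" "poly.divides (smult c d) g"
      unfolding f1(4) g1(4) using c d by (auto intro: sm)
    ultimately show ?thesis using c d by (intro bexI[of _ "smult c d"]) (auto intro: smult_mem)
  qed
qed

end

text \<open>Carries gcds from the abstract polynomials in one variable over to a subring of the
  Laurent polynomials, where that variable becomes a monomial.\<close>

lemma gcd_subring_image:
  fixes \<phi> :: "'a::idom \<Rightarrow> 'b::idom"
  assumes "gcd_subring R" and one: "\<phi> 1 = 1"
    and diff: "\<And>a b. a \<in> R \<Longrightarrow> b \<in> R \<Longrightarrow> \<phi> (a - b) = \<phi> a - \<phi> b"
    and mult: "\<And>a b. a \<in> R \<Longrightarrow> b \<in> R \<Longrightarrow> \<phi> (a * b) = \<phi> a * \<phi> b"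
    and inj: "inj_on \<phi> R"
  shows "gcd_subring (\<phi> ` R)"
proof -
  interpret R: gcd_subring R by fact
  interpret S: subring_set "\<phi> ` R"
  proof
    show "1 \<in> \<phi> ` R" using one R.one_mem by (metis image_eqI)
    fix a b assume "a \<in> \<phi> ` R" "b \<in> \<phi> ` R"
    then show "a - b \<in> \<phi> ` R" "a * b \<in> \<phi> ` R"
      using diff mult R.diff_mem R.mult_mem by (metis (no_types, lifting) imageE image_eqI)+
  qed
  have iff: "S.divides (\<phi> a) (\<phi> b) \<longleftrightarrow> R.divides a b" if "a \<in> R" "b \<in> R" for a b
  proof -
    have "\<phi> b = \<phi> a * \<phi> c \<longleftrightarrow> b = a * c" if "c \<in> R" for c
      using inj_onD[OF inj, of b "a * c"] mult[OF \<open>a \<in> R\<close> that] R.mult_mem[OF \<open>a \<in> R\<close> that] \<open>b \<in> R\<close>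
      by auto
    then show ?thesis unfolding S.divides_def R.divides_def by auto
  qed
  show ?thesis
  proof
    fix a b assume "a \<in> \<phi> ` R" "b \<in> \<phi> ` R"
    then obtain a' b' where ab: "a = \<phi> a'" "b = \<phi> b'" "a' \<in> R" "b' \<in> R" by blast
    obtain d where "d \<in> R" "R.divides d a'" "R.divides d b'"
      "\<forall>e\<in>R. R.divides e a' \<longrightarrow> R.divides e b' \<longrightarrow> R.divides e d"
      using R.gcd_exists ab by blast
    then show "\<exists>d\<in>\<phi> ` R. S.divides d a \<and> S.divides d b \<and>
        (\<forall>e\<in>\<phi> ` R. S.divides e a \<longrightarrow> S.divides e b \<longrightarrow> S.divides e d)"
      using ab iff by (intro bexI[of _ "\<phi> d"]) auto
  qed
qed

section \<open>Laurent polynomials\<close>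

lemma laurent_sum_single:
  "p = (\<Sum>m\<in>keys p. single m (lookup p m))"
  by (rule poly_mapping_eqI) (auto simp: lookup_sum lookup_single when_def in_keys_iff)

lemma lookup_mult_single:
  fixes p :: "'a::ab_group_add \<Rightarrow>\<^sub>0 'b::comm_ring_1"
  shows "lookup (p * single k c) m = lookup p (m - k) * c"
proof (induction p rule: laurent_induct)
  case (1 l d)
  have "l + k = m \<longleftrightarrow> l = m - k" by (auto simp: algebra_simps)
  then show ?case by (simp add: mult_single lookup_single when_def)
next
  case (2 p q)
  then show ?case by (simp add: distrib_right lookup_add)
qed

definition lattice_of :: "('n::finite \<Rightarrow> int) \<Rightarrow> 'n lattice" where
  "lattice_of f = Abs_poly_mapping f"

lemma lookup_lattice_of [simp]: "lookup (lattice_of f) = f"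
  by (simp add: lattice_of_def lookup_Abs_poly_mapping)

definition of_laurent :: "'n::{finite,linorder} laurent \<Rightarrow> 'n ratfun" where
  "of_laurent p = Fract p 1"

lemma of_laurent_add: "of_laurent (p + q) = of_laurent p + of_laurent q"
  by (simp add: of_laurent_def)

lemma of_laurent_diff: "of_laurent (p - q) = of_laurent p - of_laurent q"
  by (simp add: of_laurent_def)

lemma of_laurent_mult: "of_laurent (p * q) = of_laurent p * of_laurent q"
  by (simp add: of_laurent_def)

lemma of_laurent_0 [simp]: "of_laurent 0 = 0"
  by (simp add: of_laurent_def fract_collapse)

lemma of_laurent_1 [simp]: "of_laurent 1 = 1"
  by (simp add: of_laurent_def fract_collapse)

lemma of_laurent_eq_iff [simp]: "of_laurent p = of_laurent q \<longleftrightarrow> p = q"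
  by (simp add: of_laurent_def eq_fract)

lemma of_laurent_eq_0_iff [simp]: "of_laurent p = 0 \<longleftrightarrow> p = 0"
  using of_laurent_eq_iff[of p 0] by (simp del: of_laurent_eq_iff)

lemma of_laurent_sum: "of_laurent (sum f X) = (\<Sum>x\<in>X. of_laurent (f x))"
  by (induction X rule: infinite_finite_induct) (simp_all add: of_laurent_add)

lemma ratfun_cases:
  obtains p q where "f = of_laurent p / of_laurent q" "q \<noteq> 0"
  by (cases f) (auto simp: of_laurent_def)

definition monomial :: "'n::{finite,linorder} lattice \<Rightarrow> 'n ratfun" where
  "monomial m = of_laurent (single m 1)"

lemma monomial_add: "monomial (m + l) = monomial m * monomial l"
  by (simp add: monomial_def mult_single flip: of_laurent_mult)

lemma monomial_0 [simp]: "monomial 0 = 1"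
  by (simp add: monomial_def)

lemma monomial_minus_mult [simp]: "monomial (- m) * monomial m = 1"
  by (simp flip: monomial_add)

lemma monomial_nonzero [simp]: "monomial m \<noteq> 0"
  using monomial_minus_mult[of m] by (metis mult_zero_right zero_neq_one)

lemma monomial_minus: "monomial (- m) = 1 / monomial m"
  using monomial_minus_mult[of m] by (simp add: field_simps)

lemma monomial_diff: "monomial (m - l) = monomial m / monomial l"
  using monomial_add[of m "- l"] by (simp add: monomial_minus)

text \<open>The polynomial ring in the variables indexed by \<open>I\<close>, placed inside the
  fixed ring of Laurent polynomials so that the variables can be adjoined without changing the
  type.\<close>

definition monomial_polys :: "'n set \<Rightarrow> 'n::{finite,linorder} laurent set" where
  "monomial_polys I =
     {p. \<forall>m\<in>keys p. \<forall>j. 0 \<le> lookup m j \<and> (j \<notin> I \<longrightarrow> lookup m j = 0)}"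

lemma keys_diff: "keys (p - q) \<subseteq> keys p \<union> keys (q :: 'a \<Rightarrow>\<^sub>0 'b::ab_group_add)"
  by (auto simp: in_keys_iff lookup_minus)

interpretation monomial_polys: subring_set "monomial_polys I"
  for I :: "'n::{finite,linorder} set"
proof
  fix p q :: "'n laurent"
  assume pq: "p \<in> monomial_polys I" "q \<in> monomial_polys I"
  then show "p - q \<in> monomial_polys I"
    using keys_diff[of p q] by (auto simp: monomial_polys_def)
  show "p * q \<in> monomial_polys I"
    using pq keys_mult[of p q] by (fastforce simp: monomial_polys_def lookup_add)
qed (simp add: monomial_polys_def)

lemma single_in_monomial_polys:
  "(\<And>j. 0 \<le> lookup m j \<and> (j \<notin> I \<longrightarrow> lookup m j = 0)) \<Longrightarrow>
     single m c \<in> monomial_polys I"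
  by (simp add: monomial_polys_def)

text \<open>Evaluation at the new variable identifies the one-variable polynomials over
  \<open>monomial_polys I\<close> with the larger ring. It is injective because the coefficient of
  the value at \<open>m + single j (int k)\<close>, where \<open>m\<close> does not involve
  \<open>j\<close>, is the coefficient at \<open>m\<close> of the \<open>k\<close>-th
  coefficient.\<close>

lemma gcd_subring_monomial_polys_insert:
  fixes I :: "'n::{finite,linorder} set"
  assumes "gcd_subring (monomial_polys I)" and j: "j \<notin> I"
  shows "gcd_subring (monomial_polys (insert j I))"
proof -
  interpret R: gcd_subring "monomial_polys I" by fact
  define X :: "'n laurent" where "X = single (single j 1) 1"
  define ev where "ev = (\<lambda>P. poly P X)"
  have X_power: "X ^ k = single (single j (int k)) 1" for k
    by (induction k) (simp_all add: X_def mult_single flip: single_add)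
  have lookup_j: "lookup p m = 0"
    if "p \<in> monomial_polys I" "lookup m j \<noteq> 0" for p :: "'n laurent" and m
    using that j by (force simp: monomial_polys_def in_keys_iff)
  have lookup_ev: "lookup (ev P) (m + single j (int k)) =
      lookup (coeff P k) m"
    if P: "P \<in> R.polys" and m: "lookup m j = 0" for P m k
  proof -
    have "lookup (ev P) (m + single j (int k)) =
        (\<Sum>i\<le>degree P. lookup (coeff P i)
          (m + single j (int k) - single j (int i)))"
      by (simp add: ev_def poly_altdef lookup_sum X_power lookup_mult_single)
    also have "\<dots> = (\<Sum>i\<le>degree P. if i = k then lookup (coeff P i) m else 0)"
      using P m by (intro sum.cong)
        (auto simp: R.polys_def lookup_add lookup_minus lookup_single intro!: lookup_j)
    also have "\<dots> = lookup (coeff P k) m"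
      by (simp add: coeff_eq_0)
    finally show ?thesis .
  qed
  have inj: "inj_on ev R.polys"
  proof (rule inj_onI)
    fix P Q assume PQ: "P \<in> R.polys" "Q \<in> R.polys" "ev P = ev Q"
    have "lookup (coeff P k) m = lookup (coeff Q k) m" for k m
    proof (cases "lookup m j = 0")
      case True
      then show ?thesis using lookup_ev[of P] lookup_ev[of Q] PQ by metis
    next
      case False
      then show ?thesis using lookup_j PQ by (simp add: R.polys_def)
    qed
    then show "P = Q" by (intro poly_eqI poly_mapping_eqI)
  qed
  have "gcd_subring (ev ` R.polys)"
    using R.gcd_subring_polys _ _ _ inj by (rule gcd_subring_image) (simp_all add: ev_def)
  moreover have "ev ` R.polys = monomial_polys (insert j I)"
  proof
    show "ev ` R.polys \<subseteq> monomial_polys (insert j I)"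
    proof clarify
      fix P assume P: "P \<in> R.polys"
      have "coeff P k \<in> monomial_polys (insert j I)" for k
      proof -
        have "coeff P k \<in> monomial_polys I" using P by (simp add: R.polys_def)
        then show ?thesis by (auto simp: monomial_polys_def)
      qed
      moreover have "X ^ k \<in> monomial_polys (insert j I)" for k
        unfolding X_power by (rule single_in_monomial_polys) (auto simp: lookup_single when_def)
      ultimately show "ev P \<in> monomial_polys (insert j I)"
        unfolding ev_def poly_altdef by (intro monomial_polys.sum_mem monomial_polys.mult_mem)
    qed
    interpret S: gcd_subring "ev ` R.polys" by fact
    show "monomial_polys (insert j I) \<subseteq> ev ` R.polys"
    proof
      fix p assume p: "p \<in> monomial_polys (insert j I)"
      have "single m c \<in> ev ` R.polys" if m: "m \<in> keys p" for m c
      proof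
        define k where "k = nat (lookup m j)"
        define l where "l = m - single j (int k)"
        have k: "int k = lookup m j" using p m by (auto simp: k_def monomial_polys_def)
        have "single l c \<in> monomial_polys I"
        proof (rule single_in_monomial_polys)
          fix i show "0 \<le> lookup l i \<and> (i \<notin> I \<longrightarrow> lookup l i = 0)"
            using p m k by (cases "i = j") (auto simp: monomial_polys_def l_def lookup_minus lookup_single)
        qed
        then show "monom (single l c) k \<in> R.polys" by (rule R.monom_mem)
        show "single m c = ev (monom (single l c) k)"
          by (simp add: ev_def poly_monom X_power mult_single l_def)
      qed
      then have "(\<Sum>m\<in>keys p. single m (lookup p m)) \<in> ev ` R.polys"
        by (intro S.sum_mem)
      then show "p \<in> ev ` R.polys" by (simp flip: laurent_sum_single)
    qed
  qed
  ultimately show ?thesis by simp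
qed

text \<open>Induction on the set of variables. Without variables only the constants remain, and
  every nonzero constant divides everything.\<close>

lemma gcd_subring_monomial_polys: "gcd_subring (monomial_polys (I :: 'n::{finite,linorder} set))"
proof -
  have "finite I" by simp
  then show ?thesis
  proof (induction I rule: finite_induct)
    case empty
    show ?case
    proof
      have const: "p = single 0 (lookup p 0)" if "p \<in> monomial_polys {}" for p :: "'n laurent"
      proof -
        have "keys p \<subseteq> {0}"
          using that by (auto simp: monomial_polys_def intro!: poly_mapping_eqI)
        then show ?thesis by (intro poly_mapping_eqI) (auto simp: lookup_single when_def in_keys_iff)
      qed
      fix a b :: "'n laurent" assume a: "a \<in> monomial_polys {}" and b: "b \<in> monomial_polys {}"
      have unit: "monomial_polys.divides {} d c" if "d \<in> monomial_polys {}" "d \<noteq> 0" "c \<in> monomial_polys {}" for c d :: "'n laurent"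
      proof (rule monomial_polys.dividesI)
        let ?e = "single 0 (inverse (lookup d 0)) :: 'n laurent"
        have d: "d = single 0 (lookup d 0)" using const that by blast
        with that(2) have "lookup d 0 \<noteq> 0" by (metis single_zero)
        then have "d * ?e = 1" by (subst d) (simp add: mult_single)
        then show "c = d * (?e * c)" by (simp flip: mult.assoc)
        show "?e * c \<in> monomial_polys {}"
          using that(3) by (intro monomial_polys.mult_mem) (auto simp: monomial_polys_def)
      qed
      show "\<exists>d\<in>monomial_polys {}. monomial_polys.divides {} d a \<and> monomial_polys.divides {} d b \<and>
          (\<forall>e\<in>monomial_polys {}. monomial_polys.divides {} e a \<longrightarrow> monomial_polys.divides {} e b \<longrightarrow>
             monomial_polys.divides {} e d)"
      proof (cases "a = 0")
        case True
        then show ?thesis using b monomial_polys.divides_refl monomial_polys.divides_zero by blast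
      next
        case False
        then show ?thesis using a b unit monomial_polys.divides_refl by blast
      qed
    qed
  next
    case (insert j I)
    then show ?case using gcd_subring_monomial_polys_insert by blast
  qed
qed

lemma clear_negative_exponents:
  fixes F :: "'n::{finite,linorder} laurent set"
  assumes "finite F"
  obtains m where "single m 1 \<in> (monomial_polys UNIV :: 'n laurent set)"
    "\<And>p. p \<in> F \<Longrightarrow> single m 1 * p \<in> monomial_polys UNIV"
proof -
  define K where "K = (\<Union>p\<in>F. keys p)"
  have K: "finite K" using assms by (simp add: K_def)
  define m :: "'n lattice" where "m = lattice_of (\<lambda>j. \<Sum>k\<in>K. \<bar>lookup k j\<bar>)"
  have ge: "\<bar>lookup k j\<bar> \<le> lookup m j" if "k \<in> K" for k j
    unfolding m_def lookup_lattice_of using that K by (intro member_le_sum) auto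
  have "single m 1 * p \<in> monomial_polys UNIV" if p: "p \<in> F" for p
    unfolding monomial_polys_def
  proof clarify
    fix k j assume "k \<in> keys (single m 1 * p)"
    then obtain l where l: "l \<in> keys p" "k = m + l"
      using keys_mult[of "single m 1" p] by auto
    then have "l \<in> K" using p by (auto simp: K_def)
    then show "0 \<le> lookup k j \<and> (j \<notin> UNIV \<longrightarrow> lookup k j = 0)"
      using ge[of l j] l by (simp add: lookup_add)
  qed
  moreover have "single m 1 \<in> (monomial_polys UNIV :: 'n laurent set)"
    by (rule single_in_monomial_polys) (auto simp: m_def intro!: sum_nonneg)
  ultimately show ?thesis using that by blast
qed

lemma ratfun_cases_monomial_polys:
  obtains p q where "f = of_laurent p / of_laurent q" "q \<noteq> 0"
    "p \<in> monomial_polys UNIV" "q \<in> monomial_polys UNIV"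
proof -
  obtain p q where pq: "f = of_laurent p / of_laurent q" "q \<noteq> 0"
    using ratfun_cases by blast
  obtain m where m: "\<And>r. r \<in> {p, q} \<Longrightarrow> single m 1 * r \<in> monomial_polys UNIV"
    using clear_negative_exponents[of "{p, q}"] by auto
  show ?thesis
  proof
    have "single m 1 \<noteq> (0 :: 'a laurent)"
      using monomial_nonzero[of m] by (auto simp: monomial_def)
    then show "single m 1 * q \<noteq> 0" using pq(2) by simp
    show "f = of_laurent (single m 1 * p) / of_laurent (single m 1 * q)"
      by (simp add: pq(1) of_laurent_mult flip: monomial_def)
  qed (use m in auto)
qed

text \<open>The hypotheses say that the \<open>a\<^sub>i\<close> generate a fractional ideal whose inverse is generated by the \<open>b\<^sub>i\<close>.\<close>

lemma invertible_ideal_principal: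
  fixes a b :: "'i \<Rightarrow> 'n::{finite,linorder} ratfun"
  assumes J: "finite J" and one: "(\<Sum>i\<in>J. a i * b i) = 1"
    and ab: "\<And>i j. i \<in> J \<Longrightarrow> j \<in> J \<Longrightarrow> a i * b j \<in> range of_laurent"
  obtains g where "g \<noteq> 0" "\<And>i. i \<in> J \<Longrightarrow> a i / g \<in> range of_laurent"
    "\<And>i. i \<in> J \<Longrightarrow> g * b i \<in> range of_laurent"
proof -
  interpret R: gcd_subring "monomial_polys UNIV :: 'n laurent set"
    by (rule gcd_subring_monomial_polys)
  have "\<forall>i. \<exists>p q. a i = of_laurent p / of_laurent q \<and> q \<noteq> 0 \<and> p \<in> monomial_polys UNIV \<and> q \<in> monomial_polys UNIV"
    using ratfun_cases_monomial_polys by metis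
  then obtain P Q where PQ: "\<And>i. a i = of_laurent (P i) / of_laurent (Q i)" "\<And>i. Q i \<noteq> 0"
      "\<And>i. P i \<in> monomial_polys UNIV" "\<And>i. Q i \<in> monomial_polys UNIV" by metis
  define d where "d = prod Q J"
  define \<alpha> where "\<alpha> i = P i * prod Q (J - {i})" for i
  have d: "d \<in> monomial_polys UNIV" "d \<noteq> 0"
    using PQ J by (auto simp: d_def intro!: monomial_polys.prod_mem)
  have \<alpha>: "\<alpha> i \<in> monomial_polys UNIV" for i using PQ by (auto simp: \<alpha>_def intro!: monomial_polys.mem_intros)
  have a: "a i = of_laurent (\<alpha> i) / of_laurent d" if "i \<in> J" for i
  proof -
    have "d = Q i * prod Q (J - {i})" using J that by (simp add: d_def prod.remove)
    moreover have "prod Q (J - {i}) \<noteq> 0" using J PQ(2) by simp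
    ultimately show ?thesis using PQ(1,2) by (simp add: \<alpha>_def of_laurent_mult)
  qed
  obtain \<gamma> where \<gamma>: "\<gamma> \<in> monomial_polys UNIV" "\<And>i. i \<in> J \<Longrightarrow> monomial_polys.divides UNIV \<gamma> (\<alpha> i)"
      "\<And>e p. e \<in> monomial_polys UNIV \<Longrightarrow> p \<in> monomial_polys UNIV \<Longrightarrow>
        (\<And>i. i \<in> J \<Longrightarrow> monomial_polys.divides UNIV e (p * \<alpha> i)) \<Longrightarrow> monomial_polys.divides UNIV e (p * \<gamma>)"
  proof -
    have "finite (\<alpha> ` J)" "\<alpha> ` J \<subseteq> monomial_polys UNIV" using J \<alpha> by auto
    from R.finite_gcd_exists[OF this] show ?thesis using that by auto
  qed
  have "\<gamma> \<noteq> 0"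
  proof
    assume "\<gamma> = 0"
    then have "\<alpha> i = 0" if "i \<in> J" for i using \<gamma>(2) that by (auto simp: monomial_polys.divides_def)
    then have "(\<Sum>i\<in>J. a i * b i) = 0" using a by (intro sum.neutral) auto
    with one show False by simp
  qed
  have "\<forall>i j. \<exists>r. i \<in> J \<longrightarrow> j \<in> J \<longrightarrow> a i * b j = of_laurent r" using ab by blast
  then obtain r where r: "\<And>i j. i \<in> J \<Longrightarrow> j \<in> J \<Longrightarrow> a i * b j = of_laurent (r i j)" by metis
  have "finite ((\<lambda>(i, j). r i j) ` (J \<times> J))" using J by simp
  then obtain m where m0: "single m 1 \<in> (monomial_polys UNIV :: 'n laurent set)"
      "\<And>p. p \<in> (\<lambda>(i, j). r i j) ` (J \<times> J) \<Longrightarrow> single m 1 * p \<in> monomial_polys UNIV"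
    using clear_negative_exponents by blast
  have m: "single m 1 * r i j \<in> monomial_polys UNIV" if "i \<in> J" "j \<in> J" for i j
    using that by (intro m0(2)) auto
  show thesis
  proof
    show "of_laurent \<gamma> / of_laurent d \<noteq> 0" using \<open>\<gamma> \<noteq> 0\<close> d by simp
    fix i assume i: "i \<in> J"
    obtain c where c: "\<alpha> i = \<gamma> * c" using \<gamma>(2)[OF i] by (auto simp: monomial_polys.divides_def)
    have "a i / (of_laurent \<gamma> / of_laurent d) = of_laurent c"
      using \<open>\<gamma> \<noteq> 0\<close> d by (simp add: a[OF i] c of_laurent_mult)
    then show "a i / (of_laurent \<gamma> / of_laurent d) \<in> range of_laurent" by blast
    obtain p q where pq: "b i = of_laurent p / of_laurent q" "q \<noteq> 0"
        "p \<in> monomial_polys UNIV" "q \<in> monomial_polys UNIV"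
      by (rule ratfun_cases_monomial_polys)
    let ?x = "single m 1 :: 'n laurent"
    \<comment> \<open>For \<open>g = \<gamma> / d\<close> the quotients \<open>a i / g\<close> are
      Laurent polynomials because \<open>\<gamma>\<close> divides all numerators. For
      \<open>g * b i\<close> the gcd property with a multiplier is needed: as every
      \<open>a k * b i\<close> is a Laurent polynomial, \<open>d * q\<close> divides
      \<open>p * \<alpha> k\<close> up to a monomial, hence also \<open>p * \<gamma>\<close>. The
      monomial \<open>?x\<close> keeps these divisibilities among genuine polynomials.\<close>
    have "monomial_polys.divides UNIV (d * q) (?x * p * \<alpha> k)" if k: "k \<in> J" for k
    proof (rule monomial_polys.dividesI[OF m[OF k i]])
      have "of_laurent (\<alpha> k * p) = of_laurent (r k i * (d * q))"
        using r[OF k i] d pq by (simp add: a[OF k] of_laurent_mult divide_eq_eq mult_ac)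
      then have "\<alpha> k * p = r k i * (d * q)" by simp
      then show "?x * p * \<alpha> k = d * q * (?x * r k i)" by (simp add: mult_ac)
    qed
    then have "monomial_polys.divides UNIV (d * q) (?x * p * \<gamma>)"
      using d pq m0(1) by (intro \<gamma>(3)) (auto intro: monomial_polys.mem_intros)
    then obtain t where t: "?x * p * \<gamma> = d * q * t" by (auto simp: monomial_polys.divides_def)
    then have "monomial m * of_laurent p * of_laurent \<gamma> = of_laurent d * of_laurent q * of_laurent t"
      by (simp add: monomial_def flip: of_laurent_mult)
    then have "of_laurent \<gamma> / of_laurent d * b i = of_laurent t / monomial m"
      using d(2) pq(2) unfolding pq(1) by (simp add: field_simps)
    also have "\<dots> = of_laurent (t * single (- m) 1)"
      by (simp add: of_laurent_mult monomial_minus flip: monomial_def)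
    finally show "of_laurent \<gamma> / of_laurent d * b i \<in> range of_laurent" by blast
  qed
qed

section \<open>Local rings and line bundles on affine schemes\<close>

definition ideal_in :: "'k::comm_ring_1 set \<Rightarrow> 'k set \<Rightarrow> bool" where
  "ideal_in A I \<longleftrightarrow> I \<subseteq> A \<and> 0 \<in> I \<and> (\<forall>a\<in>I. \<forall>b\<in>I. a + b \<in> I) \<and> (\<forall>a\<in>A. \<forall>b\<in>I. a * b \<in> I)"

definition prime_in :: "'k::comm_ring_1 set \<Rightarrow> 'k set \<Rightarrow> bool" where
  "prime_in A P \<longleftrightarrow> ideal_in A P \<and> 1 \<notin> P \<and> (\<forall>a\<in>A. \<forall>b\<in>A. a * b \<in> P \<longrightarrow> a \<in> P \<or> b \<in> P)"

lemma ring_of_simps [simp]: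
  "carrier (ring_of A) = A" "x \<otimes>\<^bsub>ring_of A\<^esub> y = x * y" "\<one>\<^bsub>ring_of A\<^esub> = 1"
  "\<zero>\<^bsub>ring_of A\<^esub> = 0" "x \<oplus>\<^bsub>ring_of A\<^esub> y = x + y"
  by (simp_all add: ring_of_def)

lemma cring_ring_of:
  fixes A :: "'k::field set"
  assumes "subring_set A"
  shows "cring (ring_of A)"
proof -
  interpret subring_set A by fact
  show ?thesis
  proof (rule cringI)
    show "abelian_group (ring_of A)"
    proof (rule abelian_groupI)
      fix x assume "x \<in> carrier (ring_of A)"
      then show "\<exists>y\<in>carrier (ring_of A). y \<oplus>\<^bsub>ring_of A\<^esub> x = \<zero>\<^bsub>ring_of A\<^esub>"
        by (intro bexI[of _ "- x"]) (auto intro: uminus_mem)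
    qed (auto intro: add_mem zero_mem)
    show "comm_monoid (ring_of A)"
      by (rule comm_monoidI) (auto intro: mult_mem one_mem)
  qed (auto simp: distrib_right)
qed

lemma ideal_ring_of_iff:
  fixes A :: "'k::field set"
  assumes "subring_set A"
  shows "ideal I (ring_of A) \<longleftrightarrow> ideal_in A I"
proof
  interpret subring_set A by fact
  interpret R: cring "ring_of A" using assms by (rule cring_ring_of)
  show "ideal_in A I" if "ideal I (ring_of A)"
  proof -
    interpret I: ideal I "ring_of A" by fact
    show ?thesis unfolding ideal_in_def
      using I.a_subset I.zero_closed I.a_closed I.I_l_closed by auto
  qed
  assume I: "ideal_in A I"
  have neg: "- a \<in> I" if "a \<in> I" for a
    using I that uminus_mem[OF one_mem] by (force simp: ideal_in_def dest: bspec)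
  show "ideal I (ring_of A)"
  proof (rule idealI)
    show "ring (ring_of A)" by (rule R.ring_axioms)
    show "subgroup I (add_monoid (ring_of A))"
    proof (rule R.add.subgroupI)
      fix a assume a: "a \<in> I"
      then have "\<ominus>\<^bsub>ring_of A\<^esub> a = - a"
        using I uminus_mem by (intro R.minus_equality) (auto simp: ideal_in_def)
      then show "\<ominus>\<^bsub>ring_of A\<^esub> a \<in> I" using neg[OF a] by simp
    qed (use I in \<open>auto simp: ideal_in_def\<close>)
  next
    fix a x assume "a \<in> I" "x \<in> carrier (ring_of A)"
    then have "x * a \<in> I" using I by (simp add: ideal_in_def)
    then show "x \<otimes>\<^bsub>ring_of A\<^esub> a \<in> I" "a \<otimes>\<^bsub>ring_of A\<^esub> x \<in> I"
      by (simp_all add: mult.commute)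
  qed
qed

lemma primeideal_ring_of_iff:
  fixes A :: "'k::field set"
  assumes "subring_set A"
  shows "primeideal P (ring_of A) \<longleftrightarrow> prime_in A P"
proof
  interpret subring_set A by fact
  interpret R: cring "ring_of A" using assms by (rule cring_ring_of)
  show "prime_in A P" if "primeideal P (ring_of A)"
  proof -
    interpret P: primeideal P "ring_of A" by fact
    have "ideal_in A P" using P.is_ideal ideal_ring_of_iff[OF assms] by simp
    moreover have "1 \<notin> P" using P.I_notcarr P.one_imp_carrier by auto
    ultimately show ?thesis using P.I_prime by (auto simp: prime_in_def)
  qed
  assume P: "prime_in A P"
  show "primeideal P (ring_of A)"
  proof (rule primeidealI)
    show "ideal P (ring_of A)" using P ideal_ring_of_iff[OF assms] by (simp add: prime_in_def)
    show "cring (ring_of A)" by (rule R.is_cring)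
    show "carrier (ring_of A) \<noteq> P" using P one_mem by (auto simp: prime_in_def)
  qed (use P in \<open>auto simp: prime_in_def\<close>)
qed

lemma prime_in_power:
  assumes "prime_in A P" "subring_set A" "a \<in> A" "a ^ n \<in> P"
  shows "a \<in> P"
  using assms(4)
proof (induction n)
  case 0
  then show ?case using assms(1) by (simp add: prime_in_def)
next
  case (Suc n)
  then show ?case
    using assms subring_set.power_mem[OF assms(2,3), of n] by (auto simp: prime_in_def)
qed

text \<open>Zorn's lemma. For an ideal \<open>M\<close> maximal among those that contain
  \<open>I\<close> and no power of \<open>d\<close>, adjoining any outside element produces a power
  of \<open>d\<close>; two such powers multiply into \<open>M\<close> when the product of the
  outside elements lies in \<open>M\<close>. The case \<open>d = 1\<close> gives a prime above a
  proper ideal.\<close>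

lemma prime_avoiding_powers_exists:
  assumes A: "subring_set A" and I: "ideal_in A I" and d: "d \<in> A" "\<And>n. d ^ n \<notin> I"
  obtains P where "prime_in A P" "I \<subseteq> P" "d \<notin> P"
proof -
  interpret subring_set A by fact
  define \<A> where "\<A> = {J. ideal_in A J \<and> I \<subseteq> J \<and> (\<forall>n. d ^ n \<notin> J)}"
  have "\<exists>M\<in>\<A>. \<forall>J\<in>\<A>. M \<subseteq> J \<longrightarrow> J = M"
  proof (rule subset_Zorn_nonempty)
    show "\<A> \<noteq> {}" using I d by (auto simp: \<A>_def)
    fix \<C> assume C: "\<C> \<noteq> {}" "subset.chain \<A> \<C>"
    then have sub: "\<C> \<subseteq> \<A>" by (simp add: subset_chain_def)
    have "a + b \<in> \<Union>\<C>" if ab: "a \<in> \<Union>\<C>" "b \<in> \<Union>\<C>" for a b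
    proof -
      obtain J1 J2 where J: "J1 \<in> \<C>" "a \<in> J1" "J2 \<in> \<C>" "b \<in> J2" using ab by blast
      then have "J1 \<subseteq> J2 \<or> J2 \<subseteq> J1" using C by (auto simp: subset_chain_def)
      then obtain J where "J \<in> \<C>" "a \<in> J" "b \<in> J" using J by blast
      moreover from this have "ideal_in A J" using sub by (auto simp: \<A>_def)
      ultimately show ?thesis by (auto simp: ideal_in_def)
    qed
    moreover have "a * b \<in> \<Union>\<C>" if "a \<in> A" "b \<in> \<Union>\<C>" for a b
      using that sub by (fastforce simp: \<A>_def ideal_in_def)
    moreover have "0 \<in> \<Union>\<C>" "\<Union>\<C> \<subseteq> A" "I \<subseteq> \<Union>\<C>" "\<forall>n. d ^ n \<notin> \<Union>\<C>"
      using C(1) sub by (fastforce simp: \<A>_def ideal_in_def)+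
    ultimately show "\<Union>\<C> \<in> \<A>" by (simp add: \<A>_def ideal_in_def)
  qed
  then obtain M where M0: "M \<in> \<A>" "\<And>J. J \<in> \<A> \<Longrightarrow> M \<subseteq> J \<Longrightarrow> J = M"
    by metis
  have M: "ideal_in A M" "I \<subseteq> M" "\<And>n. d ^ n \<notin> M" using M0(1) by (auto simp: \<A>_def)
  note Mi = M(1)[unfolded ideal_in_def]
  have ext: "\<exists>n j x. j \<in> M \<and> x \<in> A \<and> d ^ n = j + a * x" if a: "a \<in> A" "a \<notin> M" for a
  proof (rule ccontr)
    assume neg: "\<not> ?thesis"
    define J where "J = {j + a * x |j x. j \<in> M \<and> x \<in> A}"
    have MJ: "M \<subseteq> J" unfolding J_def using zero_mem by force
    have aJ: "a \<in> J" unfolding J_def using one_mem Mi by force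
    have "ideal_in A J"
      unfolding ideal_in_def
    proof (intro conjI ballI)
      show "J \<subseteq> A" using Mi a by (auto simp: J_def intro!: add_mem mult_mem)
      show "0 \<in> J" using MJ Mi by blast
      fix u v assume v: "v \<in> J"
      then obtain j x where jx: "v = j + a * x" "j \<in> M" "x \<in> A" by (auto simp: J_def)
      show "u + v \<in> J" if u: "u \<in> J"
      proof -
        obtain j' x' where "u = j' + a * x'" "j' \<in> M" "x' \<in> A" using u by (auto simp: J_def)
        then have "u + v = (j' + j) + a * (x' + x)" "j' + j \<in> M" "x' + x \<in> A"
          using jx Mi by (auto simp: algebra_simps intro: add_mem)
        then show ?thesis unfolding J_def by blast
      qed
      show "u * v \<in> J" if "u \<in> A"
      proof -
        have "u * v = u * j + a * (u * x)" "u * j \<in> M" "u * x \<in> A"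
          using jx Mi that by (auto simp: algebra_simps intro: mult_mem)
        then show ?thesis unfolding J_def by blast
      qed
    qed
    moreover have "d ^ n \<notin> J" for n using neg by (auto simp: J_def)
    ultimately have "J \<in> \<A>" using M(2) MJ by (auto simp: \<A>_def)
    then have "J = M" using M0(2) MJ by blast
    with aJ a show False by blast
  qed
  have "prime_in A M"
    unfolding prime_in_def
  proof (intro conjI ballI impI)
    show "1 \<notin> M" using M(3)[of 0] by simp
    fix a b assume ab: "a \<in> A" "b \<in> A" "a * b \<in> M"
    show "a \<in> M \<or> b \<in> M"
    proof (rule ccontr)
      assume "\<not> ?thesis"
      then obtain n j x m k y where *: "j \<in> M" "x \<in> A" "d ^ n = j + a * x" "k \<in> M" "y \<in> A" "d ^ m = k + b * y"
        using ext ab by meson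
      have "d ^ (n + m) = (k + b * y) * j + ((a * x) * k + (x * y) * (a * b))"
        unfolding power_add *(3) *(6) by (simp add: algebra_simps)
      moreover have "k + b * y \<in> A" "a * x \<in> A" "x * y \<in> A"
        using * ab Mi by (auto intro: add_mem mult_mem)
      ultimately have "d ^ (n + m) \<in> M"
        using *(1,4) ab(3) Mi by simp
      with M(3) show False by blast
    qed
  qed (fact M(1))
  moreover have "d \<notin> M" using M(3)[of 1] by simp
  ultimately show thesis using M(2) that by blast
qed

section \<open>Localizations at primes and basic open sets\<close>

lemma localizationI: "a \<in> A \<Longrightarrow> b \<in> A \<Longrightarrow> b \<notin> P \<Longrightarrow> a / b \<in> localization A P"
  by (auto simp: localization_def)

lemma localizationE:
  assumes "f \<in> localization A P" "prime_in A P"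
  obtains a b where "f = a / b" "a \<in> A" "b \<in> A" "b \<notin> P" "b \<noteq> 0"
  using assms by (auto simp: localization_def prime_in_def ideal_in_def)

lemma subset_localization:
  assumes "subring_set A" "prime_in A P"
  shows "A \<subseteq> localization A P"
  using localizationI[of _ A 1 P] subring_set.one_mem[OF assms(1)] assms(2) by (auto simp: prime_in_def)

lemma subring_localization:
  assumes "subring_set A" "prime_in A P"
  shows "subring_set (localization A P)"
proof -
  interpret subring_set A by fact
  show ?thesis
  proof
    show "1 \<in> localization A P" using subset_localization[OF assms] one_mem by blast
    fix f g assume f: "f \<in> localization A P" and g: "g \<in> localization A P"
    obtain a b where ab: "f = a / b" "a \<in> A" "b \<in> A" "b \<notin> P" "b \<noteq> 0"
      using f assms(2) by (rule localizationE)
    obtain c d where cd: "g = c / d" "c \<in> A" "d \<in> A" "d \<notin> P" "d \<noteq> 0"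
      using g assms(2) by (rule localizationE)
    have bd: "b * d \<in> A" "b * d \<notin> P" using ab cd assms(2) by (auto simp: prime_in_def intro: mult_mem)
    have "f - g = (a * d - c * b) / (b * d)" "f * g = (a * c) / (b * d)"
      using ab cd by (simp_all add: field_simps)
    moreover have "a * d - c * b \<in> A" "a * c \<in> A" using ab cd by (auto intro: mem_intros)
    ultimately show "f - g \<in> localization A P" "f * g \<in> localization A P"
      using localizationI[OF _ bd] by simp_all
  qed
qed

text \<open>Expresses the basic open set of \<open>b\<close> through the local rings alone, as the
  condition \<open>1 / b \<in> S\<close>; this is how basic open sets appear from here on.\<close>

lemma inverse_mem_localization_iff:
  assumes "subring_set A" "prime_in A P" "b \<in> A" "b \<noteq> 0"
  shows "1 / b \<in> localization A P \<longleftrightarrow> b \<notin> P"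
proof
  interpret subring_set A by fact
  show "1 / b \<in> localization A P" if "b \<notin> P" using that assms one_mem by (auto intro: localizationI)
  assume "1 / b \<in> localization A P"
  then obtain a c where ac: "1 / b = a / c" "a \<in> A" "c \<in> A" "c \<notin> P" "c \<noteq> 0"
    using assms(2) by (rule localizationE)
  then have "c = a * b" using assms(4) by (simp add: field_simps)
  then show "b \<notin> P" using ac assms(2) by (auto simp: prime_in_def ideal_in_def)
qed

lemma SpecE:
  assumes "R \<in> Spec A" "subring_set A"
  obtains P where "prime_in A P" "R = localization A P"
  using assms primeideal_ring_of_iff[OF assms(2)] by (auto simp: Spec_def)

lemma SpecI: "subring_set A \<Longrightarrow> prime_in A P \<Longrightarrow> localization A P \<in> Spec A"
  using primeideal_ring_of_iff[of A] by (auto simp: Spec_def)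

lemma Spec_subring: "R \<in> Spec A \<Longrightarrow> subring_set A \<Longrightarrow> subring_set R"
  by (metis SpecE subring_localization)

lemma Spec_superset: "R \<in> Spec A \<Longrightarrow> subring_set A \<Longrightarrow> A \<subseteq> R"
  by (metis SpecE subset_localization)

text \<open>Consider the ideal of denominators of \<open>f\<close>. If it contained no power of
  \<open>d\<close>, some prime \<open>P\<close> above it would miss \<open>d\<close>; then
  \<open>f\<close> lies in the localization at \<open>P\<close> and has a denominator outside
  \<open>P\<close>, a contradiction.\<close>

lemma regular_on_basic_open:
  assumes A: "subring_set A" and d: "d \<in> A" "d \<noteq> 0"
    and f: "\<And>S. S \<in> Spec A \<Longrightarrow> 1 / d \<in> S \<Longrightarrow> f \<in> S"
  shows "\<exists>N. d ^ N * f \<in> A"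
proof (rule ccontr)
  interpret subring_set A by fact
  assume neg: "\<not> ?thesis"
  define I where "I = {a \<in> A. a * f \<in> A}"
  have "ideal_in A I"
    by (auto simp: ideal_in_def I_def zero_mem distrib_right mult.assoc intro: add_mem mult_mem)
  moreover have "d ^ n \<notin> I" for n using neg by (auto simp: I_def)
  ultimately obtain P where P: "prime_in A P" "I \<subseteq> P" "d \<notin> P"
    using prime_avoiding_powers_exists[OF A _ d(1)] by blast
  have "f \<in> localization A P"
    using f[OF SpecI[OF A P(1)]] inverse_mem_localization_iff[OF A P(1) d] P(3) by blast
  then obtain a b where ab: "f = a / b" "a \<in> A" "b \<in> A" "b \<notin> P" "b \<noteq> 0"
    using P(1) by (rule localizationE)
  then have "b \<in> I" by (simp add: I_def)
  with P ab show False by blast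
qed

lemma Inter_Spec:
  assumes A: "subring_set A" and f: "\<And>S. S \<in> Spec A \<Longrightarrow> f \<in> S"
  shows "f \<in> A"
proof -
  have "\<exists>N. 1 ^ N * f \<in> A"
    using subring_set.one_mem[OF A] f by (intro regular_on_basic_open[OF A]) auto
  then show ?thesis by simp
qed

text \<open>Induction over the generation of the topology. For a subbasic set given by
  \<open>f\<close>, a denominator of \<open>f\<close> at the point serves as \<open>b\<close>; for
  intersections the two elements are multiplied.\<close>

lemma basic_open_neighbourhood:
  assumes A: "subring_set A" and U: "openin (zariski X) U" and R: "R \<in> U" "R \<in> Spec A"
    and sub: "Spec A \<subseteq> X"
  shows "\<exists>b\<in>A. b \<noteq> 0 \<and> 1 / b \<in> R \<and> (\<forall>S\<in>Spec A. 1 / b \<in> S \<longrightarrow> S \<in> U)"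
proof -
  interpret subring_set A by fact
  obtain P where P: "prime_in A P" "R = localization A P" using R(2) A by (rule SpecE)
  have "generate_topology_on {{R \<in> X. f \<in> R} |f. True} U"
    using U by (simp add: zariski_def openin_topology_generated_by_iff)
  then show ?thesis using R(1)
  proof (induction rule: generate_topology_on.induct)
    case (Int U V)
    then obtain b c where b: "b \<in> A" "b \<noteq> 0" "1 / b \<in> R" "\<forall>S\<in>Spec A. 1 / b \<in> S \<longrightarrow> S \<in> U"
      and c: "c \<in> A" "c \<noteq> 0" "1 / c \<in> R" "\<forall>S\<in>Spec A. 1 / c \<in> S \<longrightarrow> S \<in> V" by auto
    have "S \<in> U \<inter> V" if S: "S \<in> Spec A" "1 / (b * c) \<in> S" for S
    proof -
      interpret S: subring_set S using S A Spec_subring by blast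
      have "b \<in> S" "c \<in> S" using Spec_superset[OF S(1) A] b c by auto
      then have "c * (1 / (b * c)) \<in> S" "b * (1 / (b * c)) \<in> S"
        using S.mult_mem[OF _ S(2)] by blast+
      moreover have "c * (1 / (b * c)) = 1 / b" "b * (1 / (b * c)) = 1 / c"
        using b(2) c(2) by (simp_all add: field_simps)
      ultimately have "1 / b \<in> S" "1 / c \<in> S" by metis+
      with S b c show ?thesis by blast
    qed
    moreover have "1 / (b * c) \<in> R"
      using subring_set.mult_mem[OF Spec_subring[OF R(2) A] b(3) c(3)] by simp
    ultimately show ?case using b c by (intro bexI[of _ "b * c"]) (auto intro: mult_mem)
  next
    case (UN K)
    then obtain V where "V \<in> K" "R \<in> V" by blast
    from UN.IH[OF this] obtain b where
      "b \<in> A" "b \<noteq> 0" "1 / b \<in> R" "\<forall>S\<in>Spec A. 1 / b \<in> S \<longrightarrow> S \<in> V" by blast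
    then show ?case using \<open>V \<in> K\<close> by (intro bexI[of _ b]) auto
  next
    case (Basis V)
    then obtain f where f: "V = {R \<in> X. f \<in> R}" by blast
    then have "f \<in> localization A P" using Basis P by blast
    then obtain a b where ab: "f = a / b" "a \<in> A" "b \<in> A" "b \<notin> P" "b \<noteq> 0"
      using P(1) by (rule localizationE)
    have "f \<in> S" if S: "S \<in> Spec A" "1 / b \<in> S" for S
    proof -
      have "a * (1 / b) \<in> S"
        using S Spec_superset[OF S(1) A] ab subring_set.mult_mem[OF Spec_subring[OF S(1) A]] by blast
      then show ?thesis by (simp add: ab)
    qed
    then show ?case
      using ab sub f inverse_mem_localization_iff[OF A P(1)] P(2) by (intro bexI[of _ b]) auto
  qed auto
qed

text \<open>Used twice: with \<open>I = A\<close> for the ideal generated by a set, and for the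
  product of a fractional ideal with its inverse. With lists of pairs, addition of finite sums is
  concatenation.\<close>

lemma ideal_in_sum_list_products:
  assumes "subring_set A" "\<And>a b. a \<in> I \<Longrightarrow> b \<in> J \<Longrightarrow> a * b \<in> A" "\<And>c a. c \<in> A \<Longrightarrow> a \<in> I \<Longrightarrow> c * a \<in> I"
  shows "ideal_in A {\<Sum>(a, b)\<leftarrow>xs. a * b |xs. set xs \<subseteq> I \<times> J}"
proof -
  interpret subring_set A by fact
  have "(\<Sum>(a, b)\<leftarrow>xs. a * b) \<in> A" if "set xs \<subseteq> I \<times> J" for xs
    using that by (induction xs) (auto intro!: zero_mem add_mem assms(2))
  moreover have "(\<Sum>(a, b)\<leftarrow>xs. a * b) + (\<Sum>(a, b)\<leftarrow>ys. a * b) = (\<Sum>(a, b)\<leftarrow>xs @ ys. a * b)"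
    for xs ys :: "('a \<times> 'a) list" by simp
  moreover have "c * (\<Sum>(a, b)\<leftarrow>xs. a * b) = (\<Sum>(a, b)\<leftarrow>map (\<lambda>(a, b). (c * a, b)) xs. a * b)"
    for c :: 'a and xs by (induction xs) (auto simp: distrib_left mult.assoc)
  moreover have "set (map (\<lambda>(a, b). (c * a, b)) xs) \<subseteq> I \<times> J" if "c \<in> A" "set xs \<subseteq> I \<times> J" for c xs
    using that assms(3) by auto
  ultimately show ?thesis
    unfolding ideal_in_def
    apply (intro conjI)
       apply blast
      apply (rule CollectI, rule exI[of _ "[]"], simp)
     apply (clarify, metis (no_types, lifting) set_append Un_least)
    apply (clarify, metis (no_types, lifting))
    done
qed

text \<open>A line bundle on an affine scheme is an invertible fractional ideal \<open>(a\<^sub>i)\<close>, with inverse \<open>(b\<^sub>i)\<close>.\<close>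

lemma line_bundle_affine:
  fixes A :: "'k::field set"
  assumes A: "subring_set A" and sub: "Spec A \<subseteq> X" and L: "line_bundle X L"
  obtains n :: nat and a b where "(\<Sum>i<n. a i * b i) = 1"
    "\<And>i S. i < n \<Longrightarrow> S \<in> Spec A \<Longrightarrow> a i \<in> L S"
    "\<And>i S l. i < n \<Longrightarrow> S \<in> Spec A \<Longrightarrow> l \<in> L S \<Longrightarrow> b i * l \<in> S"
proof -
  interpret subring_set A by fact
  \<comment> \<open>The elements on whose basic open set \<open>L\<close> is trivial. They generate
    the unit ideal, since the local ring at a prime containing them all would have no trivializing
    neighbourhood. Finitely many of them, the set \<open>C\<close>, therefore suffice.\<close>
  define T where "T = {c \<in> A. c \<noteq> 0 \<and> (\<exists>g. g \<noteq> 0 \<and> (\<forall>S\<in>Spec A. 1 / c \<in> S \<longrightarrow> L S = (\<lambda>a. g * a) ` S))}"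
  have cover: "\<exists>c\<in>T. 1 / c \<in> R" if R: "R \<in> Spec A" for R
  proof -
    obtain U g where U: "openin (zariski X) U" "R \<in> U" "g \<noteq> 0" "\<forall>S\<in>U. L S = (\<lambda>a. g * a) ` S"
      using bspec[OF L[unfolded line_bundle_def] subsetD[OF sub R]] by (elim exE conjE)
    obtain b where "b \<in> A" "b \<noteq> 0" "1 / b \<in> R" "\<forall>S\<in>Spec A. 1 / b \<in> S \<longrightarrow> S \<in> U"
      using basic_open_neighbourhood[OF A U(1,2) R sub] by blast
    then show ?thesis using U by (intro bexI[of _ b]) (auto simp: T_def)
  qed
  define \<T> where "\<T> = {\<Sum>(a, b)\<leftarrow>xs. a * b |xs. set xs \<subseteq> A \<times> T}"
  have "ideal_in A \<T>" unfolding \<T>_def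
    by (rule ideal_in_sum_list_products) (auto simp: T_def intro: mult_mem A)
  have "1 \<in> \<T>"
  proof (rule ccontr)
    assume "1 \<notin> \<T>"
    then obtain P where P: "prime_in A P" "\<T> \<subseteq> P"
      using prime_avoiding_powers_exists[OF A \<open>ideal_in A \<T>\<close> one_mem] by auto
    obtain c where c: "c \<in> T" "1 / c \<in> localization A P" using cover SpecI[OF A P(1)] by blast
    have "(\<Sum>(a, b)\<leftarrow>[(1, c)]. a * b) \<in> \<T>"
      unfolding \<T>_def using c(1) one_mem by (intro CollectI exI[of _ "[(1, c)]"]) auto
    then have "c \<in> P" using P by auto
    moreover have "c \<notin> P" using inverse_mem_localization_iff[OF A P(1)] c by (auto simp: T_def)
    ultimately show False by simp
  qed
  then obtain xs where xs: "set xs \<subseteq> A \<times> T" "1 = (\<Sum>(a, b)\<leftarrow>xs. a * b)" by (auto simp: \<T>_def)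
  define C where "C = snd ` set xs"
  have C: "finite C" "C \<subseteq> T" using xs(1) by (auto simp: C_def)
  have unit: "\<exists>c\<in>C. c \<notin> P" if P: "prime_in A P" for P
  proof (rule ccontr)
    assume neg: "\<not> ?thesis"
    have "(\<Sum>(a, b)\<leftarrow>ys. a * b) \<in> P" if "set ys \<subseteq> set xs" for ys
      using that
    proof (induction ys)
      case Nil
      then show ?case using P by (simp add: prime_in_def ideal_in_def)
    next
      case (Cons y ys)
      obtain a c where y: "y = (a, c)" by (cases y)
      have "a \<in> A" "c \<in> P" using Cons.prems y xs(1) neg by (force simp: C_def)+
      then show ?case using Cons P y by (auto simp: prime_in_def ideal_in_def)
    qed
    from this[of xs] xs(2) P show False by (simp add: prime_in_def)
  qed
  have "\<forall>c\<in>C. \<exists>g. g \<noteq> 0 \<and> (\<forall>S\<in>Spec A. 1 / c \<in> S \<longrightarrow> L S = (\<lambda>a. g * a) ` S)"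
    using C by (auto simp: T_def)
  then obtain g where g: "\<And>c. c \<in> C \<Longrightarrow> g c \<noteq> 0"
      "\<And>c S. c \<in> C \<Longrightarrow> S \<in> Spec A \<Longrightarrow> 1 / c \<in> S \<Longrightarrow> L S = (\<lambda>a. g c * a) ` S" by metis
  have CA: "c \<in> A" "c \<noteq> 0" if "c \<in> C" for c using that C by (auto simp: T_def)
  \<comment> \<open>Where \<open>c * e\<close> is invertible, both \<open>g c\<close> and
    \<open>g e\<close> generate \<open>L\<close>, so their ratio is regular there.\<close>
  have trans: "\<exists>N. (c * e) ^ N * (g c / g e) \<in> A" if ce: "c \<in> C" "e \<in> C" for c e
  proof (rule regular_on_basic_open[OF A])
    show "c * e \<in> A" "c * e \<noteq> 0" using CA ce by (auto intro: mult_mem)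
    fix S assume S: "S \<in> Spec A" "1 / (c * e) \<in> S"
    interpret S: subring_set S using S A Spec_subring by blast
    have "c \<in> S" "e \<in> S" using Spec_superset[OF S(1) A] CA ce by auto
    then have "e * (1 / (c * e)) \<in> S" "c * (1 / (c * e)) \<in> S"
      using S.mult_mem[OF _ S(2)] by blast+
    moreover have "e * (1 / (c * e)) = 1 / c" "c * (1 / (c * e)) = 1 / e"
      using CA(2)[OF ce(1)] CA(2)[OF ce(2)] by (simp_all add: field_simps)
    ultimately have "1 / c \<in> S" "1 / e \<in> S" by metis+
    then have "(\<lambda>a. g c * a) ` S = (\<lambda>a. g e * a) ` S" using g(2) ce S by metis
    moreover have "g c * 1 \<in> (\<lambda>a. g c * a) ` S" using S.one_mem by blast
    ultimately obtain s where "s \<in> S" "g c * 1 = g e * s" by blast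
    then show "g c / g e \<in> S" using g(1) ce by simp
  qed
  then obtain N where N: "\<And>c e. c \<in> C \<Longrightarrow> e \<in> C \<Longrightarrow> (c * e) ^ N c e * (g c / g e) \<in> A" by metis
  \<comment> \<open>An exponent that serves all pairs. With it \<open>c ^ M * g c\<close> is a
    section of \<open>L\<close> over the whole chart, and \<open>c ^ M / g c\<close> multiplies
    \<open>L\<close> into the structure sheaf.\<close>
  define M where "M = (\<Sum>c\<in>C. \<Sum>e\<in>C. N c e)"
  have M: "(c * e) ^ M * (g c / g e) \<in> A" if ce: "c \<in> C" "e \<in> C" for c e
  proof -
    have "N c e \<le> (\<Sum>e\<in>C. N c e)" using C(1) ce by (intro member_le_sum) auto
    also have "\<dots> \<le> M" unfolding M_def using C(1) ce by (intro member_le_sum) auto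
    finally have "(c * e) ^ M * (g c / g e) = (c * e) ^ (M - N c e) * ((c * e) ^ N c e * (g c / g e))"
      by (simp flip: power_add mult.assoc)
    moreover have "(c * e) ^ (M - N c e) \<in> A" using ce CA by (intro power_mem mult_mem) auto
    ultimately show ?thesis using mult_mem N[OF ce] by metis
  qed
  define I where "I = {f. \<forall>S\<in>Spec A. f \<in> L S}"
  define J where "J = {f. \<forall>S\<in>Spec A. \<forall>l\<in>L S. f * l \<in> S}"
  have local: "\<exists>e\<in>C. 1 / e \<in> S \<and> L S = (\<lambda>a. g e * a) ` S" if S: "S \<in> Spec A" for S
  proof -
    obtain P where P: "prime_in A P" "S = localization A P" using S A by (rule SpecE)
    obtain e where "e \<in> C" "e \<notin> P" using unit P by blast
    then have "1 / e \<in> S" using inverse_mem_localization_iff[OF A P(1)] P CA by blast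
    then show ?thesis using \<open>e \<in> C\<close> g S by blast
  qed
  have I: "c ^ M * g c \<in> I" if c: "c \<in> C" for c
    unfolding I_def
  proof clarify
    fix S assume S: "S \<in> Spec A"
    then obtain e where e: "e \<in> C" "1 / e \<in> S" "L S = (\<lambda>a. g e * a) ` S" using local by blast
    interpret S: subring_set S using S A Spec_subring by blast
    have "(c * e) ^ M * (g c / g e) * (1 / e) ^ M \<in> S"
      using S.mult_mem[OF subsetD[OF Spec_superset[OF S A] M[OF c e(1)]] S.power_mem[OF e(2)]] .
    moreover have "c ^ M * g c = g e * ((c * e) ^ M * (g c / g e) * (1 / e) ^ M)"
      using CA[OF e(1)] g(1)[OF e(1)] by (simp add: field_simps)
    ultimately show "c ^ M * g c \<in> L S" using e(3) by blast
  qed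
  have J: "c ^ M / g c \<in> J" if c: "c \<in> C" for c
    unfolding J_def
  proof clarify
    fix S l assume S: "S \<in> Spec A" and l: "l \<in> L S"
    then obtain e where e: "e \<in> C" "1 / e \<in> S" "L S = (\<lambda>a. g e * a) ` S" using local by blast
    interpret S: subring_set S using S A Spec_subring by blast
    obtain s where s: "s \<in> S" "l = g e * s" using l e by blast
    have "(e * c) ^ M * (g e / g c) * (1 / e) ^ M * s \<in> S"
      using S.mult_mem[OF S.mult_mem[OF subsetD[OF Spec_superset[OF S A] M[OF e(1) c]] S.power_mem[OF e(2)]] s(1)] .
    moreover have "c ^ M / g c * l = (e * c) ^ M * (g e / g c) * (1 / e) ^ M * s"
      using CA[OF e(1)] g(1)[OF c] by (simp add: s field_simps)
    ultimately show "c ^ M / g c * l \<in> S" by metis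
  qed
  define \<P> where "\<P> = {\<Sum>(a, b)\<leftarrow>xs. a * b |xs. set xs \<subseteq> I \<times> J}"
  have "ideal_in A \<P>" unfolding \<P>_def
  proof (rule ideal_in_sum_list_products[OF A])
    show "a * b \<in> A" if "a \<in> I" "b \<in> J" for a b
      using that by (intro Inter_Spec[OF A]) (auto simp: I_def J_def mult.commute)
    show "c * a \<in> I" if ca: "c \<in> A" "a \<in> I" for c a
      unfolding I_def
    proof clarify
      fix S assume S: "S \<in> Spec A"
      then obtain e where e: "L S = (\<lambda>a. g e * a) ` S" using local by blast
      then obtain s where s: "s \<in> S" "a = g e * s" using ca S by (auto simp: I_def)
      have "c * s \<in> S" using s ca Spec_superset[OF S A] subring_set.mult_mem[OF Spec_subring[OF S A]] by blast
      moreover have "c * a = g e * (c * s)" by (simp add: s)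
      ultimately show "c * a \<in> L S" using e by blast
    qed
  qed
  \<comment> \<open>The products of these sections with their partners are
    \<open>c ^ (M + M)\<close>. No prime contains all of them, because none contains all of
    \<open>C\<close>.\<close>
  have "1 \<in> \<P>"
  proof (rule ccontr)
    assume "1 \<notin> \<P>"
    then obtain P where P: "prime_in A P" "\<P> \<subseteq> P"
      using prime_avoiding_powers_exists[OF A \<open>ideal_in A \<P>\<close> one_mem] by auto
    obtain c where c: "c \<in> C" "c \<notin> P" using unit P by blast
    have "(\<Sum>(a, b)\<leftarrow>[(c ^ M * g c, c ^ M / g c)]. a * b) \<in> \<P>"
      unfolding \<P>_def using I[OF c(1)] J[OF c(1)]
      by (intro CollectI exI[of _ "[(c ^ M * g c, c ^ M / g c)]"]) auto
    moreover have "(\<Sum>(a, b)\<leftarrow>[(c ^ M * g c, c ^ M / g c)]. a * b) = c ^ (M + M)"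
      using g(1)[OF c(1)] by (simp add: power_add)
    ultimately have "c ^ (M + M) \<in> P" using P by auto
    then have "c \<in> P" using prime_in_power[OF P(1) A] CA c by blast
    with c show False by simp
  qed
  then obtain ys where ys: "set ys \<subseteq> I \<times> J" "1 = (\<Sum>(a, b)\<leftarrow>ys. a * b)" by (auto simp: \<P>_def)
  show thesis
  proof
    show "(\<Sum>i<length ys. fst (ys ! i) * snd (ys ! i)) = 1"
      using ys(2) by (simp add: sum_list_sum_nth atLeast0LessThan case_prod_beta)
    fix i S assume i: "i < length ys" and S: "S \<in> Spec A"
    have "ys ! i \<in> I \<times> J" using i ys(1) nth_mem by blast
    then have IJ: "fst (ys ! i) \<in> I" "snd (ys ! i) \<in> J" by auto
    show "fst (ys ! i) \<in> L S" using IJ S by (auto simp: I_def)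
    show "snd (ys ! i) * l \<in> S" if "l \<in> L S" for l using IJ S that by (auto simp: J_def)
  qed
qed

section \<open>Rational cones\<close>

lemma pairing_integral:
  assumes "\<And>i. v $ i \<in> \<int>"
  shows "pairing m v \<in> \<int>"
  unfolding pairing_def using assms by (intro Ints_sum Ints_mult) auto

text \<open>Dirichlet's theorem applied to the coordinates of \<open>w\<close>. The error bound
  holds for all \<open>x\<close> simultaneously and \<open>q\<close> is at least 1, so one lattice
  point can be tested on all generators of a cone and on a vector outside it.\<close>

lemma lattice_approximation:
  fixes w :: "real^'n::finite"
  assumes "e > 0"
  obtains m :: "'n lattice" and q :: real where "q \<ge> 1"
    "\<And>x. \<bar>pairing m x - q * (w \<bullet> x)\<bar> \<le> e * (\<Sum>j\<in>UNIV. \<bar>x $ j\<bar>)"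
proof -
  obtain h :: "'n \<Rightarrow> nat" where h: "bij_betw h UNIV {0..<CARD('n)}"
    using ex_bij_betw_finite_nat[of "UNIV :: 'n set"] by auto
  obtain N :: nat where N: "N > 0" "1 / real N < e"
    using assms by (metis nat_approx_posE zero_less_Suc)
  obtain q p where qp: "0 < q" "\<And>i. i < CARD('n) \<Longrightarrow>
      \<bar>of_int q * (w $ inv_into UNIV h i) - of_int (p i)\<bar> < 1 / N"
    using Dirichlet_approx_simult[OF N(1), of "CARD('n)" "\<lambda>i. w $ inv_into UNIV h i"] by blast
  define m :: "'n lattice" where "m = lattice_of (p \<circ> h)"
  have m: "\<bar>of_int (lookup m j) - of_int q * w $ j\<bar> \<le> e" for j
  proof -
    have "h j < CARD('n)" using h by (auto simp: bij_betw_def)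
    moreover have "inv_into UNIV h (h j) = j" using h by (simp add: bij_betw_def)
    ultimately have "\<bar>of_int q * (w $ j) - of_int (p (h j))\<bar> < 1 / N" using qp(2)[of "h j"] by simp
    then show ?thesis using N by (simp add: m_def)
  qed
  show thesis
  proof
    show "real_of_int q \<ge> 1" using qp by simp
    fix x :: "real^'n"
    have "pairing m x - of_int q * (w \<bullet> x) =
        (\<Sum>j\<in>UNIV. (of_int (lookup m j) - of_int q * w $ j) * x $ j)"
      by (simp add: pairing_def inner_vec_def sum_distrib_left left_diff_distrib sum_subtractf mult.assoc)
    also have "\<bar>\<dots>\<bar> \<le> (\<Sum>j\<in>UNIV. \<bar>(of_int (lookup m j) - of_int q * w $ j) * x $ j\<bar>)"
      by (rule sum_abs)
    also have "\<dots> \<le> (\<Sum>j\<in>UNIV. e * \<bar>x $ j\<bar>)"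
      using m by (intro sum_mono) (auto simp: abs_mult intro: mult_right_mono)
    finally show "\<bar>pairing m x - of_int q * (w \<bullet> x)\<bar> \<le> e * (\<Sum>j\<in>UNIV. \<bar>x $ j\<bar>)"
      by (simp add: sum_distrib_left)
  qed
qed

definition dual_cone :: "(real^'n) set \<Rightarrow> 'n::finite lattice set" where
  "dual_cone \<sigma> = {m. \<forall>v\<in>\<sigma>. 0 \<le> pairing m v}"

lemma pairing_nonneg_hull:
  assumes "\<And>v. v \<in> S \<Longrightarrow> 0 \<le> pairing m v" "v \<in> convex_cone hull S"
  shows "0 \<le> pairing m v"
proof -
  have "convex_cone hull S \<subseteq> {v. lattice_vec m \<bullet> v \<ge> 0}"
    using assms(1) by (intro hull_minimal convex_cone_halfspace_ge) (auto simp: pairing_eq_inner)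
  then show ?thesis using assms(2) by (auto simp: pairing_eq_inner)
qed

text \<open>
  A separating real functional can be chosen in the lattice by simultaneous Diophantine
  approximation: on the integral generators the approximating values are integers \<open>> -1\<close>.
\<close>

lemma lattice_separation:
  fixes \<sigma> :: "(real^'n::finite) set"
  assumes "rational_cone \<sigma>" "v \<notin> \<sigma>"
  obtains m where "m \<in> dual_cone \<sigma>" "pairing m v < 0"
proof -
  obtain S where S: "finite S" "\<And>s i. s \<in> S \<Longrightarrow> s $ i \<in> \<int>" "\<sigma> = convex_cone hull S"
    using assms(1) by (auto simp: rational_cone_def)
  have "convex \<sigma>" "closed \<sigma>"
    using closed_convex_cone_hull[OF S(1)] convex_convex_cone_hull by (auto simp: S(3))
  then obtain w b where w: "w \<bullet> v < b" "\<And>x. x \<in> \<sigma> \<Longrightarrow> b < w \<bullet> x"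
    using separating_hyperplane_closed_point[of \<sigma> v] assms(2) by auto
  have "0 \<in> \<sigma>" using convex_cone_hull_contains_0 S(3) by blast
  then have b: "b < 0" using w(2) by force
  have pos: "0 \<le> w \<bullet> x" if x: "x \<in> \<sigma>" for x
  proof (rule ccontr)
    assume "\<not> 0 \<le> w \<bullet> x"
    then have neg: "w \<bullet> x < 0" by simp
    have "(b / (w \<bullet> x)) *\<^sub>R x \<in> \<sigma>"
      unfolding S(3) using x S(3) b neg by (intro convex_cone_hull_mul) (auto simp: divide_nonpos_neg)
    from w(2)[OF this] neg show False by simp
  qed
  define C where "C = (\<Sum>s\<in>S. \<Sum>j\<in>UNIV. \<bar>s $ j\<bar>)"
  define D where "D = (\<Sum>j\<in>UNIV. \<bar>v $ j\<bar>)"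
  have CD: "C \<ge> 0" "D \<ge> 0" by (auto simp: C_def D_def intro!: sum_nonneg)
  \<comment> \<open>The first bound keeps the error below 1 on every generator. The second keeps it
    at most \<open>- b\<close> at \<open>v\<close>, where \<open>q * (w \<bullet> v)\<close> is
    below \<open>b\<close>, so that the value at \<open>v\<close> stays negative.\<close>
  define e where "e = min (1 / (C + 1)) (- b / (D + 1))"
  have e: "e > 0" using CD b by (simp add: e_def divide_neg_pos)
  obtain m q where m: "q \<ge> 1" "\<And>x. \<bar>pairing m x - q * (w \<bullet> x)\<bar> \<le> e * (\<Sum>j\<in>UNIV. \<bar>x $ j\<bar>)"
    using lattice_approximation[OF e] by blast
  have "0 \<le> pairing m s" if s: "s \<in> S" for s
  proof -
    have "(\<Sum>j\<in>UNIV. \<bar>s $ j\<bar>) \<le> C"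
      unfolding C_def using S(1) s by (intro member_le_sum) (auto intro: sum_nonneg)
    then have "e * (\<Sum>j\<in>UNIV. \<bar>s $ j\<bar>) \<le> e * C" using e by simp
    also have "\<dots> \<le> 1 / (C + 1) * C" using CD by (intro mult_right_mono) (auto simp: e_def)
    also have "\<dots> < 1" using CD by simp
    finally have "\<bar>pairing m s - q * (w \<bullet> s)\<bar> < 1" using m(2)[of s] by simp
    moreover have "0 \<le> q * (w \<bullet> s)" using pos hull_inc[of s S] s S(3) m(1) by (intro mult_nonneg_nonneg) auto
    ultimately have "pairing m s > -1" by linarith
    moreover obtain k where "pairing m s = of_int k" using pairing_integral[of s m] S(2)[OF s] by (auto elim: Ints_cases)
    ultimately show ?thesis by simp
  qed
  then have "m \<in> dual_cone \<sigma>"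
    using pairing_nonneg_hull unfolding dual_cone_def S(3) by blast
  moreover have "pairing m v < 0"
  proof -
    have "e * D \<le> - b / (D + 1) * D" using CD by (intro mult_right_mono) (auto simp: e_def)
    also have "\<dots> \<le> - b" using CD b by (simp add: field_simps)
    finally have "pairing m v - q * (w \<bullet> v) \<le> - b" using m(2)[of v] by (simp add: D_def)
    moreover have "q * (w \<bullet> v) \<le> 1 * (w \<bullet> v)"
      using m(1) w(1) b by (intro mult_right_mono_neg) auto
    ultimately show ?thesis using w(1) by linarith
  qed
  ultimately show thesis using that by blast
qed

lemma bidual_cone:
  assumes "rational_cone \<sigma>" "\<And>m. m \<in> dual_cone \<sigma> \<Longrightarrow> 0 \<le> pairing m v"
  shows "v \<in> \<sigma>"
  using lattice_separation[OF assms(1), of v] assms(2) by (metis not_less)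

lemma rational_cone_convex_cone: "rational_cone \<sigma> \<Longrightarrow> convex_cone \<sigma>"
  by (auto simp: rational_cone_def convex_cone_convex_cone_hull)

lemma pairing_uminus_right: "pairing m (- v) = - pairing m v"
  by (simp add: pairing_eq_inner)

text \<open>For every generator \<open>s \<noteq> 0\<close> some element of the dual cone is
  positive on \<open>s\<close>, since otherwise \<open>- s\<close> would lie in the bidual, that is
  in \<open>\<sigma>\<close>, against strong convexity. The sum of these elements is positive on all
  nonzero generators.\<close>

lemma interior_dual_exists:
  fixes \<sigma> :: "(real^'n::finite) set"
  assumes \<sigma>: "rational_cone \<sigma>" "strongly_convex \<sigma>"
  obtains u where "\<And>v. v \<in> \<sigma> \<Longrightarrow> v \<noteq> 0 \<Longrightarrow> 0 < pairing u v"
proof -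
  obtain S where S: "finite S" "\<sigma> = convex_cone hull S"
    using \<sigma>(1) by (auto simp: rational_cone_def)
  have "\<exists>m\<in>dual_cone \<sigma>. s \<noteq> 0 \<longrightarrow> 0 < pairing m s" if s: "s \<in> S" for s
  proof (rule ccontr)
    assume neg: "\<not> ?thesis"
    have "0 \<in> dual_cone \<sigma>" by (simp add: dual_cone_def pairing_zero)
    with neg have "s \<noteq> 0" by auto
    have "- s \<in> \<sigma>" using neg by (intro bidual_cone[OF \<sigma>(1)]) (force simp: pairing_uminus_right)
    moreover have "s \<in> \<sigma>" using s S(2) hull_inc by metis
    ultimately have "s \<in> \<sigma> \<inter> uminus ` \<sigma>" by force
    then show False using \<sigma>(2) \<open>s \<noteq> 0\<close> by (auto simp: strongly_convex_def)
  qed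
  then obtain m where m: "\<And>s. s \<in> S \<Longrightarrow> m s \<in> dual_cone \<sigma>" "\<And>s. s \<in> S \<Longrightarrow> s \<noteq> 0 \<Longrightarrow> 0 < pairing (m s) s"
    by metis
  define u where "u = (\<Sum>s\<in>S. m s)"
  have pos: "0 < pairing u s" if s: "s \<in> S" "s \<noteq> 0" for s
  proof -
    have "s \<in> \<sigma>" using s S(2) hull_inc by metis
    then have "0 \<le> pairing (m t) s" if "t \<in> S" for t using m(1)[OF that] by (simp add: dual_cone_def)
    then show ?thesis unfolding u_def pairing_sum using S(1) s m(2)
      by (intro sum_pos2[of S s]) auto
  qed
  let ?H = "insert 0 {v. 0 < pairing u v}"
  have "\<sigma> \<subseteq> ?H"
    unfolding S(2)
  proof (rule hull_minimal)
    show "S \<subseteq> ?H" using pos by auto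
    show "convex_cone ?H"
      unfolding convex_cone_iff
      by (auto simp: pairing_eq_inner inner_right_distrib intro: add_pos_pos)
  qed
  then show thesis using that by blast
qed

text \<open>In a generating set of minimal cardinality, every element spans an extremal ray.\<close>

lemma minimal_generators:
  fixes \<sigma> :: "(real^'n::finite) set"
  assumes "rational_cone \<sigma>"
  obtains F where "finite F" "\<sigma> = convex_cone hull F" "\<And>v i. v \<in> F \<Longrightarrow> v $ i \<in> \<int>"
    "\<And>v. v \<in> F \<Longrightarrow> \<exists>m. pairing m v < 0 \<and> (\<forall>w\<in>F - {v}. 0 \<le> pairing m w)"
proof -
  define G where "G = (\<lambda>F. finite F \<and> (\<forall>v\<in>F. \<forall>i. v $ i \<in> \<int>) \<and> \<sigma> = convex_cone hull F)"
  obtain F0 where "G F0" using assms by (auto simp: rational_cone_def G_def)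
  then obtain F where F: "G F" "\<And>F'. G F' \<Longrightarrow> card F \<le> card F'"
    using ex_has_least_nat[of G F0 card] by blast
  have "\<exists>m. pairing m v < 0 \<and> (\<forall>w\<in>F - {v}. 0 \<le> pairing m w)" if v: "v \<in> F" for v
  proof -
    let ?\<tau> = "convex_cone hull (F - {v})"
    have rat: "rational_cone ?\<tau>" using F(1) by (auto simp: rational_cone_def G_def)
    have "v \<notin> ?\<tau>"
    proof
      assume "v \<in> ?\<tau>"
      then have "F \<subseteq> ?\<tau>" using hull_subset[of "F - {v}" convex_cone] by blast
      then have "convex_cone hull F \<subseteq> ?\<tau>" by (intro hull_minimal convex_cone_convex_cone_hull)
      then have "convex_cone hull F = ?\<tau>" using hull_mono[of "F - {v}" F convex_cone] by blast
      then have "G (F - {v})" using F(1) by (auto simp: G_def)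
      then have "card F \<le> card (F - {v})" by (rule F(2))
      moreover have "card (F - {v}) < card F" using F(1) v by (intro card_Diff1_less) (auto simp: G_def)
      ultimately show False by simp
    qed
    then obtain m where "m \<in> dual_cone ?\<tau>" "pairing m v < 0" using lattice_separation[OF rat] by blast
    then show ?thesis using hull_inc[of _ "F - {v}" convex_cone] by (auto simp: dual_cone_def)
  qed
  then show thesis using that[of F] F(1) unfolding G_def by blast
qed

section \<open>Monomial valuations\<close>

text \<open>The monomial valuation attached to \<open>v\<close>. For the primitive generator of a
  ray it is the order of vanishing along the corresponding toric divisor; here \<open>v\<close> may
  be any real vector.\<close>

definition lorder :: "real^'n::{finite,linorder} \<Rightarrow> 'n laurent \<Rightarrow> real" where
  "lorder v p = Min ((\<lambda>m. pairing m v) ` keys p)"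

lemma keys_nonempty: "p \<noteq> 0 \<Longrightarrow> keys p \<noteq> {}"
  by (metis all_not_in_conv in_keys_iff lookup_zero poly_mapping_eqI)

lemma lorder_le: "m \<in> keys p \<Longrightarrow> lorder v p \<le> pairing m v"
  by (simp add: lorder_def)

lemma lorder_ge_iff: "p \<noteq> 0 \<Longrightarrow> c \<le> lorder v p \<longleftrightarrow> (\<forall>m\<in>keys p. c \<le> pairing m v)"
  by (simp add: lorder_def keys_nonempty)

lemma lorder_attained:
  assumes "p \<noteq> 0"
  obtains m where "m \<in> keys p" "pairing m v = lorder v p"
proof -
  have "lorder v p \<in> (\<lambda>m. pairing m v) ` keys p"
    unfolding lorder_def using keys_nonempty[OF assms] by (intro Min_in) auto
  then show thesis using that by force
qed

lemma initial_form:
  fixes p :: "'n::{finite,linorder} laurent"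
  assumes "p \<noteq> 0"
  obtains p0 p1 where "p = p0 + p1" "p0 \<noteq> 0"
    "\<And>m. m \<in> keys p0 \<Longrightarrow> pairing m v = lorder v p"
    "\<And>m. m \<in> keys p1 \<Longrightarrow> lorder v p < pairing m v"
proof -
  define K where "K = {m \<in> keys p. pairing m v = lorder v p}"
  define p0 where "p0 = (\<Sum>m\<in>K. single m (lookup p m))"
  have K: "finite K" "K \<subseteq> keys p" by (auto simp: K_def)
  have lookup: "lookup p0 m = (if m \<in> K then lookup p m else 0)" for m
    using K by (simp add: p0_def lookup_sum lookup_single when_def)
  obtain m where "m \<in> keys p" "pairing m v = lorder v p"
    using lorder_attained[OF assms] by blast
  then have "lookup p0 m \<noteq> 0" by (simp add: lookup K_def in_keys_iff)
  then have "p0 \<noteq> 0" by auto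
  moreover have "pairing m v = lorder v p" if "m \<in> keys p0" for m
    using that by (auto simp: in_keys_iff lookup K_def split: if_splits)
  moreover have "lorder v p < pairing m v" if "m \<in> keys (p - p0)" for m
  proof -
    have "m \<in> keys p" "m \<notin> K"
      using that by (auto simp: in_keys_iff lookup lookup_minus split: if_splits)
    then show ?thesis using lorder_le[of m p v] by (auto simp: K_def)
  qed
  ultimately show thesis using that[of p0 "p - p0"] by simp
qed

text \<open>The product of the two initial forms is nonzero, as Laurent polynomials form a domain.
  All other contributions have strictly larger order and cannot cancel its exponents.\<close>

lemma lorder_mult:
  fixes p q :: "'n::{finite,linorder} laurent"
  assumes "p \<noteq> 0" "q \<noteq> 0"
  shows "lorder v (p * q) = lorder v p + lorder v q"
proof (rule antisym)
  have pq: "p * q \<noteq> 0" using assms by simp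
  show "lorder v p + lorder v q \<le> lorder v (p * q)"
    unfolding lorder_ge_iff[OF pq]
  proof
    fix m assume "m \<in> keys (p * q)"
    then obtain k l where "k \<in> keys p" "l \<in> keys q" "m = k + l"
      using keys_mult[of p q] by blast
    then show "lorder v p + lorder v q \<le> pairing m v"
      using lorder_le[of k p v] lorder_le[of l q v] by (simp add: pairing_add)
  qed
  obtain p0 p1 where p: "p = p0 + p1" "p0 \<noteq> 0"
      "\<And>m. m \<in> keys p0 \<Longrightarrow> pairing m v = lorder v p"
      "\<And>m. m \<in> keys p1 \<Longrightarrow> lorder v p < pairing m v"
    using initial_form[OF assms(1)] by blast
  obtain q0 q1 where q: "q = q0 + q1" "q0 \<noteq> 0"
      "\<And>m. m \<in> keys q0 \<Longrightarrow> pairing m v = lorder v q"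
      "\<And>m. m \<in> keys q1 \<Longrightarrow> lorder v q < pairing m v"
    using initial_form[OF assms(2)] by blast
  define r where "r = p0 * q1 + p1 * q"
  have r: "lorder v p + lorder v q < pairing m v" if m: "m \<in> keys r" for m
  proof -
    from m consider "m \<in> keys (p0 * q1)" | "m \<in> keys (p1 * q)"
      unfolding r_def using keys_add[of "p0 * q1" "p1 * q"] by blast
    then show ?thesis
    proof cases
      case 1
      then obtain k l where "k \<in> keys p0" "l \<in> keys q1" "m = k + l"
        using keys_mult[of p0 q1] by blast
      then show ?thesis using p(3)[of k] q(4)[of l] by (simp add: pairing_add)
    next
      case 2
      then obtain k l where "k \<in> keys p1" "l \<in> keys q" "m = k + l"
        using keys_mult[of p1 q] by blast
      then show ?thesis using p(4)[of k] lorder_le[of l q v] by (simp add: pairing_add)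
    qed
  qed
  have "p0 * q0 \<noteq> 0" using p q by simp
  then obtain m where m: "m \<in> keys (p0 * q0)" using keys_nonempty by blast
  then obtain k l where "k \<in> keys p0" "l \<in> keys q0" "m = k + l"
    using keys_mult[of p0 q0] by blast
  then have eq: "pairing m v = lorder v p + lorder v q" using p q by (simp add: pairing_add)
  then have "m \<notin> keys r" using r by force
  moreover have "p * q = p0 * q0 + r" by (simp add: r_def p(1) q(1) algebra_simps)
  ultimately have "m \<in> keys (p * q)" using m by (simp add: in_keys_iff lookup_add)
  then show "lorder v (p * q) \<le> lorder v p + lorder v q" using lorder_le[of m "p * q" v] eq by simp
qed

text \<open>As for Laurent polynomials, the value at \<open>0\<close> is meaningless.\<close>

definition worder :: "real^'n::{finite,linorder} \<Rightarrow> 'n ratfun \<Rightarrow> real" where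
  "worder v f = (SOME r. \<exists>p q. p \<noteq> 0 \<and> q \<noteq> 0 \<and> f = of_laurent p / of_laurent q \<and> r = lorder v p - lorder v q)"

lemma worder_divide:
  assumes "p \<noteq> 0" "q \<noteq> 0"
  shows "worder v (of_laurent p / of_laurent q) = lorder v p - lorder v q"
  unfolding worder_def
proof (rule some_equality)
  show "\<exists>p' q'. p' \<noteq> 0 \<and> q' \<noteq> 0 \<and> of_laurent p / of_laurent q = of_laurent p' / of_laurent q' \<and>
      lorder v p - lorder v q = lorder v p' - lorder v q'"
    using assms by blast
  fix r assume "\<exists>p' q'. p' \<noteq> 0 \<and> q' \<noteq> 0 \<and> of_laurent p / of_laurent q = of_laurent p' / of_laurent q' \<and>
      r = lorder v p' - lorder v q'"
  then obtain p' q' where *: "p' \<noteq> 0" "q' \<noteq> 0" "of_laurent p / of_laurent q = of_laurent p' / of_laurent q'"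
      "r = lorder v p' - lorder v q'" by blast
  then have "of_laurent (p * q') = of_laurent (p' * q)"
    using assms by (simp add: of_laurent_mult frac_eq_eq)
  then have "p * q' = p' * q" by simp
  then have "lorder v p + lorder v q' = lorder v p' + lorder v q"
    using assms * by (metis lorder_mult)
  then show "r = lorder v p - lorder v q" using *(4) by simp
qed

lemma lorder_single: "c \<noteq> 0 \<Longrightarrow> lorder v (single m c) = pairing m v"
  by (simp add: lorder_def)

lemma worder_of_laurent: "p \<noteq> 0 \<Longrightarrow> worder v (of_laurent p) = lorder v p"
  using worder_divide[of p 1 v] lorder_single[of 1 v 0] by (simp add: pairing_zero)

lemma worder_monomial: "worder v (monomial m) = pairing m v"
  using worder_of_laurent[of "single m 1" v] monomial_nonzero[of m]
  by (auto simp: monomial_def lorder_single)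

lemma nonzero_ratfun_cases:
  assumes "f \<noteq> 0"
  obtains p q where "f = of_laurent p / of_laurent q" "p \<noteq> 0" "q \<noteq> 0"
  using assms by (metis ratfun_cases divide_eq_0_iff of_laurent_0)

lemma worder_mult:
  assumes "f \<noteq> 0" "g \<noteq> 0"
  shows "worder v (f * g) = worder v f + worder v g"
proof -
  obtain p q where f: "f = of_laurent p / of_laurent q" "p \<noteq> 0" "q \<noteq> 0"
    using assms(1) by (rule nonzero_ratfun_cases)
  obtain r s where g: "g = of_laurent r / of_laurent s" "r \<noteq> 0" "s \<noteq> 0"
    using assms(2) by (rule nonzero_ratfun_cases)
  have "f * g = of_laurent (p * r) / of_laurent (q * s)" by (simp add: f g of_laurent_mult)
  then have "worder v (f * g) = lorder v (p * r) - lorder v (q * s)"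
    using f g by (simp add: worder_divide del: of_laurent_mult)
  then show ?thesis using f g by (simp add: worder_divide lorder_mult)
qed

lemma worder_one: "worder v 1 = 0"
  using worder_mult[of 1 1 v] by simp

lemma worder_div:
  assumes "f \<noteq> 0" "g \<noteq> 0"
  shows "worder v (f / g) = worder v f - worder v g"
  using worder_mult[of "f / g" g v] assms by simp

lemma worder_power: "f \<noteq> 0 \<Longrightarrow> worder v (f ^ k) = real k * worder v f"
  by (induction k) (simp_all add: worder_one worder_mult distrib_right)

lemma worder_uminus: "worder v (- f) = worder v f"
proof (cases "f = 0")
  case False
  have "worder v (- 1) + worder v (- 1) = 0"
    using worder_mult[of "- 1" "- 1" v] by (simp add: worder_one)
  then show ?thesis using worder_mult[of "- 1" f v] False by simp
qed simp

lemma worder_add: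
  assumes "f \<noteq> 0" "g \<noteq> 0" "f + g \<noteq> 0" "c \<le> worder v f" "c \<le> worder v g"
  shows "c \<le> worder v (f + g)"
proof -
  obtain p q where f: "f = of_laurent p / of_laurent q" "p \<noteq> 0" "q \<noteq> 0"
    using assms(1) by (rule nonzero_ratfun_cases)
  obtain r s where g: "g = of_laurent r / of_laurent s" "r \<noteq> 0" "s \<noteq> 0"
    using assms(2) by (rule nonzero_ratfun_cases)
  have eq: "f + g = of_laurent (p * s + r * q) / of_laurent (q * s)"
    using f g by (simp add: of_laurent_mult of_laurent_add add_frac_eq)
  with assms(3) have nz: "p * s + r * q \<noteq> 0" by auto
  have "c + lorder v (q * s) \<le> lorder v (p * s + r * q)"
    unfolding lorder_ge_iff[OF nz]
  proof
    fix m assume "m \<in> keys (p * s + r * q)"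
    then consider "m \<in> keys (p * s)" | "m \<in> keys (r * q)"
      using keys_add[of "p * s" "r * q"] by blast
    then show "c + lorder v (q * s) \<le> pairing m v"
    proof cases
      case 1
      then have "lorder v (p * s) \<le> pairing m v" by (rule lorder_le)
      then show ?thesis using assms(4) f g by (simp add: lorder_mult worder_divide)
    next
      case 2
      then have "lorder v (r * q) \<le> pairing m v" by (rule lorder_le)
      then show ?thesis using assms(5) f g by (simp add: lorder_mult worder_divide)
    qed
  qed
  then show ?thesis using f g nz unfolding eq by (simp add: worder_divide del: of_laurent_mult)
qed

section \<open>Valuation rings of monomial valuations and their centres\<close>

definition valuation_ring :: "real^'n::{finite,linorder} \<Rightarrow> 'n ratfun set" where
  "valuation_ring v = {f. f = 0 \<or> 0 \<le> worder v f}"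

lemma subring_valuation_ring: "subring_set (valuation_ring v)"
proof
  show "1 \<in> valuation_ring v" by (simp add: valuation_ring_def worder_one)
  fix f g assume fg: "f \<in> valuation_ring v" "g \<in> valuation_ring v"
  show "f * g \<in> valuation_ring v"
    using fg by (cases "f = 0 \<or> g = 0") (auto simp: valuation_ring_def worder_mult)
  show "f - g \<in> valuation_ring v"
  proof (cases "f = 0 \<or> g = 0 \<or> f = g")
    case True
    then show ?thesis using fg by (auto simp: valuation_ring_def worder_uminus)
  next
    case False
    then have "0 \<le> worder v (f + - g)"
      using fg by (intro worder_add) (auto simp: valuation_ring_def worder_uminus)
    then show ?thesis by (simp add: valuation_ring_def)
  qed
qed

abbreviation positive_order :: "real^'n::{finite,linorder} \<Rightarrow> 'n ratfun set \<Rightarrow> 'n ratfun set" where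
  "positive_order v A \<equiv> {f \<in> A. f = 0 \<or> 0 < worder v f}"

text \<open>This prime is the centre of the valuation on \<open>Spec A\<close>. It turns a vector
  \<open>v\<close> into a point of a chart whose local ring still has no functions of negative order
  along \<open>v\<close>.\<close>

lemma prime_in_positive_order:
  assumes A: "subring_set A" "A \<subseteq> valuation_ring v"
  shows "prime_in A (positive_order v A)"
proof -
  interpret subring_set A by fact
  have ge: "0 \<le> worder v f" if "f \<in> A" "f \<noteq> 0" for f
    using A(2) that by (auto simp: valuation_ring_def)
  show ?thesis
    unfolding prime_in_def ideal_in_def
  proof (intro conjI ballI impI)
    fix f g assume f: "f \<in> positive_order v A" and g: "g \<in> positive_order v A"
    show "f + g \<in> positive_order v A"
    proof (cases "f = 0 \<or> g = 0 \<or> f + g = 0")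
      case True
      then show ?thesis using f g by (auto intro: zero_mem)
    next
      case False
      then have "min (worder v f) (worder v g) \<le> worder v (f + g)"
        by (intro worder_add) auto
      then show ?thesis using f g False by (auto intro: add_mem)
    qed
  next
    fix f g assume f: "f \<in> A" and g: "g \<in> positive_order v A"
    show "f * g \<in> positive_order v A"
    proof (cases "f = 0 \<or> g = 0")
      case False
      then show ?thesis using f g ge[OF f] by (auto simp: worder_mult intro: mult_mem add_nonneg_pos)
    qed (auto intro: zero_mem)
  next
    fix f g assume f: "f \<in> A" and g: "g \<in> A" and fg: "f * g \<in> positive_order v A"
    show "f \<in> positive_order v A \<or> g \<in> positive_order v A"
      using f g fg by (cases "f = 0 \<or> g = 0") (auto simp: worder_mult)
  qed (auto simp: worder_one zero_mem)
qed

lemma localization_positive_order: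
  assumes A: "subring_set A" "A \<subseteq> valuation_ring v"
  shows "localization A (positive_order v A) \<subseteq> valuation_ring v"
proof
  fix f assume "f \<in> localization A (positive_order v A)"
  then obtain a b where ab: "f = a / b" "a \<in> A" "b \<in> A" "b \<notin> positive_order v A" "b \<noteq> 0"
    using prime_in_positive_order[OF A] by (rule localizationE)
  show "f \<in> valuation_ring v"
  proof (cases "a = 0")
    case False
    have "0 \<le> worder v a" using ab A False by (auto simp: valuation_ring_def)
    then show ?thesis using ab False by (simp add: valuation_ring_def worder_div)
  qed (simp add: ab valuation_ring_def)
qed

text \<open>The subfield of fractions of degree 0 for the grading by \<open>v\<close>. It serves to
  show that the polytope of an ample bundle lies in no hyperplane orthogonal to
  \<open>v\<close>.\<close>

definition homogeneous_fractions :: "real^'n::{finite,linorder} \<Rightarrow> 'n ratfun set" where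
  "homogeneous_fractions v = {of_laurent p / of_laurent q |p q. q \<noteq> 0 \<and>
     (\<exists>d. \<forall>m\<in>keys p \<union> keys q. pairing m v = d)}"

lemma keys_mult_pairing:
  assumes "\<And>m. m \<in> keys p \<Longrightarrow> pairing m v = c" "\<And>m. m \<in> keys q \<Longrightarrow> pairing m v = d"
    "m \<in> keys (p * q :: 'n::{finite,linorder} laurent)"
  shows "pairing m v = c + d"
  using keys_mult[of p q] assms by (auto simp: pairing_add)

lemma homogeneous_fractionsI:
  assumes "q \<noteq> 0" "\<And>m. m \<in> keys p \<Longrightarrow> pairing m v = d"
    "\<And>m. m \<in> keys q \<Longrightarrow> pairing m v = d"
  shows "of_laurent p / of_laurent q \<in> homogeneous_fractions v"
  unfolding homogeneous_fractions_def using assms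
  by (intro CollectI exI[of _ p] exI[of _ q] exI[of _ d] conjI) auto

lemma homogeneous_fractionsE:
  assumes "f \<in> homogeneous_fractions v"
  obtains p q d where "f = of_laurent p / of_laurent q" "q \<noteq> 0"
    "\<And>m. m \<in> keys p \<Longrightarrow> pairing m v = d" "\<And>m. m \<in> keys q \<Longrightarrow> pairing m v = d"
  using assms unfolding homogeneous_fractions_def by (auto simp: Un_iff)

lemma homogeneous_fractions_closed:
  assumes f: "f \<in> homogeneous_fractions v" and g: "g \<in> homogeneous_fractions v"
  shows "f + g \<in> homogeneous_fractions v" "f * g \<in> homogeneous_fractions v"
    "f / g \<in> homogeneous_fractions v"
proof -
  obtain p q c where f: "f = of_laurent p / of_laurent q" "q \<noteq> 0"
      "\<And>m. m \<in> keys p \<Longrightarrow> pairing m v = c" "\<And>m. m \<in> keys q \<Longrightarrow> pairing m v = c"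
    using f by (rule homogeneous_fractionsE) (rule that)
  obtain r s d where g: "g = of_laurent r / of_laurent s" "s \<noteq> 0"
      "\<And>m. m \<in> keys r \<Longrightarrow> pairing m v = d" "\<And>m. m \<in> keys s \<Longrightarrow> pairing m v = d"
    using g by (rule homogeneous_fractionsE) (rule that)
  note km = keys_mult_pairing[OF f(3) g(3)] keys_mult_pairing[OF f(3) g(4)]
    keys_mult_pairing[OF f(4) g(3)] keys_mult_pairing[OF f(4) g(4)]
  have "of_laurent (p * s + q * r) / of_laurent (q * s) \<in> homogeneous_fractions v"
  proof (rule homogeneous_fractionsI[where d = "c + d"])
    fix m assume "m \<in> keys (p * s + q * r)"
    then consider "m \<in> keys (p * s)" | "m \<in> keys (q * r)"
      using keys_add[of "p * s" "q * r"] by blast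
    then show "pairing m v = c + d" by cases (simp_all add: km)
  qed (use f g km in auto)
  then show "f + g \<in> homogeneous_fractions v"
    using f g by (simp add: of_laurent_mult of_laurent_add add_frac_eq mult.commute)
  have "of_laurent (p * r) / of_laurent (q * s) \<in> homogeneous_fractions v"
    using f g km by (intro homogeneous_fractionsI[where d = "c + d"]) auto
  then show "f * g \<in> homogeneous_fractions v" by (simp add: f g of_laurent_mult)
  show "f / g \<in> homogeneous_fractions v"
  proof (cases "r = 0")
    case True
    have "of_laurent 0 / of_laurent q \<in> homogeneous_fractions v"
      using f by (intro homogeneous_fractionsI[where d = c]) auto
    then show ?thesis by (simp add: True g)
  next
    case False
    have "of_laurent (p * s) / of_laurent (q * r) \<in> homogeneous_fractions v"
      using f g km False by (intro homogeneous_fractionsI[where d = "c + d"]) auto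
    then show ?thesis by (simp add: f g of_laurent_mult)
  qed
qed

lemma const_eq_of_laurent: "const c = of_laurent (single 0 c)"
  by (simp add: const_def of_laurent_def)

lemma subalgebra_homogeneous_fractions: "subalgebra (homogeneous_fractions v)"
  unfolding subalgebra_def
proof (intro conjI ballI)
  have "of_laurent (single 0 c) / of_laurent 1 \<in> homogeneous_fractions v" for c
    by (intro homogeneous_fractionsI[where d = 0]) (auto simp: pairing_zero split: if_splits)
  then show "range const \<subseteq> homogeneous_fractions v" by (auto simp: const_eq_of_laurent)
qed (auto intro: homogeneous_fractions_closed)

lemma monomial_homogeneous_fractions:
  assumes "monomial m \<in> homogeneous_fractions v"
  shows "pairing m v = 0"
proof -
  obtain p q d where pq: "monomial m = of_laurent p / of_laurent q" "q \<noteq> 0"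
      "\<And>m. m \<in> keys p \<Longrightarrow> pairing m v = d" "\<And>m. m \<in> keys q \<Longrightarrow> pairing m v = d"
    using assms by (rule homogeneous_fractionsE) (rule that)
  have p: "p \<noteq> 0" using pq(1) monomial_nonzero[of m] by auto
  have "lorder v p = d" "lorder v q = d"
    using lorder_attained[OF p, of v] lorder_attained[OF pq(2), of v] pq(3,4) by metis+
  then show ?thesis using worder_divide[OF p pq(2), of v] worder_monomial[of v m] pq(1) by simp
qed

lemma subalgebra_valuation_ring: "subalgebra (valuation_ring v)"
proof -
  interpret subring_set "valuation_ring v" by (rule subring_valuation_ring)
  have "const c \<in> valuation_ring v" for c
  proof (cases "c = 0")
    case False
    then have "single 0 c \<noteq> (0 :: 'a laurent)"
      by (metis lookup_single_eq lookup_zero)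
    then show ?thesis
      using False by (simp add: const_eq_of_laurent valuation_ring_def worder_of_laurent lorder_single pairing_zero)
  qed (simp add: const_eq_of_laurent valuation_ring_def)
  then show ?thesis by (auto simp: subalgebra_def intro: add_mem mult_mem)
qed

section \<open>Line bundles on toric varieties\<close>

lemma cone_algebra_eq: "cone_algebra \<sigma> = of_laurent ` {p. keys p \<subseteq> dual_cone \<sigma>}"
  by (auto simp: cone_algebra_def of_laurent_def dual_cone_def)

lemma of_laurent_mem_cone_algebra: "of_laurent p \<in> cone_algebra \<sigma> \<longleftrightarrow> keys p \<subseteq> dual_cone \<sigma>"
  by (auto simp: cone_algebra_eq)

lemma monomial_mem_cone_algebra: "monomial m \<in> cone_algebra \<sigma> \<longleftrightarrow> m \<in> dual_cone \<sigma>"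
  by (simp add: monomial_def of_laurent_mem_cone_algebra)

lemma dual_cone_zero: "0 \<in> dual_cone \<sigma>"
  by (simp add: dual_cone_def pairing_zero)

lemma dual_cone_add: "a \<in> dual_cone \<sigma> \<Longrightarrow> b \<in> dual_cone \<sigma> \<Longrightarrow> a + b \<in> dual_cone \<sigma>"
  by (simp add: dual_cone_def pairing_add)

lemma subring_cone_algebra: "subring_set (cone_algebra \<sigma>)"
proof
  show "1 \<in> cone_algebra \<sigma>"
    using monomial_mem_cone_algebra[of 0 \<sigma>] dual_cone_zero by simp
  fix f g assume "f \<in> cone_algebra \<sigma>" "g \<in> cone_algebra \<sigma>"
  then obtain p q where pq: "f = of_laurent p" "g = of_laurent q"
      "keys p \<subseteq> dual_cone \<sigma>" "keys q \<subseteq> dual_cone \<sigma>"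
    by (auto simp: cone_algebra_eq)
  have "keys (p - q) \<subseteq> dual_cone \<sigma>" using keys_diff[of p q] pq by blast
  moreover have "keys (p * q) \<subseteq> dual_cone \<sigma>"
    using keys_mult[of p q] pq by (auto intro: dual_cone_add)
  ultimately show "f - g \<in> cone_algebra \<sigma>" "f * g \<in> cone_algebra \<sigma>"
    by (simp_all add: pq of_laurent_mem_cone_algebra flip: of_laurent_mult of_laurent_diff)
qed

lemma cone_algebra_valuation_ring:
  assumes "v \<in> \<sigma>"
  shows "cone_algebra \<sigma> \<subseteq> valuation_ring v"
proof
  fix f assume "f \<in> cone_algebra \<sigma>"
  then obtain p where p: "f = of_laurent p" "keys p \<subseteq> dual_cone \<sigma>"
    by (auto simp: cone_algebra_eq)
  show "f \<in> valuation_ring v"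
  proof (cases "p = 0")
    case False
    have "0 \<le> lorder v p"
      unfolding lorder_ge_iff[OF False] using p assms by (auto simp: dual_cone_def)
    then show ?thesis using False by (simp add: p valuation_ring_def worder_of_laurent)
  qed (simp add: p valuation_ring_def)
qed

lemma cone_algebra_zero: "cone_algebra {0} = range of_laurent"
  by (auto simp: cone_algebra_eq dual_cone_def pairing_eq_inner)

definition lattice_multiple :: "nat \<Rightarrow> 'n lattice \<Rightarrow> 'n lattice" where
  "lattice_multiple k u = (\<Sum>i<k. u)"

lemma pairing_lattice_multiple: "pairing (lattice_multiple k u) v = real k * pairing u v"
  by (simp add: lattice_multiple_def pairing_sum)

lemma monomial_lattice_multiple: "monomial (lattice_multiple k u) = monomial u ^ k"
  by (induction k) (simp_all add: lattice_multiple_def monomial_add mult.commute)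

text \<open>\<open>N\<close> exceeds all the ratios of \<open>pairing k s\<close> to
  \<open>pairing u s\<close> in absolute value. If \<open>u\<close> is positive on all generators,
  this says that inverting its monomial yields all monomials; if \<open>u\<close> vanishes on one of
  them, it yields those of nonnegative order along that one.\<close>

lemma shift_into_dual_cone:
  assumes "finite S" "\<sigma> = convex_cone hull S" "finite K"
    and u: "u \<in> dual_cone \<sigma>" "\<And>k s. k \<in> K \<Longrightarrow> s \<in> S \<Longrightarrow> 0 \<le> pairing k s \<or> 0 < pairing u s"
  shows "\<exists>N. \<forall>k\<in>K. k + lattice_multiple N u \<in> dual_cone \<sigma>"
proof -
  define f where "f = (\<lambda>(k, s). \<bar>pairing k s / pairing u s\<bar>)"
  obtain N where N: "(\<Sum>x\<in>K \<times> S. f x) \<le> real N"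
    using real_arch_simple by blast
  have "0 \<le> pairing (k + lattice_multiple N u) s" if k: "k \<in> K" "s \<in> S" for k s
  proof (cases "0 \<le> pairing k s")
    case True
    moreover have "0 \<le> pairing u s"
      using u(1) hull_inc[OF k(2), of convex_cone] assms(2) by (simp add: dual_cone_def)
    ultimately show ?thesis by (simp add: pairing_add pairing_lattice_multiple)
  next
    case False
    then have pos: "0 < pairing u s" using u(2) k by blast
    have "f (k, s) \<le> (\<Sum>x\<in>K \<times> S. f x)"
      using k assms(1,3) by (intro member_le_sum) (auto simp: f_def)
    with N have "\<bar>pairing k s\<bar> / pairing u s \<le> real N" using pos by (simp add: f_def abs_divide)
    then have "\<bar>pairing k s\<bar> \<le> real N * pairing u s" using pos by (simp add: field_simps)
    then show ?thesis by (simp add: pairing_add pairing_lattice_multiple)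
  qed
  then have "k + lattice_multiple N u \<in> dual_cone \<sigma>" if "k \<in> K" for k
    unfolding dual_cone_def assms(2) using pairing_nonneg_hull[of S "k + lattice_multiple N u"] that by blast
  then show ?thesis by blast
qed

text \<open>Strong convexity makes the origin an extreme point of any cone of the fan. Thus the
  torus is one of the charts.\<close>

lemma zero_cone_in_fan:
  assumes "fan \<Sigma>"
  shows "{0} \<in> \<Sigma>"
proof -
  obtain \<sigma> where \<sigma>: "\<sigma> \<in> \<Sigma>" "rational_cone \<sigma>" "strongly_convex \<sigma>"
    using assms by (auto simp: fan_def)
  have cc: "convex_cone \<sigma>" using \<sigma>(2) by (rule rational_cone_convex_cone)
  have "a = 0" if ab: "a \<in> \<sigma>" "b \<in> \<sigma>" "0 \<in> open_segment a b" for a b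
  proof -
    obtain t where t: "0 < t" "t < 1" "0 = (1 - t) *\<^sub>R a + t *\<^sub>R b"
      using ab(3) by (auto simp: in_segment)
    have "(1 - t) *\<^sub>R a = t *\<^sub>R (- b)" using t(3) by (simp add: eq_neg_iff_add_eq_0)
    moreover have "(1 - t) *\<^sub>R a \<in> \<sigma>" "t *\<^sub>R b \<in> \<sigma>"
      using convex_cone_scaleR[OF cc] ab t by auto
    ultimately have "(1 - t) *\<^sub>R a \<in> \<sigma> \<inter> uminus ` \<sigma>" by force
    then have "(1 - t) *\<^sub>R a = 0"
      by (simp only: \<sigma>(3)[unfolded strongly_convex_def] singleton_iff)
    then show ?thesis using t by simp
  qed
  then have "{0} face_of \<sigma>"
    unfolding face_of_def using convex_cone_contains_0[OF cc]
    by (auto simp: open_segment_commute)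
  then show ?thesis using assms \<sigma>(1) by (auto simp: fan_def)
qed

text \<open>Numerator and denominator are multiplied by a power of the monomial of some
  \<open>u\<close> positive on the cone, which moves them into \<open>cone_algebra \<sigma>\<close>.
  This monomial is a unit on the torus, so the denominator stays outside \<open>P\<close>; hence
  localizing at \<open>P\<close> and at its contraction gives the same ring.\<close>

lemma Spec_torus_subset:
  fixes \<sigma> :: "(real^'n::{finite,linorder}) set"
  assumes \<sigma>: "rational_cone \<sigma>" "strongly_convex \<sigma>"
  shows "Spec (cone_algebra {0}) \<subseteq> Spec (cone_algebra \<sigma>)"
proof
  let ?T = "cone_algebra {0 :: (real, 'n) vec}" and ?A = "cone_algebra \<sigma>"
  interpret T: subring_set ?T by (rule subring_cone_algebra)
  interpret A: subring_set ?A by (rule subring_cone_algebra)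
  have AT: "?A \<subseteq> ?T" unfolding cone_algebra_zero by (auto simp: cone_algebra_eq)
  fix S assume "S \<in> Spec ?T"
  then obtain P where P: "prime_in ?T P" "S = localization ?T P"
    using subring_cone_algebra by (rule SpecE)
  have P1: "0 \<in> P" "\<And>a b. a \<in> P \<Longrightarrow> b \<in> P \<Longrightarrow> a + b \<in> P"
      "\<And>a b. a \<in> ?T \<Longrightarrow> b \<in> P \<Longrightarrow> a * b \<in> P" "1 \<notin> P"
      "\<And>a b. a \<in> ?T \<Longrightarrow> b \<in> ?T \<Longrightarrow> a * b \<in> P \<Longrightarrow> a \<in> P \<or> b \<in> P"
    using P(1) by (simp_all add: prime_in_def ideal_in_def)
  have "\<And>a b. a \<in> ?A \<Longrightarrow> b \<in> ?A \<Longrightarrow> a * b \<in> P \<Longrightarrow> a \<in> P \<or> b \<in> P"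
    using P1(5) AT by blast
  then have prime: "prime_in ?A (P \<inter> ?A)"
    using P1(1-4) AT A.zero_mem A.add_mem A.mult_mem unfolding prime_in_def ideal_in_def by auto
  have "localization ?T P = localization ?A (P \<inter> ?A)"
  proof
    show "localization ?A (P \<inter> ?A) \<subseteq> localization ?T P"
      using AT by (auto simp: localization_def)
    show "localization ?T P \<subseteq> localization ?A (P \<inter> ?A)"
    proof
      fix f assume "f \<in> localization ?T P"
      then obtain a b where ab: "f = a / b" "a \<in> ?T" "b \<in> ?T" "b \<notin> P" "b \<noteq> 0"
        using P(1) by (rule localizationE)
      then obtain p q where pq: "a = of_laurent p" "b = of_laurent q" by (auto simp: cone_algebra_zero)
      obtain F where F: "finite F" "\<sigma> = convex_cone hull F" "0 \<notin> F"
        using minimal_generators[OF \<sigma>(1)] by (metis inner_zero_right less_irrefl pairing_eq_inner)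
      obtain u where u: "\<And>v. v \<in> \<sigma> \<Longrightarrow> v \<noteq> 0 \<Longrightarrow> 0 < pairing u v"
        using interior_dual_exists[OF \<sigma>] by blast
      have pos: "0 < pairing u s" if "s \<in> F" for s
        using u[of s] that F(2,3) hull_inc by metis
      have ud: "u \<in> dual_cone \<sigma>"
        unfolding dual_cone_def using u by (force simp: pairing_eq_inner)
      obtain N where N: "\<forall>k\<in>keys p \<union> keys q. k + lattice_multiple N u \<in> dual_cone \<sigma>"
        using shift_into_dual_cone[OF F(1,2) _ ud, of "keys p \<union> keys q"] pos by auto
      let ?x = "monomial (lattice_multiple N u)"
      have shift: "of_laurent r * ?x \<in> ?A" if "keys r \<subseteq> keys p \<union> keys q" for r
      proof -
        have "keys (r * single (lattice_multiple N u) 1) \<subseteq> dual_cone \<sigma>"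
          using keys_mult[of r "single (lattice_multiple N u) 1"] N that by fastforce
        then show ?thesis by (simp add: monomial_def of_laurent_mem_cone_algebra flip: of_laurent_mult)
      qed
      have "b * ?x \<notin> P"
      proof
        assume "b * ?x \<in> P"
        moreover have "monomial (- lattice_multiple N u) \<in> ?T" by (auto simp: cone_algebra_zero monomial_def)
        ultimately have "monomial (- lattice_multiple N u) * (b * ?x) \<in> P"
          using P(1) by (auto simp: prime_in_def ideal_in_def)
        then have "b * (monomial (- lattice_multiple N u) * ?x) \<in> P" by (simp only: mult_ac)
        then show False using ab(4) by simp
      qed
      then have "(a * ?x) / (b * ?x) \<in> localization ?A (P \<inter> ?A)"
        using shift[of p] shift[of q] pq by (intro localizationI) auto
      then show "f \<in> localization ?A (P \<inter> ?A)" by (simp add: ab(1))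
    qed
  qed
  then show "S \<in> Spec ?A" using SpecI[OF subring_cone_algebra prime] P(2) by simp
qed

text \<open>The criterion by which \<open>h\<close> is recognized as a generator: one inclusion is
  the expansion \<open>l = h * (\<Sum>i<n. (a i / h) * (b i * l))\<close>, the other expands
  \<open>h * x\<close> in the \<open>a i\<close> with coefficients
  \<open>h * b i * x\<close>.\<close>

lemma invertible_stalk:
  fixes L :: "'k::field subsheaf"
  assumes S: "subring_set S" and t: "L S = (\<lambda>a. t * a) ` S" and one: "(\<Sum>i<n. a i * b i) = 1"
    and a: "\<And>i. i < n \<Longrightarrow> a i \<in> L S" and b: "\<And>i l. i < n \<Longrightarrow> l \<in> L S \<Longrightarrow> b i * l \<in> S"
    and h: "h \<noteq> 0" "\<And>i. i < (n::nat) \<Longrightarrow> a i / h \<in> S" "\<And>i. i < n \<Longrightarrow> h * b i \<in> S"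
  shows "L S = (\<lambda>a. h * a) ` S"
proof
  interpret subring_set S by fact
  show "L S \<subseteq> (\<lambda>a. h * a) ` S"
  proof
    fix l assume l: "l \<in> L S"
    have "l = (\<Sum>i<n. a i * b i) * l" by (simp add: one)
    also have "\<dots> = h * (\<Sum>i<n. (a i / h) * (b i * l))"
      using h(1) by (simp add: sum_distrib_left sum_distrib_right mult_ac)
    finally have "l = h * (\<Sum>i<n. (a i / h) * (b i * l))" .
    moreover have "(\<Sum>i<n. (a i / h) * (b i * l)) \<in> S"
      by (rule sum_mem, rule mult_mem) (use h b l in auto)
    ultimately show "l \<in> (\<lambda>a. h * a) ` S" by blast
  qed
  show "(\<lambda>a. h * a) ` S \<subseteq> L S"
  proof clarify
    fix x assume x: "x \<in> S"
    have "\<forall>i. \<exists>s. i < n \<longrightarrow> s \<in> S \<and> a i = t * s" using a t by blast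
    then obtain s where s: "\<And>i. i < n \<Longrightarrow> s i \<in> S" "\<And>i. i < n \<Longrightarrow> a i = t * s i" by metis
    have "h * x = (\<Sum>i<n. a i * b i) * (h * x)" by (simp add: one)
    also have "\<dots> = (\<Sum>i<n. a i * (h * b i) * x)"
      by (simp add: sum_distrib_right sum_distrib_left mult_ac)
    also have "\<dots> = (\<Sum>i<n. t * (s i * (h * b i) * x))"
      using s(2) by (intro sum.cong) (auto simp: mult_ac)
    also have "\<dots> = t * (\<Sum>i<n. s i * (h * b i) * x)" by (simp add: sum_distrib_left)
    finally have "h * x = t * (\<Sum>i<n. s i * (h * b i) * x)" .
    moreover have "(\<Sum>i<n. s i * (h * b i) * x) \<in> S"
      using h(3) s(1) x by (intro sum_mem mult_mem[OF mult_mem]) auto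
    ultimately show "h * x \<in> L S" unfolding t by blast
  qed
qed

lemma line_bundle_stalk:
  assumes "line_bundle X L" "S \<in> X"
  obtains t where "t \<noteq> 0" "L S = (\<lambda>a. t * a) ` S"
  using bspec[OF assms(1)[unfolded line_bundle_def] assms(2)] by blast

text \<open>
  On the torus \<open>L\<close> is trivial. After division by a generator there, the local generators of the
  fractional ideal on the chart of \<open>\<sigma>\<close> satisfy order conditions along all \<open>v \<in> \<sigma>\<close>, and the constant
  coefficient of \<open>\<Sum>a\<^sub>i b\<^sub>i = 1\<close> provides a monomial for which all of these are equalities.
\<close>

lemma line_bundle_toric:
  fixes \<Sigma> :: "(real^'n::{finite,linorder}) set set" and L :: "'n ratfun subsheaf"
  assumes fan: "fan \<Sigma>" and X: "X = toric_variety \<Sigma>" and L: "line_bundle X L"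
  obtains g m where "g \<noteq> 0"
    "\<And>\<sigma> S. \<sigma> \<in> \<Sigma> \<Longrightarrow> S \<in> Spec (cone_algebra \<sigma>) \<Longrightarrow> L S = (\<lambda>a. g * monomial (m \<sigma>) * a) ` S"
proof -
  let ?T = "cone_algebra {0 :: (real, 'n) vec}"
  have SpecX: "Spec (cone_algebra \<sigma>) \<subseteq> X" if "\<sigma> \<in> \<Sigma>" for \<sigma>
    using that by (auto simp: X toric_variety_def)
  note subT = SpecX[OF zero_cone_in_fan[OF fan]]
  obtain n :: nat and a b where ab: "(\<Sum>i<n. a i * b i) = 1"
      "\<And>i S. i < n \<Longrightarrow> S \<in> Spec ?T \<Longrightarrow> a i \<in> L S"
      "\<And>i S l. i < n \<Longrightarrow> S \<in> Spec ?T \<Longrightarrow> l \<in> L S \<Longrightarrow> b i * l \<in> S"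
    by (rule line_bundle_affine[OF subring_cone_algebra subT L]) (rule that)
  have "a i * b j \<in> range of_laurent" if ij: "i < n" "j < n" for i j
    unfolding cone_algebra_zero[symmetric]
  proof (rule Inter_Spec[OF subring_cone_algebra])
    fix S assume S: "S \<in> Spec ?T"
    show "a i * b j \<in> S" using ab(3)[OF ij(2) S ab(2)[OF ij(1) S]] by (simp add: mult.commute)
  qed
  note ab_range = this
  obtain g where g: "g \<noteq> 0" "\<And>i. i < n \<Longrightarrow> a i / g \<in> ?T" "\<And>i. i < n \<Longrightarrow> g * b i \<in> ?T"
    unfolding cone_algebra_zero
  proof (rule invertible_ideal_principal[of "{..<n}" a b])
    show "(\<Sum>i<n. a i * b i) = 1" by (rule ab(1))
  qed (use ab_range in auto)
  have torus: "L S = (\<lambda>a. g * a) ` S" if S: "S \<in> Spec ?T" for S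
  proof -
    obtain t where t: "L S = (\<lambda>a. t * a) ` S"
      by (rule line_bundle_stalk[OF L subsetD[OF subT S]]) (rule that)
    show ?thesis
    proof (rule invertible_stalk[where L = L and a = a and b = b and n = n and h = g,
        OF Spec_subring[OF S subring_cone_algebra] t ab(1)])
      fix i assume i: "i < n"
      show "a i \<in> L S" by (rule ab(2)[OF i S])
      show "b i * l \<in> S" if "l \<in> L S" for l using ab(3)[OF i S that] .
      show "a i / g \<in> S" "g * b i \<in> S"
        using g(2)[OF i] g(3)[OF i] Spec_superset[OF S subring_cone_algebra] by blast+
    qed (use g(1) in simp)
  qed
  have "\<exists>m. \<forall>S\<in>Spec (cone_algebra \<sigma>). L S = (\<lambda>a. g * monomial m * a) ` S" if \<sigma>: "\<sigma> \<in> \<Sigma>" for \<sigma>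
  proof -
    let ?A = "cone_algebra \<sigma>"
    have rat: "rational_cone \<sigma>" "strongly_convex \<sigma>" using fan \<sigma> by (auto simp: fan_def)
    obtain n :: nat and a b where ab: "(\<Sum>i<n. a i * b i) = 1"
        "\<And>i S. i < n \<Longrightarrow> S \<in> Spec ?A \<Longrightarrow> a i \<in> L S"
        "\<And>i S l. i < n \<Longrightarrow> S \<in> Spec ?A \<Longrightarrow> l \<in> L S \<Longrightarrow> b i * l \<in> S"
      by (rule line_bundle_affine[OF subring_cone_algebra SpecX[OF \<sigma>] L]) (rule that)
    note TA = Spec_torus_subset[OF rat]
    have "a i / g \<in> range of_laurent \<and> g * b i \<in> range of_laurent" if i: "i < n" for i
      unfolding cone_algebra_zero[symmetric]
    proof (intro conjI Inter_Spec[OF subring_cone_algebra])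
      fix S assume S: "S \<in> Spec ?T"
      interpret S: subring_set S using Spec_subring[OF S subring_cone_algebra] .
      have "a i \<in> (\<lambda>a. g * a) ` S" using ab(2)[OF i] TA S torus[OF S] by blast
      then show "a i / g \<in> S" using g(1) by auto
      have "g * 1 \<in> L S" using torus[OF S] S.one_mem by blast
      then show "g * b i \<in> S" using ab(3)[OF i, of S g] TA S by (auto simp: mult.commute)
    qed
    note ab_range = this
    have "\<forall>i. \<exists>p. i < n \<longrightarrow> a i / g = of_laurent p" using ab_range by blast
    then obtain p where p: "\<And>i. i < n \<Longrightarrow> a i / g = of_laurent (p i)" by metis
    have "\<forall>i. \<exists>q. i < n \<longrightarrow> g * b i = of_laurent q" using ab_range by blast
    then obtain q where q: "\<And>i. i < n \<Longrightarrow> g * b i = of_laurent (q i)" by metis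
    have a: "a i = g * of_laurent (p i)" if "i < n" for i
      using g(1) by (simp flip: p[OF that])
    have b: "b i = of_laurent (q i) / g" if "i < n" for i
      using g(1) by (simp flip: q[OF that])
    \<comment> \<open>The bound is the order of \<open>t / g\<close> along \<open>v\<close>, where
      \<open>t\<close> generates \<open>L\<close> at the centre of \<open>v\<close> on this chart.
      Both \<open>a i / t\<close> and \<open>b i * t\<close> are regular at that point, hence of
      nonnegative order if nonzero.\<close>
    have "\<exists>c. \<forall>i<n. (\<forall>k\<in>keys (p i). c \<le> pairing k v) \<and> (\<forall>k\<in>keys (q i). - c \<le> pairing k v)"
      if v: "v \<in> \<sigma>" for v
    proof -
      note sub = cone_algebra_valuation_ring[OF v]
      define S where "S = localization ?A (positive_order v ?A)"
      have S: "S \<in> Spec ?A" unfolding S_def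
        by (intro SpecI subring_cone_algebra prime_in_positive_order sub)
      interpret S: subring_set S using Spec_subring[OF S subring_cone_algebra] .
      have Sv: "S \<subseteq> valuation_ring v" unfolding S_def
        by (intro localization_positive_order subring_cone_algebra sub)
      obtain t where t: "t \<noteq> 0" "L S = (\<lambda>a. t * a) ` S" by (rule line_bundle_stalk[OF L subsetD[OF SpecX[OF \<sigma>] S]]) (rule that)
      show ?thesis
      proof (intro exI allI impI conjI)
        fix i assume i: "i < n"
        show "\<forall>k\<in>keys (p i). worder v (t / g) \<le> pairing k v"
        proof (cases "p i = 0")
          case False
          obtain s where s: "s \<in> S" "a i = t * s" using ab(2)[OF i S] t(2) by blast
          then have pi: "of_laurent (p i) = t / g * s" using a[OF i] g(1) by (simp add: field_simps)
          moreover have "s \<noteq> 0" using pi False by auto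
          ultimately have "worder v (of_laurent (p i)) = worder v (t / g) + worder v s"
            unfolding pi using t(1) g(1) by (intro worder_mult) auto
          moreover have "0 \<le> worder v s" using Sv s(1) \<open>s \<noteq> 0\<close> by (auto simp: valuation_ring_def)
          ultimately have "worder v (t / g) \<le> lorder v (p i)" using worder_of_laurent[OF False, of v] by simp
          then show ?thesis unfolding lorder_ge_iff[OF False] .
        qed simp
        show "\<forall>k\<in>keys (q i). - worder v (t / g) \<le> pairing k v"
        proof (cases "q i = 0")
          case False
          have "t * 1 \<in> L S" using t(2) S.one_mem by blast
          then have "b i * t \<in> S" using ab(3)[OF i S] by simp
          then have "of_laurent (q i) * (t / g) \<in> valuation_ring v" using b[OF i] Sv by auto
          moreover have nz: "of_laurent (q i) \<noteq> 0" "t / g \<noteq> 0" using False t g by auto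
          ultimately have "0 \<le> worder v (of_laurent (q i) * (t / g))"
            by (auto simp: valuation_ring_def)
          then have "0 \<le> worder v (of_laurent (q i)) + worder v (t / g)"
            unfolding worder_mult[OF nz] .
          then have "- worder v (t / g) \<le> lorder v (q i)" using worder_of_laurent[OF False, of v] by simp
          then show ?thesis unfolding lorder_ge_iff[OF False] .
        qed simp
      qed
    qed
    then obtain c where c: "\<And>v i k. v \<in> \<sigma> \<Longrightarrow> i < n \<Longrightarrow> k \<in> keys (p i) \<Longrightarrow> c v \<le> pairing k v"
        "\<And>v i k. v \<in> \<sigma> \<Longrightarrow> i < n \<Longrightarrow> k \<in> keys (q i) \<Longrightarrow> - c v \<le> pairing k v" by metis
    have "of_laurent (\<Sum>i<n. p i * q i) = (\<Sum>i<n. a i * b i)"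
      unfolding of_laurent_sum of_laurent_mult using a b g(1) by (intro sum.cong) auto
    then have "of_laurent (\<Sum>i<n. p i * q i) = of_laurent 1" using ab(1) by simp
    then have "(\<Sum>i<n. p i * q i) = 1" by (simp only: of_laurent_eq_iff)
    from arg_cong[OF this, of "\<lambda>r. lookup r 0"]
    have "(\<Sum>i<n. lookup (p i * q i) 0) \<noteq> 0" by (simp add: lookup_sum)
    then obtain i where i: "i < n" "lookup (p i * q i) 0 \<noteq> 0"
      by (rule sum.not_neutral_contains_not_neutral) auto
    then have "0 \<in> keys (p i * q i)" by (simp add: in_keys_iff)
    then obtain m l where m: "m \<in> keys (p i)" "l \<in> keys (q i)" "0 = m + l"
      using keys_mult[of "p i" "q i"] by blast
    have l: "l = - m" using m(3) by (simp add: eq_neg_iff_add_eq_0 add.commute)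
    have cm: "pairing m v = c v" if "v \<in> \<sigma>" for v
      using c(1)[OF that i(1) m(1)] c(2)[OF that i(1) m(2)] by (simp add: l pairing_minus)
    have in_A: "a j / (g * monomial m) \<in> ?A" "g * monomial m * b j \<in> ?A" if j: "j < n" for j
    proof -
      have "a j / (g * monomial m) = of_laurent (p j * single (- m) 1)"
        using g(1) by (simp add: a[OF j] of_laurent_mult monomial_minus flip: monomial_def)
      moreover have "keys (p j * single (- m) 1) \<subseteq> dual_cone \<sigma>"
      proof
        fix x assume "x \<in> keys (p j * single (- m) 1)"
        then obtain k where k: "k \<in> keys (p j)" "x = k + - m"
          using keys_mult[of "p j" "single (- m) 1"] by auto
        show "x \<in> dual_cone \<sigma>"
          using c(1)[OF _ j k(1)] cm by (simp add: k(2) dual_cone_def pairing_diff)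
      qed
      ultimately show "a j / (g * monomial m) \<in> ?A" by (simp add: of_laurent_mem_cone_algebra)
      have "g * monomial m * b j = of_laurent (single m 1 * q j)"
        using g(1) by (simp add: b[OF j] of_laurent_mult flip: monomial_def)
      moreover have "keys (single m 1 * q j) \<subseteq> dual_cone \<sigma>"
      proof
        fix x assume "x \<in> keys (single m 1 * q j)"
        then obtain k where k: "k \<in> keys (q j)" "x = m + k"
          using keys_mult[of "single m 1" "q j"] by auto
        show "x \<in> dual_cone \<sigma>"
          unfolding dual_cone_def
        proof clarify
          fix v assume v: "v \<in> \<sigma>"
          show "0 \<le> pairing x v" using c(2)[OF v j k(1)] cm[OF v] by (simp add: k(2) pairing_add)
        qed
      qed
      ultimately show "g * monomial m * b j \<in> ?A" by (simp add: of_laurent_mem_cone_algebra)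
    qed
    have "L S = (\<lambda>a. g * monomial m * a) ` S" if S: "S \<in> Spec ?A" for S
    proof -
      obtain t where t: "L S = (\<lambda>a. t * a) ` S"
        by (rule line_bundle_stalk[OF L subsetD[OF SpecX[OF \<sigma>] S]]) (rule that)
      show ?thesis
      proof (rule invertible_stalk[where L = L and a = a and b = b and n = n and h = "g * monomial m",
        OF Spec_subring[OF S subring_cone_algebra] t ab(1)])
        fix i assume i: "i < n"
        show "a i \<in> L S" by (rule ab(2)[OF i S])
        show "b i * l \<in> S" if "l \<in> L S" for l using ab(3)[OF i S that] .
        show "a i / (g * monomial m) \<in> S" "g * monomial m * b i \<in> S"
          using in_A(1)[OF i] in_A(2)[OF i] Spec_superset[OF S subring_cone_algebra] by blast+
      qed (use g(1) in simp)
    qed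
    then show ?thesis by blast
  qed
  then obtain m where "\<And>\<sigma>. \<sigma> \<in> \<Sigma> \<Longrightarrow> \<forall>S\<in>Spec (cone_algebra \<sigma>). L S = (\<lambda>a. g * monomial (m \<sigma>) * a) ` S"
    by metis
  with g(1) that show thesis by blast
qed

section \<open>Global sections\<close>

lemma submodule_generated_product:
  assumes "subring_set S"
  shows "submodule_generated S {a * b |a b. a \<in> (\<lambda>a. g * a) ` S \<and> b \<in> (\<lambda>a. h * a) ` S} = (\<lambda>a. g * h * a) ` S"
    (is "submodule_generated S ?G = ?R")
proof
  interpret subring_set S by fact
  show "?R \<subseteq> submodule_generated S ?G"
  proof clarify
    fix s assume s: "s \<in> S"
    have "(g * 1) * (h * 1) \<in> ?G" using one_mem by blast
    then have "g * h \<in> ?G" by simp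
    moreover have "g * h * s = (\<Sum>x\<in>{g * h}. (\<lambda>_. s) x * x)" by (simp add: mult_ac)
    ultimately show "g * h * s \<in> submodule_generated S ?G"
      unfolding submodule_generated_def using s
      by (intro CollectI exI[of _ "{g * h}"] exI[of _ "\<lambda>_. s"]) auto
  qed
  show "submodule_generated S ?G \<subseteq> ?R"
  proof
    fix y assume "y \<in> submodule_generated S ?G"
    then obtain T c where T: "y = (\<Sum>x\<in>T. c x * x)" "T \<subseteq> ?G" "c ` T \<subseteq> S"
      by (auto simp: submodule_generated_def)
    have "\<forall>x\<in>T. \<exists>r\<in>S. x = g * h * r"
    proof
      fix x assume "x \<in> T"
      then obtain a b where "x = (g * a) * (h * b)" "a \<in> S" "b \<in> S" using T(2) by blast
      then show "\<exists>r\<in>S. x = g * h * r" by (intro bexI[of _ "a * b"]) (auto simp: mult_ac intro: mult_mem)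
    qed
    then obtain r where r: "\<And>x. x \<in> T \<Longrightarrow> r x \<in> S" "\<And>x. x \<in> T \<Longrightarrow> x = g * h * r x" by metis
    have "y = (\<Sum>x\<in>T. g * h * (c x * r x))"
      unfolding T(1) by (rule sum.cong[OF refl]) (metis r(2) mult.left_commute)
    also have "\<dots> = g * h * (\<Sum>x\<in>T. c x * r x)" by (simp add: sum_distrib_left)
    finally have "y = g * h * (\<Sum>x\<in>T. c x * r x)" .
    moreover have "(\<Sum>x\<in>T. c x * r x) \<in> S" using T(3) r(1) by (intro sum_mem mult_mem) auto
    ultimately show "y \<in> ?R" by blast
  qed
qed

lemma tensor_power_stalk:
  assumes S: "subring_set S" and L: "L S = (\<lambda>a. h * a) ` S"
  shows "tensor_power L k S = (\<lambda>a. h ^ k * a) ` S"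
proof (induction k)
  case (Suc k)
  then show ?case
    using submodule_generated_product[OF S, of "h ^ k" h] by (simp add: tensor_def L mult.commute[of h])
qed simp

lemma of_laurent_scale: "cscale c (of_laurent p) = of_laurent (single 0 c * p)"
  by (simp add: cscale_def const_eq_of_laurent of_laurent_mult)

lemma lookup_scale: "lookup (single 0 c * p) m = c * lookup (p :: 'n::{finite,linorder} laurent) m"
  using lookup_mult_single[of p 0 c m] by (simp add: mult.commute)

lemma independent_monomials:
  fixes h :: "'n::{finite,linorder} ratfun"
  assumes "h \<noteq> 0"
  shows "ratfun.independent ((\<lambda>x. h * monomial x) ` K)"
proof
  assume "ratfun.dependent ((\<lambda>x. h * monomial x) ` K)"
  then obtain T u v where T: "finite T" "T \<subseteq> (\<lambda>x. h * monomial x) ` K" "v \<in> T" "u v \<noteq> 0"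
      "(\<Sum>v\<in>T. cscale (u v) v) = 0"
    unfolding ratfun.dependent_explicit by blast
  obtain J where J: "finite J" "T = (\<lambda>x. h * monomial x) ` J"
    using T(1,2) finite_subset_image by meson
  have inj: "inj_on (\<lambda>x. h * monomial x) J"
  proof (rule inj_onI)
    fix x y assume "h * monomial x = h * monomial y"
    then have "single x (1 :: complex) = single y 1"
      using assms by (simp add: monomial_def)
    then show "x = y" by (metis lookup_single_eq lookup_single_not_eq zero_neq_one)
  qed
  define p where "p = (\<Sum>x\<in>J. single x (u (h * monomial x)))"
  have "0 = (\<Sum>x\<in>J. cscale (u (h * monomial x)) (h * monomial x))"
    using T(5) unfolding J(2) by (simp add: sum.reindex[OF inj])
  also have "\<dots> = h * of_laurent p"
    by (simp add: p_def of_laurent_sum sum_distrib_left cscale_def const_eq_of_laurent monomial_def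
        mult.left_commute mult_single flip: of_laurent_mult)
  finally have "p = 0" using assms by simp
  obtain x where x: "x \<in> J" "v = h * monomial x" using T(3) J(2) by blast
  have "lookup p x = u v"
    using J(1) x by (simp add: p_def lookup_sum lookup_single when_def)
  with \<open>p = 0\<close> T(4) show False by simp
qed

lemma monomial_eq_iff: "monomial x = monomial y \<longleftrightarrow> x = y"
proof
  assume "monomial x = monomial y"
  then have "single x (1 :: complex) = single y 1" by (simp add: monomial_def)
  then show "x = y" by (metis lookup_single_eq lookup_single_not_eq zero_neq_one)
qed simp

lemma divide_monomial_mem_cone_algebra:
  "of_laurent p / monomial m \<in> cone_algebra \<sigma> \<longleftrightarrow> (\<forall>k\<in>keys p. k - m \<in> dual_cone \<sigma>)"
proof -
  have "of_laurent p / monomial m = of_laurent (p * single (- m) 1)"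
    by (simp add: of_laurent_mult monomial_minus flip: monomial_def)
  moreover have "k \<in> keys (p * single (- m) 1) \<longleftrightarrow> k + m \<in> keys p" for k
    by (simp add: in_keys_iff lookup_mult_single)
  then have "keys (p * single (- m) 1) = (\<lambda>k. k - m) ` keys p"
    by (force simp: image_iff)
  ultimately show ?thesis by (simp add: of_laurent_mem_cone_algebra image_subset_iff)
qed

lemma mem_scaled_iff:
  fixes h :: "'k::field"
  assumes "h \<noteq> 0"
  shows "f \<in> (\<lambda>a. h * a) ` R \<longleftrightarrow> f / h \<in> R"
proof -
  have "f = h * a \<longleftrightarrow> a = f / h" for a using assms by (auto simp: field_simps)
  then show ?thesis by (auto simp: image_iff)
qed

section \<open>Sections of a toric line bundle as lattice points\<close>

locale toric_line_bundle =
  fixes \<Sigma> :: "(real, 'n::{finite,linorder}) vec set set" and X :: "'n ratfun set set"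
    and L :: "'n ratfun subsheaf" and g :: "'n ratfun" and m :: "(real, 'n) vec set \<Rightarrow> 'n lattice"
  assumes fan: "fan \<Sigma>" and X: "X = toric_variety \<Sigma>" and L: "line_bundle X L" and g: "g \<noteq> 0"
    and stalk: "\<sigma> \<in> \<Sigma> \<Longrightarrow> R \<in> Spec (cone_algebra \<sigma>) \<Longrightarrow> L R = (\<lambda>a. g * monomial (m \<sigma>) * a) ` R"
begin

lemma cone: "\<sigma> \<in> \<Sigma> \<Longrightarrow> rational_cone \<sigma>" "\<sigma> \<in> \<Sigma> \<Longrightarrow> strongly_convex \<sigma>"
  using fan by (auto simp: fan_def)

lemma in_X_iff: "R \<in> X \<longleftrightarrow> (\<exists>\<sigma>\<in>\<Sigma>. R \<in> Spec (cone_algebra \<sigma>))"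
  by (auto simp: X toric_variety_def)

text \<open>The lattice points of \<open>k P\<close>, with \<open>P\<close> the polytope of the
  divisor that defines \<open>L\<close>. The inequalities run over all vectors of the cones instead
  of ray generators, so that no rays have to be chosen.\<close>

definition degree_points :: "nat \<Rightarrow> 'n lattice set" where
  "degree_points k = {x. \<forall>\<sigma>\<in>\<Sigma>. \<forall>v\<in>\<sigma>. real k * pairing (m \<sigma>) v \<le> pairing x v}"

text \<open>The invariant form with coefficient 1 has a simple pole along every toric divisor;
  strict inequality provides the zero that compensates it.\<close>

definition interior_points :: "nat \<Rightarrow> 'n lattice set" where
  "interior_points k = {x. \<forall>\<sigma>\<in>\<Sigma>. \<forall>v\<in>\<sigma>. v \<noteq> 0 \<longrightarrow> real k * pairing (m \<sigma>) v < pairing x v}"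

lemma tensor_power_stalk_toric:
  assumes "\<sigma> \<in> \<Sigma>" "R \<in> Spec (cone_algebra \<sigma>)"
  shows "tensor_power L k R = (\<lambda>a. g ^ k * monomial (lattice_multiple k (m \<sigma>)) * a) ` R"
  using tensor_power_stalk[of R L "g * monomial (m \<sigma>)" k, OF Spec_subring[OF assms(2) subring_cone_algebra] stalk[OF assms]]
  by (simp add: power_mult_distrib monomial_lattice_multiple)

lemma mem_dual_shift_iff:
  "k - lattice_multiple j (m \<sigma>) \<in> dual_cone \<sigma> \<longleftrightarrow> (\<forall>v\<in>\<sigma>. real j * pairing (m \<sigma>) v \<le> pairing k v)"
  by (auto simp: dual_cone_def pairing_diff pairing_lattice_multiple)

text \<open>On each chart a section is a multiple of the local generator by an element of the
  coordinate ring, by \<open>Inter_Spec\<close>. The chart of the zero cone makes it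
  \<open>g ^ k\<close> times a Laurent polynomial, and the other charts then restrict the exponents
  one by one.\<close>

lemma global_sections_tensor_power:
  "global_sections X (tensor_power L k) =
     (\<lambda>p. g ^ k * of_laurent p) ` {p. keys p \<subseteq> degree_points k}"
proof -
  have iff: "(\<forall>R\<in>Spec (cone_algebra \<sigma>). f \<in> tensor_power L k R) \<longleftrightarrow>
      f / g ^ k / monomial (lattice_multiple k (m \<sigma>)) \<in> cone_algebra \<sigma>" if \<sigma>: "\<sigma> \<in> \<Sigma>" for \<sigma> f
  proof -
    have "f \<in> tensor_power L k R \<longleftrightarrow> f / g ^ k / monomial (lattice_multiple k (m \<sigma>)) \<in> R"
      if "R \<in> Spec (cone_algebra \<sigma>)" for R
    proof -
      let ?h = "g ^ k * monomial (lattice_multiple k (m \<sigma>))"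
      have h: "?h \<noteq> 0" using g by simp
      have "f \<in> (\<lambda>a. ?h * a) ` R \<longleftrightarrow> f / ?h \<in> R" by (rule mem_scaled_iff[OF h])
      then show ?thesis unfolding tensor_power_stalk_toric[OF \<sigma> that] by (simp add: divide_divide_eq_left)
    qed
    then show ?thesis
      using Inter_Spec[OF subring_cone_algebra] Spec_superset[OF _ subring_cone_algebra] by blast
  qed
  have mem: "f \<in> global_sections X (tensor_power L k) \<longleftrightarrow>
      (\<forall>\<sigma>\<in>\<Sigma>. f / g ^ k / monomial (lattice_multiple k (m \<sigma>)) \<in> cone_algebra \<sigma>)" for f
    using iff unfolding global_sections_def X toric_variety_def by blast
  have poly: "g ^ k * of_laurent p \<in> global_sections X (tensor_power L k) \<longleftrightarrow> keys p \<subseteq> degree_points k" for p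
  proof -
    have "g ^ k * of_laurent p / g ^ k = of_laurent p" using g by simp
    then show ?thesis
      unfolding mem divide_monomial_mem_cone_algebra mem_dual_shift_iff degree_points_def
      by (simp only: divide_monomial_mem_cone_algebra mem_dual_shift_iff) blast
  qed
  show ?thesis
  proof
    show "(\<lambda>p. g ^ k * of_laurent p) ` {p. keys p \<subseteq> degree_points k} \<subseteq> global_sections X (tensor_power L k)"
      using poly by blast
    show "global_sections X (tensor_power L k) \<subseteq> (\<lambda>p. g ^ k * of_laurent p) ` {p. keys p \<subseteq> degree_points k}"
    proof
      fix f assume f: "f \<in> global_sections X (tensor_power L k)"
      then have "f / g ^ k / monomial (lattice_multiple k (m {0})) \<in> range of_laurent"
        using mem zero_cone_in_fan[OF fan] cone_algebra_zero by blast
      then obtain p where "f / g ^ k / monomial (lattice_multiple k (m {0})) = of_laurent p" by blast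
      then have "f = g ^ k * of_laurent (single (lattice_multiple k (m {0})) 1 * p)"
        using g by (simp add: of_laurent_mult field_simps flip: monomial_def)
      with f poly show "f \<in> (\<lambda>p. g ^ k * of_laurent p) ` {p. keys p \<subseteq> degree_points k}" by blast
    qed
  qed
qed

lemma global_sections_L:
  "global_sections X L = (\<lambda>p. g * of_laurent p) ` {p. keys p \<subseteq> degree_points 1}"
proof -
  have "L R = tensor_power L 1 R" if "R \<in> X" for R
    using that tensor_power_stalk_toric[of _ R 1] stalk[of _ R] unfolding in_X_iff
    by (auto simp: lattice_multiple_def)
  then have "global_sections X L = global_sections X (tensor_power L 1)"
    by (simp add: global_sections_def)
  then show ?thesis using global_sections_tensor_power[of 1] by simp
qed

lemma dim_global_sections_L: "ratfun.dim (global_sections X L) = card (degree_points 1)"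
proof -
  let ?B = "(\<lambda>x. g * monomial x) ` degree_points 1"
  have "card ?B = card (degree_points 1)"
    using g by (intro card_image inj_onI) (simp add: monomial_eq_iff)
  moreover have "ratfun.span ?B = ratfun.span (global_sections X L)"
  proof (rule ratfun.span_eq[THEN iffD2], intro conjI)
    show "?B \<subseteq> ratfun.span (global_sections X L)"
      unfolding global_sections_L monomial_def
      by (intro order_trans[OF _ ratfun.span_superset] image_subsetI imageI) auto
    show "global_sections X L \<subseteq> ratfun.span ?B"
    proof
      fix f assume "f \<in> global_sections X L"
      then obtain p where p: "f = g * of_laurent p" "keys p \<subseteq> degree_points 1"
        unfolding global_sections_L by blast
      have "f = (\<Sum>x\<in>keys p. cscale (lookup p x) (g * monomial x))"
        unfolding p(1) by (subst laurent_sum_single)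
          (simp add: of_laurent_sum sum_distrib_left cscale_def const_eq_of_laurent monomial_def
            mult.left_commute mult_single flip: of_laurent_mult)
      also have "\<dots> \<in> ratfun.span ?B"
        using p(2) by (intro ratfun.span_sum ratfun.span_scale ratfun.span_base) auto
      finally show "f \<in> ratfun.span ?B" .
    qed
  qed
  ultimately show ?thesis
    using ratfun.dim_eq_card[OF _ independent_monomials[OF g]] by metis
qed

lemma degree_points_add: "x \<in> degree_points k \<Longrightarrow> y \<in> degree_points j \<Longrightarrow> x + y \<in> degree_points (k + j)"
  by (fastforce simp: degree_points_def pairing_add distrib_right intro: add_mono)

text \<open>The sections of every power are spanned by monomials times a power of \<open>g\<close>,
  so it suffices to split each exponent \<open>x\<close> as \<open>(x - p) + p\<close>.\<close>

lemma normally_generatedI: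
  assumes "\<And>k x. 1 \<le> k \<Longrightarrow> x \<in> degree_points (k + 1) \<Longrightarrow> \<exists>p\<in>degree_points 1. x - p \<in> degree_points k"
  shows "normally_generated X L"
  unfolding normally_generated_def
proof (intro allI impI)
  fix k :: nat assume k: "1 \<le> k"
  let ?P = "{s * t |s t. s \<in> global_sections X (tensor_power L k) \<and> t \<in> global_sections X L}"
  let ?\<Gamma> = "global_sections X (tensor_power L (k + 1))"
  show "ratfun.span ?P = ?\<Gamma>"
  proof
    let ?S = "(\<lambda>p. g ^ (k + 1) * of_laurent p) ` {p. keys p \<subseteq> degree_points (k + 1)}"
    have "ratfun.subspace ?\<Gamma>"
      unfolding ratfun.subspace_def global_sections_tensor_power
    proof (intro conjI ballI allI)
      show "0 \<in> ?S"
        by (rule image_eqI[of _ _ 0]) auto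
      fix x y assume x: "x \<in> ?S"
      then obtain p where p: "x = g ^ (k + 1) * of_laurent p" "keys p \<subseteq> degree_points (k + 1)" by blast
      show "cscale c x \<in> ?S" for c
      proof (rule image_eqI)
        show "cscale c x = g ^ (k + 1) * of_laurent (single 0 c * p)"
          unfolding of_laurent_scale[symmetric] by (simp add: p(1) cscale_def mult_ac)
        show "single 0 c * p \<in> {p. keys p \<subseteq> degree_points (k + 1)}"
          using p(2) by (auto simp: in_keys_iff lookup_scale)
      qed
      assume "y \<in> ?S"
      then obtain q where q: "y = g ^ (k + 1) * of_laurent q" "keys q \<subseteq> degree_points (k + 1)" by blast
      show "x + y \<in> ?S"
      proof (rule image_eqI)
        show "x + y = g ^ (k + 1) * of_laurent (p + q)" by (simp add: p q of_laurent_add distrib_left)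
        show "p + q \<in> {p. keys p \<subseteq> degree_points (k + 1)}"
          using p(2) q(2) keys_add[of p q] by blast
      qed
    qed
    moreover have "?P \<subseteq> ?\<Gamma>"
    proof clarify
      fix s t assume "s \<in> global_sections X (tensor_power L k)" "t \<in> global_sections X L"
      then obtain p q where pq: "s = g ^ k * of_laurent p" "t = g * of_laurent q"
          "keys p \<subseteq> degree_points k" "keys q \<subseteq> degree_points 1"
        unfolding global_sections_tensor_power global_sections_L by blast
      have "s * t = g ^ (k + 1) * of_laurent (p * q)" by (simp add: pq of_laurent_mult mult_ac)
      moreover have "keys (p * q) \<subseteq> degree_points (k + 1)"
        using keys_mult[of p q] pq(3,4) degree_points_add[of _ k _ 1] by blast
      ultimately show "s * t \<in> ?\<Gamma>" unfolding global_sections_tensor_power by blast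
    qed
    ultimately show "ratfun.span ?P \<subseteq> ?\<Gamma>" by (rule ratfun.span_minimal[rotated])
    show "?\<Gamma> \<subseteq> ratfun.span ?P"
    proof
      fix f assume "f \<in> ?\<Gamma>"
      then obtain p where p: "f = g ^ (k + 1) * of_laurent p" "keys p \<subseteq> degree_points (k + 1)"
        unfolding global_sections_tensor_power by blast
      have "f = (\<Sum>x\<in>keys p. cscale (lookup p x) (g ^ (k + 1) * monomial x))"
        unfolding p(1) by (subst laurent_sum_single)
          (simp add: of_laurent_sum sum_distrib_left cscale_def const_eq_of_laurent monomial_def
            mult.left_commute mult_single flip: of_laurent_mult)
      also have "\<dots> \<in> ratfun.span ?P"
      proof (intro ratfun.span_sum ratfun.span_scale ratfun.span_base)
        fix x assume "x \<in> keys p"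
        then obtain y where y: "y \<in> degree_points 1" "x - y \<in> degree_points k"
          using assms[OF k, of x] p(2) by blast
        have "g ^ (k + 1) * monomial x = (g ^ k * monomial (x - y)) * (g * monomial y)"
          by (simp add: mult_ac flip: monomial_add)
        moreover have "g ^ k * monomial (x - y) \<in> global_sections X (tensor_power L k)"
          unfolding global_sections_tensor_power monomial_def using y by (intro imageI) simp
        moreover have "g * monomial y \<in> global_sections X L"
          unfolding global_sections_L monomial_def using y by (intro imageI) simp
        ultimately show "g ^ (k + 1) * monomial x \<in> ?P" by blast
      qed
      finally show "f \<in> ratfun.span ?P" .
    qed
  qed
qed

text \<open>The section of \<open>x\<close> is, on each chart, the generator of the power of
  \<open>L\<close> times the monomial of \<open>x - lattice_multiple k (m \<sigma>)\<close>. Two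
  different points would give two independent sections. The assumption \<open>dual\<close> isolates
  the local computation with differential forms, done in
  \<open>interior_monomial_dualizing\<close>.\<close>

lemma interior_points_unique:
  assumes dim: "ratfun.dim (global_sections X (tensor (tensor_power L k) (dualizing_sheaf X))) = 1"
    and dual: "\<And>\<sigma> R x. \<sigma> \<in> \<Sigma> \<Longrightarrow> R \<in> Spec (cone_algebra \<sigma>) \<Longrightarrow> x \<in> interior_points k \<Longrightarrow>
      monomial (x - lattice_multiple k (m \<sigma>)) \<in> dualizing_sheaf X R"
    and x: "x \<in> interior_points k" and y: "y \<in> interior_points k"
  shows "x = y"
proof -
  let ?\<Gamma> = "global_sections X (tensor (tensor_power L k) (dualizing_sheaf X))"
  have mem: "g ^ k * monomial x \<in> ?\<Gamma>" if x: "x \<in> interior_points k" for x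
    unfolding global_sections_def
  proof clarify
    fix R assume "R \<in> X"
    then obtain \<sigma> where \<sigma>: "\<sigma> \<in> \<Sigma>" "R \<in> Spec (cone_algebra \<sigma>)" by (auto simp: in_X_iff)
    interpret R: subring_set R using Spec_subring[OF \<sigma>(2) subring_cone_algebra] .
    let ?l = "lattice_multiple k (m \<sigma>)"
    let ?G = "{a * b |a b. a \<in> tensor_power L k R \<and> b \<in> dualizing_sheaf X R}"
    have "g ^ k * monomial ?l * 1 \<in> tensor_power L k R"
      unfolding tensor_power_stalk_toric[OF \<sigma>] using R.one_mem by blast
    then have "(g ^ k * monomial ?l) * monomial (x - ?l) \<in> ?G" using dual[OF \<sigma> x] by auto
    then have "g ^ k * monomial x \<in> ?G" by (simp add: mult.assoc flip: monomial_add)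
    then show "g ^ k * monomial x \<in> tensor (tensor_power L k) (dualizing_sheaf X) R"
      unfolding tensor_def submodule_generated_def using R.one_mem
      by (intro CollectI exI[of _ "{g ^ k * monomial x}"] exI[of _ "\<lambda>_. 1"]) auto
  qed
  obtain B where B: "ratfun.independent B" "ratfun.span B = ratfun.span ?\<Gamma>" "card B = 1"
    using dim ratfun.basis_exists[of ?\<Gamma>] by (metis ratfun.span_span ratfun.span_mono ratfun.span_superset subset_antisym ratfun.span_minimal ratfun.subspace_span)
  let ?A = "(\<lambda>x. g ^ k * monomial x) ` {x, y}"
  have "?A \<subseteq> ratfun.span B"
    using mem x y B(2) ratfun.span_base by auto
  \<comment> \<open>An infinite basis would have \<open>card B = 0\<close>.\<close>
  moreover have "finite B" using B(3) card.infinite by fastforce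
  moreover have "ratfun.independent ?A" using g by (intro independent_monomials) simp
  ultimately have "card ?A \<le> card B" using ratfun.independent_span_bound by blast
  then have "card ?A \<le> Suc 0" using B(3) by simp
  then have "g ^ k * monomial x = g ^ k * monomial y"
    unfolding card_le_Suc0_iff_eq[OF finite_imageI[OF finite.insertI[OF finite.insertI[OF finite.emptyI]]]] by blast
  then show ?thesis using g by (simp add: monomial_eq_iff)
qed

end

section \<open>Regular forms\<close>

lemma const_zero: "const 0 = 0"
  by (simp add: const_eq_of_laurent)

lemma const_uminus: "const (- c) = - const c"
  using const_add[of c "- c"] by (simp add: const_zero eq_neg_iff_add_eq_0 add.commute)

lemma const_of_nat: "const (of_nat n) = of_nat n"
  by (induction n) (simp_all add: const_zero const_add const_one)

lemma const_of_int: "const (of_int k) = of_int k"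
  by (cases k) (simp_all add: const_of_nat const_uminus const_add const_one del: of_nat_Suc)

lemma const_mem_cone_algebra: "const c \<in> cone_algebra \<sigma>"
  by (auto simp: const_eq_of_laurent of_laurent_mem_cone_algebra dual_cone_zero)

lemma log_deriv_monomial: "log_deriv i (monomial w) = of_int (lookup w i) * monomial w"
proof -
  have "laurent_deriv i (1 :: 'a laurent) = 0"
    using laurent_deriv_single[of i 0 1] by simp
  then have "log_deriv i (monomial w) = of_laurent (laurent_deriv i (single w 1))"
    by (simp add: monomial_def of_laurent_def log_deriv_Fract)
  also have "\<dots> = const (of_int (lookup w i)) * monomial w"
    by (simp add: laurent_deriv_single const_eq_of_laurent monomial_def mult_single del: single_of_int flip: of_laurent_mult)
  finally show ?thesis by (simp add: const_of_int)
qed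

lemma monomial_sum: "monomial (sum f A) = (\<Prod>x\<in>A. monomial (f x))"
  by (induction A rule: infinite_finite_induct) (simp_all add: monomial_add)

text \<open>The coefficient of the wedge product of the differentials of \<open>n\<close> monomials:
  each logarithmic derivative multiplies a monomial by an exponent, so the monomials come out of the
  determinant.\<close>

lemma det_log_deriv_monomials:
  fixes w :: "'n::{finite,linorder} \<Rightarrow> 'n lattice"
  shows "det (\<chi> i j. log_deriv i (monomial (w j))) =
    of_int (det (\<chi> i j. lookup (w j) i)) * monomial (\<Sum>j\<in>UNIV. w j)"
proof -
  have "(\<Prod>i\<in>UNIV. monomial (w (p i))) = monomial (\<Sum>j\<in>UNIV. w j)" if "p permutes UNIV" for p
    unfolding monomial_sum using prod.permute[OF that, of "\<lambda>j. monomial (w j)"] by (simp add: comp_def)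
  then show ?thesis
    by (auto simp: det_def log_deriv_monomial prod.distrib sum_distrib_right mult.assoc intro!: sum.cong)
qed

lemma det_nonzero_iff:
  fixes w :: "'n::{finite,linorder} \<Rightarrow> 'n lattice"
  assumes "\<And>z. (\<And>j. pairing (w j) z = 0) \<Longrightarrow> z = 0"
  shows "det (\<chi> i j. lookup (w j) i) \<noteq> 0"
proof -
  define A :: "((real, 'n) vec, 'n) vec" where "A = (\<chi> j. lattice_vec (w j))"
  have "A *v z = (\<chi> j. pairing (w j) z)" for z
    by (simp add: A_def matrix_vector_mult_def pairing_def lattice_vec_def)
  then have "z = 0" if "A *v z = 0" for z
    using that assms by (simp add: vec_eq_iff)
  then have "invertible A"
    unfolding invertible_left_inverse matrix_left_invertible_ker by blast
  then have "det (transpose A) \<noteq> 0" by (simp add: invertible_det_nz det_transpose)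
  moreover have "det (transpose A) = of_int (det (\<chi> i j. lookup (w j) i))"
    by (simp add: det_def A_def transpose_def lattice_vec_def)
  ultimately show ?thesis by simp
qed

text \<open>By \<open>det_log_deriv_monomials\<close>, the form is the wedge product of the
  differentials of the monomials of \<open>w\<close>, times a monomial in \<open>S\<close> and the
  inverse of a nonzero integer determinant, which lies in \<open>S\<close> because the constants
  do.\<close>

lemma monomial_regular_form:
  fixes w :: "'n::{finite,linorder} \<Rightarrow> 'n lattice"
  assumes S: "subring_set S" "range const \<subseteq> S" and w: "\<And>j. monomial (w j) \<in> S"
    and y: "monomial (y - (\<Sum>j\<in>UNIV. w j)) \<in> S"
    and indep: "\<And>z. (\<And>j. pairing (w j) z = 0) \<Longrightarrow> z = 0"
  shows "monomial y \<in> regular_forms S"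
proof -
  interpret subring_set S by fact
  define d where "d = det (\<chi> i j. lookup (w j) i)"
  have d: "d \<noteq> 0" unfolding d_def using indep by (rule det_nonzero_iff)
  define D where "D = det (\<chi> i j. log_deriv i (monomial (w j)))"
  have D: "D = const (of_int d) * monomial (\<Sum>j\<in>UNIV. w j)"
    by (simp add: D_def d_def det_log_deriv_monomials const_of_int)
  have inv: "const (1 / of_int d) * const (of_int d) = 1"
    using d by (simp add: const_one flip: const_mult)
  define c where "c = const (1 / of_int d) * monomial (y - (\<Sum>j\<in>UNIV. w j))"
  have "c * D = (const (1 / of_int d) * const (of_int d)) * (monomial (y - (\<Sum>j\<in>UNIV. w j)) * monomial (\<Sum>j\<in>UNIV. w j))"
    unfolding c_def D by (simp only: mult_ac)
  also have "\<dots> = monomial y" unfolding inv by (simp flip: monomial_add)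
  finally have "monomial y = (\<Sum>x\<in>{D}. (\<lambda>_. c) x * x)" by simp
  moreover have "c \<in> S" unfolding c_def using S(2) y by (intro mult_mem) auto
  moreover have "D \<in> {det (\<chi> i j. log_deriv i (g j)) |g. range g \<subseteq> S}"
    unfolding D_def using w by (intro CollectI exI[of _ "\<lambda>j. monomial (w j)"]) auto
  ultimately show ?thesis
    unfolding regular_forms_def submodule_generated_def
    by (intro CollectI exI[of _ "{D}"] exI[of _ "\<lambda>_. c"]) auto
qed

lemma monomial_regular_form_torus:
  fixes y :: "'n::{finite,linorder} lattice"
  assumes S: "subring_set S" "range const \<subseteq> S" and all: "\<And>m. monomial m \<in> S"
  shows "monomial y \<in> regular_forms S"
proof (rule monomial_regular_form[OF S all all, of "\<lambda>j. single j 1"])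
  fix z :: "(real, 'n) vec" assume z: "\<And>j. pairing (single j 1) z = 0"
  have "pairing (single j 1) z = z $ j" for j
    by (simp add: pairing_def lookup_single when_def if_distrib[of real_of_int] if_distrib[of "\<lambda>c. c * _"] cong: if_cong)
  then show "z = 0" using z by (simp add: vec_eq_iff)
qed

text \<open>
  The form is obtained from \<open>x\<^sup>y\<close> itself together with independent characters orthogonal to \<open>v\<close>.
\<close>

lemma monomial_regular_form_divisor:
  fixes y :: "'n::{finite,linorder} lattice"
  assumes S: "subring_set S" "range const \<subseteq> S" and half: "\<And>m. 0 \<le> pairing m v \<Longrightarrow> monomial m \<in> S"
    and v: "v \<noteq> 0" "\<And>i. v $ i \<in> \<int>" and y: "0 < pairing y v"
  shows "monomial y \<in> regular_forms S"
proof -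
  obtain i0 where i0: "v $ i0 \<noteq> 0" using v(1) by (auto simp: vec_eq_iff)
  have "\<forall>i. \<exists>k. v $ i = of_int k" using v(2) Ints_cases by metis
  then obtain V where V: "\<And>i. v $ i = of_int (V i)" by metis
  define w where "w = (\<lambda>j. if j = i0 then y else
    single j (V i0) - single i0 (V j))"
  have single: "pairing (single j c) z = of_int c * z $ j" for j c and z :: "(real, 'n) vec"
    by (simp add: pairing_def lookup_single when_def if_distrib[of real_of_int] if_distrib[of "\<lambda>c. c * _"] cong: if_cong)
  have w: "pairing (w j) z = v $ i0 * z $ j - v $ j * z $ i0" if "j \<noteq> i0" for j z
    using that by (simp add: w_def pairing_diff single V)
  have wv: "pairing (w j) v = 0" if "j \<noteq> i0" for j using w[OF that, of v] by simp
  show ?thesis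
  proof (rule monomial_regular_form[OF S, of w])
    show "monomial (w j) \<in> S" for j
      using y wv[of j] by (intro half) (cases "j = i0", auto simp: w_def)
    \<comment> \<open>Only \<open>w i0 = y\<close> contributes along \<open>v\<close>. The
      complementary exponent is therefore orthogonal to \<open>v\<close>, and its monomial lies in
      \<open>S\<close> as well.\<close>
    have "pairing (\<Sum>j\<in>UNIV. w j) v = pairing (w i0) v"
      unfolding pairing_sum using wv by (subst sum.remove[of UNIV i0]) auto
    then show "monomial (y - (\<Sum>j\<in>UNIV. w j)) \<in> S"
      by (intro half) (simp add: pairing_diff w_def)
    fix z assume z: "\<And>j. pairing (w j) z = 0"
    \<comment> \<open>Vanishing of the characters orthogonal to \<open>v\<close> makes
      \<open>z\<close> a multiple of \<open>v\<close>; as \<open>y\<close> is positive on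
      \<open>v\<close>, the factor is 0.\<close>
    have zj: "z $ j = (z $ i0 / v $ i0) * v $ j" for j
      using z[of j] w[of j z] i0 by (cases "j = i0") (auto simp: field_simps)
    have zv: "z = (z $ i0 / v $ i0) *\<^sub>R v"
      unfolding vec_eq_iff
    proof
      fix i show "z $ i = ((z $ i0 / v $ i0) *\<^sub>R v) $ i"
        using zj[of i] by (simp only: vector_scaleR_component real_scaleR_def)
    qed
    have "pairing y ((z $ i0 / v $ i0) *\<^sub>R v) = (z $ i0 / v $ i0) * pairing y v"
      by (simp only: pairing_eq_inner inner_scaleR_right)
    then have "pairing y z = (z $ i0 / v $ i0) * pairing y v" using zv by metis
    moreover have "pairing y z = 0" using z[of i0] by (simp add: w_def)
    ultimately have "z $ i0 / v $ i0 = 0" using y by simp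
    then show "z = 0" using zv by (metis scaleR_zero_left)
  qed
qed

lemma maximal_ideal_localization:
  assumes A: "subring_set A" "prime_in A P" and M: "maximalideal M (ring_of (localization A P))"
  shows "M = {a / b |a b. a \<in> P \<and> b \<in> A - P}"
proof -
  let ?S = "localization A P" and ?N = "{a / b |a b. a \<in> P \<and> b \<in> A - P}"
  interpret A: subring_set A by fact
  interpret S: subring_set ?S by (rule subring_localization[OF A])
  interpret M: maximalideal M "ring_of ?S" by fact
  have P: "P \<subseteq> A" "0 \<in> P" "\<And>a b. a \<in> P \<Longrightarrow> b \<in> P \<Longrightarrow> a + b \<in> P" "\<And>a b. a \<in> A \<Longrightarrow> b \<in> P \<Longrightarrow> a * b \<in> P"
      "1 \<notin> P" "\<And>a b. a \<in> A \<Longrightarrow> b \<in> A \<Longrightarrow> a * b \<in> P \<Longrightarrow> a \<in> P \<or> b \<in> P"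
    using A(2) by (auto simp: prime_in_def ideal_in_def)
  have Mi: "ideal_in ?S M" using M.is_ideal ideal_ring_of_iff[OF S.subring_set_axioms] by simp
  have "1 \<notin> M" using M.I_notcarr M.one_imp_carrier by auto
  have sub: "M \<subseteq> ?N"
  proof
    fix f assume f: "f \<in> M"
    then have "f \<in> ?S" using Mi by (auto simp: ideal_in_def)
    then obtain a b where ab: "f = a / b" "a \<in> A" "b \<in> A" "b \<notin> P" "b \<noteq> 0"
      using A(2) by (rule localizationE)
    have "a \<in> P"
    proof (rule ccontr)
      assume a: "a \<notin> P"
      then have "b / a \<in> ?S" using ab by (intro localizationI)
      then have "b / a * f \<in> M" using Mi f by (auto simp: ideal_in_def)
      moreover have "a \<noteq> 0" using a P(2) by auto
      ultimately show False using \<open>1 \<notin> M\<close> ab by simp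
    qed
    then show "f \<in> ?N" using ab by blast
  qed
  have N: "ideal_in ?S ?N"
    unfolding ideal_in_def
  proof (intro conjI ballI)
    show "?N \<subseteq> ?S" using P(1) by (auto simp: localization_def)
    have "0 / 1 \<in> ?N" using P(2,5) A.one_mem by blast
    then show "0 \<in> ?N" by simp
    fix f g assume g: "g \<in> ?N"
    then obtain c d where cd: "g = c / d" "c \<in> P" "d \<in> A" "d \<notin> P" by blast
    then have d0: "d \<noteq> 0" using P(2) by auto
    show "f + g \<in> ?N" if f: "f \<in> ?N"
    proof -
      obtain a b where ab: "f = a / b" "a \<in> P" "b \<in> A" "b \<notin> P" using f by blast
      then have b0: "b \<noteq> 0" using P(2) by auto
      have "f + g = (d * a + b * c) / (b * d)" using ab(1) cd(1) b0 d0 by (simp add: field_simps)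
      moreover have "d * a + b * c \<in> P" using ab cd by (intro P(3,4)) auto
      moreover have "b * d \<in> A - P" using ab cd P(6)[of b d] by (auto intro: A.mult_mem)
      ultimately show ?thesis by blast
    qed
    show "f * g \<in> ?N" if f: "f \<in> ?S"
    proof -
      obtain a b where ab: "f = a / b" "a \<in> A" "b \<in> A" "b \<notin> P" "b \<noteq> 0"
        using f A(2) by (rule localizationE)
      have "f * g = (a * c) / (b * d)" using ab(1) cd(1) by simp
      moreover have "a * c \<in> P" using ab cd by (intro P(4)) auto
      moreover have "b * d \<in> A - P" using ab cd P(6)[of b d] by (auto intro: A.mult_mem)
      ultimately show ?thesis by blast
    qed
  qed
  have "1 \<notin> ?N"
  proof
    assume "1 \<in> ?N"
    then obtain a b where "1 = a / b" "a \<in> P" "b \<in> A" "b \<notin> P" by blast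
    moreover from this have "b \<noteq> 0" using P(2) by auto
    ultimately show False by simp
  qed
  then have "?N \<noteq> ?S" using S.one_mem by blast
  moreover have "ideal ?N (ring_of ?S)" using N ideal_ring_of_iff[OF S.subring_set_axioms] by blast
  moreover have "?N \<subseteq> carrier (ring_of ?S)" using N by (simp add: ideal_in_def)
  ultimately have "?N = M" using M.I_maximal[of ?N] sub by simp
  then show ?thesis by simp
qed

text \<open>
  A prime of height one containing a monomial contains the ideal of positive order along some
  generator \<open>v\<close> of the cone: otherwise it would omit a product of functions of positive order along
  each of the generators, and the monomial divides a power of that product.
\<close>

lemma codim_one_cases:
  fixes \<tau> :: "(real^'n::{finite,linorder}) set"
  assumes \<tau>: "rational_cone \<tau>" "strongly_convex \<tau>"
    and S: "S \<in> Spec (cone_algebra \<tau>)" "codim_one S"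
  shows "(\<forall>x. monomial x \<in> S) \<or>
    (\<exists>v\<in>\<tau>. v \<noteq> 0 \<and> (\<forall>i. v $ i \<in> \<int>) \<and> S \<subseteq> valuation_ring v \<and> (\<forall>x. 0 \<le> pairing x v \<longrightarrow> monomial x \<in> S))"
proof -
  let ?A = "cone_algebra \<tau>"
  interpret A: subring_set ?A by (rule subring_cone_algebra)
  obtain P where P: "prime_in ?A P" "S = localization ?A P"
    using S(1) subring_cone_algebra by (rule SpecE)
  obtain F where F: "finite F" "\<tau> = convex_cone hull F" "\<And>v i. v \<in> F \<Longrightarrow> v $ i \<in> \<int>"
      "\<And>v. v \<in> F \<Longrightarrow> \<exists>x. pairing x v < 0 \<and> (\<forall>w\<in>F - {v}. 0 \<le> pairing x w)"
    using minimal_generators[OF \<tau>(1)] by metis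
  have F0: "v \<noteq> 0" if "v \<in> F" for v using F(4)[OF that] by (auto simp: pairing_eq_inner)
  have F\<tau>: "v \<in> \<tau>" if "v \<in> F" for v using hull_inc[OF that, of convex_cone] F(2) by simp
  obtain u where u: "\<And>v. v \<in> \<tau> \<Longrightarrow> v \<noteq> 0 \<Longrightarrow> 0 < pairing u v"
    using interior_dual_exists[OF \<tau>] by blast
  have uF: "0 < pairing u s" if "s \<in> F" for s using u[OF F\<tau>[OF that] F0[OF that]] .
  have dualI: "x \<in> dual_cone \<tau>" if "\<And>s. s \<in> F \<Longrightarrow> 0 \<le> pairing x s" for x
    using pairing_nonneg_hull[of F x] that unfolding dual_cone_def F(2) by blast
  have shift: "monomial x \<in> S" if e: "e \<in> dual_cone \<tau>" "monomial e \<notin> P"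
    and x: "\<And>s. s \<in> F \<Longrightarrow> 0 \<le> pairing x s \<or> 0 < pairing e s" for x e
  proof -
    obtain N where N: "x + lattice_multiple N e \<in> dual_cone \<tau>"
      using shift_into_dual_cone[OF F(1,2) _ e(1), of "{x}"] x by auto
    have "monomial (lattice_multiple N e) \<in> ?A" "monomial (lattice_multiple N e) \<notin> P"
      using e prime_in_power[OF P(1) subring_cone_algebra]
      by (auto simp: monomial_lattice_multiple monomial_mem_cone_algebra intro: A.power_mem)
    then have "monomial (x + lattice_multiple N e) / monomial (lattice_multiple N e) \<in> S"
      unfolding P(2) using N by (intro localizationI) (simp_all add: monomial_mem_cone_algebra)
    then show ?thesis by (simp add: monomial_add)
  qed
  show ?thesis
  proof (cases "\<exists>x\<in>dual_cone \<tau>. monomial x \<in> P")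
    case False
    \<comment> \<open>All monomials of the chart are units at this point, so it lies in the
      torus.\<close>
    have "u \<in> dual_cone \<tau>" using uF by (intro dualI) (auto intro: less_imp_le)
    then have "monomial x \<in> S" for x using False uF by (intro shift[of u]) auto
    then show ?thesis by blast
  next
    case True
    then obtain x0 where x0: "x0 \<in> dual_cone \<tau>" "monomial x0 \<in> P" by blast
    have ge: "0 \<le> worder v f" if "v \<in> F" "f \<in> ?A" "f \<noteq> 0" for v f
      using cone_algebra_valuation_ring[OF F\<tau>[OF that(1)]] that by (auto simp: valuation_ring_def)
    have "\<exists>v\<in>F. positive_order v ?A \<subseteq> P"
    proof (rule ccontr)
      assume neg: "\<not> ?thesis"
      have "0 \<in> P" using P(1) by (simp add: prime_in_def ideal_in_def)
      then have "\<forall>v\<in>F. \<exists>f. f \<in> ?A \<and> f \<noteq> 0 \<and> 0 < worder v f \<and> f \<notin> P" using neg by blast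
      then obtain f where f: "\<And>v. v \<in> F \<Longrightarrow> f v \<in> ?A" "\<And>v. v \<in> F \<Longrightarrow> f v \<noteq> 0"
          "\<And>v. v \<in> F \<Longrightarrow> 0 < worder v (f v)" "\<And>v. v \<in> F \<Longrightarrow> f v \<notin> P" by metis
      have prod: "prod f G \<in> ?A \<and> prod f G \<noteq> 0 \<and> prod f G \<notin> P" if "G \<subseteq> F" for G
        using finite_subset[OF that F(1)] that
      proof (induction G rule: finite_induct)
        case empty
        then show ?case using P(1) A.one_mem by (simp add: prime_in_def)
      next
        case (insert v G)
        then have IH: "prod f G \<in> ?A" "prod f G \<noteq> 0" "prod f G \<notin> P" and vF: "v \<in> F" by auto
        have "f v * prod f G \<notin> P"
          using P(1) f(1)[OF vF] f(4)[OF vF] IH unfolding prime_in_def by blast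
        then show ?case using f(1,2)[OF vF] IH insert.hyps by (auto intro: A.mult_mem)
      qed
      define h where "h = prod f F"
      have h: "h \<in> ?A" "h \<noteq> 0" "h \<notin> P" using prod[of F] by (auto simp: h_def)
      have pos: "0 < worder v h" if v: "v \<in> F" for v
      proof -
        have "h = f v * prod f (F - {v})" using F(1) v by (simp add: h_def prod.remove)
        moreover have "prod f (F - {v}) \<noteq> 0" "0 \<le> worder v (prod f (F - {v}))"
          using prod[of "F - {v}"] ge[OF v] by auto
        ultimately show ?thesis using f(2,3)[OF v] by (simp add: worder_mult add_pos_nonneg)
      qed
      obtain p where p: "h = of_laurent p" using h(1) by (auto simp: cone_algebra_eq)
      obtain N where N: "(\<Sum>v\<in>F. \<bar>pairing x0 v\<bar> / worder v h) \<le> real N" using real_arch_simple by blast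
      have hN: "h ^ N = of_laurent (p ^ N)" by (induction N) (simp_all add: p of_laurent_mult)
      have p0: "p ^ N \<noteq> 0" using h(2) p by auto
      have "of_laurent (p ^ N) / monomial x0 \<in> ?A"
        unfolding divide_monomial_mem_cone_algebra
      proof
        fix k assume k: "k \<in> keys (p ^ N)"
        show "k - x0 \<in> dual_cone \<tau>"
        proof (rule dualI)
          fix v assume v: "v \<in> F"
          have "\<bar>pairing x0 v\<bar> / worder v h \<le> (\<Sum>v\<in>F. \<bar>pairing x0 v\<bar> / worder v h)"
            using F(1) v pos by (intro member_le_sum) (auto intro!: divide_nonneg_pos)
          with N have "\<bar>pairing x0 v\<bar> / worder v h \<le> real N" by linarith
          then have "pairing x0 v \<le> real N * worder v h" using pos[OF v] by (simp add: field_simps)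
          also have "\<dots> = lorder v (p ^ N)"
            using worder_power[OF h(2), of v N] worder_of_laurent[OF p0, of v] hN by simp
          also have "\<dots> \<le> pairing k v" by (rule lorder_le[OF k])
          finally show "0 \<le> pairing (k - x0) v" by (simp add: pairing_diff)
        qed
      qed
      then have "h ^ N / monomial x0 * monomial x0 \<in> P"
        using x0(2) P(1) hN by (simp only: prime_in_def ideal_in_def)
      then have "h ^ N \<in> P" by simp
      then show False using prime_in_power[OF P(1) subring_cone_algebra h(1)] h(3) by blast
    qed
    then obtain v where v: "v \<in> F" "positive_order v ?A \<subseteq> P" by blast
    have Sv: "S \<subseteq> valuation_ring v"
    proof
      fix f assume "f \<in> S"
      then obtain a b where ab: "f = a / b" "a \<in> ?A" "b \<in> ?A" "b \<notin> P" "b \<noteq> 0"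
        unfolding P(2) using P(1) by (rule localizationE)
      have "worder v b = 0" using ge[OF v(1) ab(3,5)] v(2) ab by force
      then show "f \<in> valuation_ring v"
        using ge[OF v(1) ab(2)] ab by (cases "a = 0") (auto simp: valuation_ring_def worder_div)
    qed
    interpret S: subring_set S using Spec_subring[OF S(1) subring_cone_algebra] .
    \<comment> \<open>A nonzero prime below the maximal ideal \<open>M\<close> of height one must be
      \<open>M\<close>. Hence every nonzero element of \<open>P\<close> has positive order along
      \<open>v\<close>, and monomials of the chart of order 0 are units in \<open>S\<close>.\<close>
    let ?Q = "positive_order v S"
    have Q: "prime_in S ?Q" using prime_in_positive_order[OF S.subring_set_axioms Sv] .
    obtain M where M: "maximalideal M (ring_of S)"
        "\<And>Q. primeideal Q (ring_of S) \<Longrightarrow> Q \<subset> M \<Longrightarrow> Q = {0}"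
      using S(2) by (auto simp: codim_one_def)
    have M_eq: "M = {a / b |a b. a \<in> P \<and> b \<in> ?A - P}"
      using maximal_ideal_localization[OF subring_cone_algebra P(1)] M(1) P(2) by simp
    have "?Q \<subseteq> M"
    proof
      fix f assume f: "f \<in> ?Q"
      then have "f \<in> localization ?A P" using P(2) by simp
      then obtain a b where ab: "f = a / b" "a \<in> ?A" "b \<in> ?A" "b \<notin> P" "b \<noteq> 0"
        using P(1) by (rule localizationE)
      have "a = 0 \<or> 0 < worder v a"
      proof (cases "a = 0")
        case False
        then have "0 < worder v a - worder v b" using f ab by (auto simp: worder_div)
        then show ?thesis using ge[OF v(1) ab(3,5)] by linarith
      qed simp
      then have "a \<in> P" using v(2) ab by blast
      then show "f \<in> M" unfolding M_eq using ab by blast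
    qed
    moreover have "?Q \<noteq> {0}"
    proof -
      have "u \<in> dual_cone \<tau>" using uF by (intro dualI) (auto intro: less_imp_le)
      then have "monomial u \<in> S" using Spec_superset[OF S(1) subring_cone_algebra] monomial_mem_cone_algebra by blast
      then have "monomial u \<in> ?Q" using uF[OF v(1)] by (simp add: worder_monomial)
      then show ?thesis using monomial_nonzero[of u] by blast
    qed
    moreover have "primeideal ?Q (ring_of S)"
      using Q primeideal_ring_of_iff[OF S.subring_set_axioms] by simp
    ultimately have "M \<subseteq> ?Q" using M(2)[of ?Q] by blast
    have P_pos: "f = 0 \<or> 0 < worder v f" if f: "f \<in> P" for f
    proof -
      have "f / 1 \<in> M" unfolding M_eq using f P(1) A.one_mem by (force simp: prime_in_def)
      then show ?thesis using \<open>M \<subseteq> ?Q\<close> by auto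
    qed
    obtain w where w: "pairing w v < 0" "\<And>s. s \<in> F - {v} \<Longrightarrow> 0 \<le> pairing w s" using F(4)[OF v(1)] by blast
    obtain i j where ij: "pairing w v = of_int i" "pairing u v = of_int j"
      using pairing_integral[of v] F(3)[OF v(1)] by (metis Ints_cases)
    have ij0: "i < 0" "0 < j" using ij w(1) uF[OF v(1)] by auto
    \<comment> \<open>The values of \<open>u\<close> and \<open>w\<close> at \<open>v\<close> are
      the integers \<open>j > 0\<close> and \<open>i < 0\<close>, so this combination vanishes at
      \<open>v\<close>. It is positive on all other generators, since \<open>u\<close> is positive
      and \<open>w\<close> nonnegative there.\<close>
    define e where "e = lattice_multiple (nat (- i)) u + lattice_multiple (nat j) w"
    have ev: "pairing e v = 0"
      using ij ij0 by (simp add: e_def pairing_add pairing_lattice_multiple)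
    have es: "0 < pairing e s" if "s \<in> F - {v}" for s
    proof -
      have "real_of_int i * pairing u s < 0" using ij0(1) uF[of s] that by (simp add: mult_neg_pos)
      moreover have "0 \<le> real_of_int j * pairing w s" using ij0(2) w(2)[OF that] by simp
      ultimately show ?thesis using ij0 by (simp add: e_def pairing_add pairing_lattice_multiple)
    qed
    have ed: "e \<in> dual_cone \<tau>"
    proof (rule dualI)
      fix s assume "s \<in> F"
      then show "0 \<le> pairing e s" using ev es[of s] by (cases "s = v") auto
    qed
    have "monomial e \<notin> P" using P_pos[of "monomial e"] ev by (auto simp: worder_monomial)
    then have "monomial x \<in> S" if "0 \<le> pairing x v" for x
      using shift[OF ed, of x] es that by blast
    then show ?thesis using F\<tau>[OF v(1)] F0[OF v(1)] F(3)[OF v(1)] Sv by blast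
  qed
qed

context toric_line_bundle
begin

text \<open>Points of codimension one near \<open>R\<close> may belong to charts of other cones. On
  \<open>U\<close> the generator of the chart of \<open>\<sigma>\<close> still generates
  \<open>L\<close>; comparison with the generator on the chart of \<open>\<tau>\<close> makes the
  monomial of \<open>m \<sigma> - m \<tau>\<close> a unit at \<open>S\<close>. So
  \<open>m \<sigma>\<close> and \<open>m \<tau>\<close> agree along the divisor, and the strict
  inequality for \<open>\<tau>\<close> applies.\<close>

lemma interior_monomial_dualizing:
  assumes \<sigma>: "\<sigma> \<in> \<Sigma>" "R \<in> Spec (cone_algebra \<sigma>)" and x: "x \<in> interior_points k"
  shows "monomial (x - lattice_multiple k (m \<sigma>)) \<in> dualizing_sheaf X R"
proof -
  interpret R: subring_set R using Spec_subring[OF \<sigma>(2) subring_cone_algebra] .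
  have RX: "R \<in> X" using \<sigma> in_X_iff by blast
  let ?h = "g * monomial (m \<sigma>)"
  have h: "?h \<noteq> 0" using g by simp
  obtain U0 t where U0: "openin (zariski X) U0" "R \<in> U0" "t \<noteq> 0" "\<And>S. S \<in> U0 \<Longrightarrow> L S = (\<lambda>a. t * a) ` S"
    using bspec[OF L[unfolded line_bundle_def] RX] by metis
  have eq: "(\<lambda>a. t * a) ` R = (\<lambda>a. ?h * a) ` R" using U0(4)[OF U0(2)] stalk[OF \<sigma>] by simp
  have "t * 1 \<in> (\<lambda>a. ?h * a) ` R" "?h * 1 \<in> (\<lambda>a. t * a) ` R"
    using R.one_mem eq by blast+
  then have th: "t / ?h \<in> R" "?h / t \<in> R"
    using mem_scaled_iff[OF h] mem_scaled_iff[OF U0(3)] by simp_all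
  have op: "openin (zariski X) {S \<in> X. f \<in> S}" for f
    unfolding zariski_def by (rule topology_generated_by_Basis) blast
  define U where "U = U0 \<inter> {S \<in> X. t / ?h \<in> S} \<inter> {S \<in> X. ?h / t \<in> S}"
  have U: "openin (zariski X) U" unfolding U_def by (intro openin_Int op U0(1))
  have RU: "R \<in> U" using U0(2) th RX by (simp add: U_def)
  have "monomial (x - lattice_multiple k (m \<sigma>)) \<in> regular_forms S" if S: "S \<in> U" "codim_one S" for S
  proof -
    have SU: "S \<in> U0" "S \<in> X" "t / ?h \<in> S" "?h / t \<in> S" using S(1) by (auto simp: U_def)
    obtain \<tau> where \<tau>: "\<tau> \<in> \<Sigma>" "S \<in> Spec (cone_algebra \<tau>)" using SU(2) in_X_iff by blast
    interpret S: subring_set S using Spec_subring[OF \<tau>(2) subring_cone_algebra] .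
    let ?h' = "g * monomial (m \<tau>)"
    have h': "?h' \<noteq> 0" using g by simp
    have eq': "(\<lambda>a. t * a) ` S = (\<lambda>a. ?h' * a) ` S" using U0(4)[OF SU(1)] stalk[OF \<tau>] by simp
    have "t * 1 \<in> (\<lambda>a. ?h' * a) ` S" "?h' * 1 \<in> (\<lambda>a. t * a) ` S"
      using S.one_mem eq' by blast+
    then have th': "t / ?h' \<in> S" "?h' / t \<in> S"
      using mem_scaled_iff[OF h'] mem_scaled_iff[OF U0(3)] by simp_all
    have "?h / t * (t / ?h') \<in> S" "?h' / t * (t / ?h) \<in> S" using SU th' by (blast intro: S.mult_mem)+
    moreover have "?h / t * (t / ?h') = monomial (m \<sigma> - m \<tau>)" "?h' / t * (t / ?h) = monomial (m \<tau> - m \<sigma>)"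
      using g U0(3) by (simp_all add: monomial_diff)
    ultimately have trans: "monomial (m \<sigma> - m \<tau>) \<in> S" "monomial (m \<tau> - m \<sigma>) \<in> S" by metis+
    have const: "range const \<subseteq> S"
      using Spec_superset[OF \<tau>(2) subring_cone_algebra] const_mem_cone_algebra by blast
    consider "\<And>x. monomial x \<in> S"
      | v where "v \<in> \<tau>" "v \<noteq> 0" "\<And>i. v $ i \<in> \<int>" "S \<subseteq> valuation_ring v" "\<And>x. 0 \<le> pairing x v \<Longrightarrow> monomial x \<in> S"
      using codim_one_cases[OF cone(1)[OF \<tau>(1)] cone(2)[OF \<tau>(1)] \<tau>(2) S(2)] by blast
    then show ?thesis
    proof cases
      case 1
      then show ?thesis by (rule monomial_regular_form_torus[OF S.subring_set_axioms const])
    next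
      case 2
      have "0 \<le> worder v (monomial (m \<sigma> - m \<tau>))" "0 \<le> worder v (monomial (m \<tau> - m \<sigma>))"
        using trans 2(4) monomial_nonzero by (auto simp: valuation_ring_def)
      then have "pairing (m \<sigma>) v = pairing (m \<tau>) v" by (simp add: worder_monomial pairing_diff)
      moreover have "real k * pairing (m \<tau>) v < pairing x v"
        using x \<tau>(1) 2(1,2) by (auto simp: interior_points_def)
      ultimately have "0 < pairing (x - lattice_multiple k (m \<sigma>)) v"
        by (simp add: pairing_diff pairing_lattice_multiple)
      then show ?thesis
        using monomial_regular_form_divisor[OF S.subring_set_axioms const 2(5) 2(2,3)] by blast
    qed
  qed
  then show ?thesis unfolding dualizing_sheaf_def using U RU by blast
qed

end

section \<open>Ampleness\<close>

lemma subalgebra_hull: "subalgebra (subalgebra hull B)"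
  by (rule hull_in) (auto simp: subalgebra_def)

lemma subring_subalgebra:
  assumes "subalgebra A"
  shows "subring_set A"
proof
  have c: "const c \<in> A" for c using assms by (auto simp: subalgebra_def)
  show "1 \<in> A" using c[of 1] by (simp add: const_one)
  fix a b assume ab: "a \<in> A" "b \<in> A"
  then show "a * b \<in> A" using assms by (simp add: subalgebra_def)
  have "a + const (- 1) * b \<in> A" using assms ab c unfolding subalgebra_def by blast
  then show "a - b \<in> A" by (simp add: const_uminus const_one)
qed

lemma toric_variety_nonempty:
  fixes \<Sigma> :: "(real^'n::{finite,linorder}) set set"
  assumes "fan \<Sigma>"
  shows "toric_variety \<Sigma> \<noteq> {}"
proof -
  let ?T = "cone_algebra {0 :: (real, 'n) vec}"
  \<comment> \<open>Along the zero vector every nonzero function has order 0, so this is the generic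
    point.\<close>
  have "localization ?T (positive_order 0 ?T) \<in> Spec ?T"
    by (intro SpecI subring_cone_algebra prime_in_positive_order cone_algebra_valuation_ring) simp
  then show ?thesis using zero_cone_in_fan[OF assms] by (auto simp: toric_variety_def)
qed

lemma dual_cone_orthogonal:
  assumes "\<And>x. x \<in> dual_cone \<sigma> \<Longrightarrow> pairing x v = 0" "rational_cone \<sigma>" "strongly_convex \<sigma>"
  shows "v = 0"
proof -
  have "v \<in> \<sigma>" "- v \<in> \<sigma>"
    using assms(1) by (auto intro!: bidual_cone[OF assms(2)] simp: pairing_uminus_right)
  then have "v \<in> \<sigma> \<inter> uminus ` \<sigma>" by force
  then show ?thesis by (simp only: assms(3)[unfolded strongly_convex_def] singleton_iff)
qed

lemma very_ampleE:
  assumes "very_ample X L"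
  obtains S where "finite S" "0 \<notin> S" "S \<subseteq> global_sections X L"
    "X = (\<Union>s\<in>S. nonvanishing_locus X L s)"
    "\<And>s. s \<in> S \<Longrightarrow> nonvanishing_locus X L s = Spec (subalgebra hull {t / s |t. t \<in> S})"
proof -
  obtain S where S: "finite S \<and> 0 \<notin> S \<and> S \<subseteq> global_sections X L \<and>
      X = (\<Union>s\<in>S. nonvanishing_locus X L s) \<and>
      (\<forall>s\<in>S. nonvanishing_locus X L s = Spec (subalgebra hull {t / s |t. t \<in> S}))"
    using assms[unfolded very_ample_def, THEN conjunct2] by (rule exE)
  show thesis
    by (rule that[OF conjunct1[OF S] conjunct1[OF conjunct2[OF S]]
        conjunct1[OF conjunct2[OF conjunct2[OF S]]] conjunct1[OF conjunct2[OF conjunct2[OF conjunct2[OF S]]]]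
        bspec[OF conjunct2[OF conjunct2[OF conjunct2[OF conjunct2[OF S]]]]]])
qed

text \<open>
  The valuative criterion for the order along \<open>v\<close>: dividing by a section of minimal order shows
  that this valuation has a centre on \<open>X\<close>, and the chart containing it belongs to a cone through \<open>v\<close>.
\<close>

lemma very_ample_fan_complete:
  fixes \<Sigma> :: "(real^'n::{finite,linorder}) set set"
  assumes fan: "fan \<Sigma>" and ample: "very_ample (toric_variety \<Sigma>) L"
  shows "\<exists>\<sigma>\<in>\<Sigma>. v \<in> \<sigma>"
proof -
  let ?X = "toric_variety \<Sigma>"
  obtain S where S: "finite S" "0 \<notin> S" "?X = (\<Union>s\<in>S. nonvanishing_locus ?X L s)"
      "\<And>s. s \<in> S \<Longrightarrow> nonvanishing_locus ?X L s = Spec (subalgebra hull {t / s |t. t \<in> S})"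
    using ample by (rule very_ampleE) (rule that)
  have "S \<noteq> {}" using toric_variety_nonempty[OF fan] S(3) by auto
  then obtain s where s: "s \<in> S" "\<And>t. t \<in> S \<Longrightarrow> worder v s \<le> worder v t"
    using ex_is_arg_min_if_finite[OF S(1), of "worder v"] by (auto simp: is_arg_min_linorder)
  define B where "B = subalgebra hull {t / s |t. t \<in> S}"
  have "B \<subseteq> valuation_ring v"
    unfolding B_def
  proof (intro hull_minimal subalgebra_valuation_ring subsetI)
    fix x assume "x \<in> {t / s |t. t \<in> S}"
    then obtain t where t: "t \<in> S" "x = t / s" by blast
    have "t \<noteq> 0" "s \<noteq> 0" using t(1) s(1) S(2) by auto
    then show "x \<in> valuation_ring v" using s(2)[OF t(1)] by (simp add: t(2) valuation_ring_def worder_div)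
  qed
  moreover have B: "subring_set B" unfolding B_def by (intro subring_subalgebra subalgebra_hull)
  ultimately have *: "prime_in B (positive_order v B)"
      "localization B (positive_order v B) \<subseteq> valuation_ring v"
    by (simp_all add: prime_in_positive_order localization_positive_order)
  let ?R = "localization B (positive_order v B)"
  have "?R \<in> ?X" using SpecI[OF B *(1)] S(3,4) s(1) unfolding B_def by blast
  then obtain \<sigma> where \<sigma>: "\<sigma> \<in> \<Sigma>" "?R \<in> Spec (cone_algebra \<sigma>)" by (auto simp: toric_variety_def)
  have "v \<in> \<sigma>"
  proof (rule bidual_cone)
    show "rational_cone \<sigma>" using fan \<sigma>(1) by (simp add: fan_def)
    fix x assume "x \<in> dual_cone \<sigma>"
    then have "monomial x \<in> valuation_ring v"
      using *(2) Spec_superset[OF \<sigma>(2) subring_cone_algebra] monomial_mem_cone_algebra by blast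
    then show "0 \<le> pairing x v" by (auto simp: valuation_ring_def worder_monomial)
  qed
  with \<sigma>(1) show ?thesis by blast
qed

text \<open>The sum of the generators works: if nonnegative values on the generators add up to 0,
  each of them is 0.\<close>

lemma relative_interior_point:
  fixes \<sigma> :: "(real^'n::{finite,linorder}) set"
  assumes "rational_cone \<sigma>"
  obtains w where "w \<in> \<sigma>"
    "\<And>x v. x \<in> dual_cone \<sigma> \<Longrightarrow> pairing x w = 0 \<Longrightarrow> v \<in> \<sigma> \<Longrightarrow> pairing x v = 0"
proof -
  obtain F where F: "finite F" "\<sigma> = convex_cone hull F" using assms by (auto simp: rational_cone_def)
  have F\<sigma>: "s \<in> \<sigma>" if "s \<in> F" for s using hull_inc[OF that, of convex_cone] F(2) by simp
  have sum: "sum (\<lambda>v. v) G \<in> \<sigma>" if "G \<subseteq> F" for G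
    using finite_subset[OF that F(1)] that
  proof (induction G rule: finite_induct)
    case empty
    then show ?case using F(2) by (simp add: convex_cone_hull_contains_0)
  next
    case (insert s G)
    then show ?case using F\<sigma>[of s] F(2) by (auto intro: convex_cone_hull_add)
  qed
  show thesis
  proof
    show "sum (\<lambda>v. v) F \<in> \<sigma>" using sum by simp
    fix x v assume x: "x \<in> dual_cone \<sigma>" "pairing x (sum (\<lambda>v. v) F) = 0" and v: "v \<in> \<sigma>"
    have nonneg: "0 \<le> pairing x s" if "s \<in> F" for s using x(1) F\<sigma>[OF that] by (simp add: dual_cone_def)
    have "(\<Sum>s\<in>F. pairing x s) = 0" using x(2) by (simp add: pairing_eq_inner inner_sum_right)
    then have zero: "pairing x s = 0" if "s \<in> F" for s
      using sum_nonneg_eq_0_iff[OF F(1), of "pairing x"] nonneg that by blast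
    have "0 \<le> pairing (- x) v"
    proof (rule pairing_nonneg_hull[of F])
      show "0 \<le> pairing (- x) s" if "s \<in> F" for s using zero[OF that] by (simp add: pairing_minus)
      show "v \<in> convex_cone hull F" using v F(2) by simp
    qed
    moreover have "0 \<le> pairing x v" using x(1) v by (simp add: dual_cone_def)
    ultimately show "pairing x v = 0" by (simp add: pairing_minus)
  qed
qed

section \<open>The polytope of an ample line bundle: vertices, convex hull and dimension\<close>

locale ample_toric_line_bundle = toric_line_bundle +
  assumes ample: "ample X L"
begin

definition full_cone :: "(real, 'a) vec set \<Rightarrow> bool" where
  "full_cone \<sigma> \<longleftrightarrow> (\<forall>x. (\<forall>v\<in>\<sigma>. pairing x v = 0) \<longrightarrow> x = 0)"

lemma complete: "\<exists>\<sigma>\<in>\<Sigma>. v \<in> \<sigma>"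
  using ample very_ample_fan_complete[OF fan] unfolding ample_def X by blast

text \<open>At the centre of a vector \<open>w\<close> in the relative interior, some section of a
  very ample power generates it. One of its exponents \<open>x\<close> then differs from
  \<open>k\<close> times \<open>m \<sigma>\<close> by an element of the dual cone that vanishes at
  \<open>w\<close>, hence on all of the full-dimensional cone, hence is 0. So the
  \<open>k\<close>-fold multiple of \<open>m \<sigma>\<close> satisfies all inequalities, and these
  can be divided by \<open>k\<close>.\<close>

lemma vertex_in_degree_points:
  assumes \<sigma>: "\<sigma> \<in> \<Sigma>" "full_cone \<sigma>"
  shows "m \<sigma> \<in> degree_points 1"
proof -
  obtain k where k: "1 \<le> k" "very_ample X (tensor_power L k)" using ample by (auto simp: ample_def)
  obtain S where S: "S \<subseteq> global_sections X (tensor_power L k)"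
      "X = (\<Union>s\<in>S. nonvanishing_locus X (tensor_power L k) s)"
    using k(2) by (rule very_ampleE) (rule that)
  let ?A = "cone_algebra \<sigma>"
  obtain w where w: "w \<in> \<sigma>" "\<And>x v. x \<in> dual_cone \<sigma> \<Longrightarrow> pairing x w = 0 \<Longrightarrow> v \<in> \<sigma> \<Longrightarrow> pairing x v = 0"
    using relative_interior_point[OF cone(1)[OF \<sigma>(1)]] by metis
  let ?P = "positive_order w ?A"
  have P: "prime_in ?A ?P"
    by (intro prime_in_positive_order subring_cone_algebra cone_algebra_valuation_ring w(1))
  define R where "R = localization ?A ?P"
  have R: "R \<in> Spec ?A" unfolding R_def by (intro SpecI subring_cone_algebra P)
  interpret R: subring_set R using Spec_subring[OF R subring_cone_algebra] .
  have "R \<in> X" using R \<sigma>(1) in_X_iff by blast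
  then have "R \<in> (\<Union>s\<in>S. nonvanishing_locus X (tensor_power L k) s)"
    by (rule ssubst[OF S(2)[symmetric]])
  then obtain s where s: "s \<in> S" "tensor_power L k R = (\<lambda>a. s * a) ` R"
    by (auto simp: nonvanishing_locus_def)
  obtain p where p: "s = g ^ k * of_laurent p" "keys p \<subseteq> degree_points k"
    using s(1) S(1) unfolding global_sections_tensor_power by blast
  let ?l = "lattice_multiple k (m \<sigma>)"
  let ?h = "g ^ k * monomial ?l"
  have h: "?h \<noteq> 0" using g by simp
  have eq: "(\<lambda>a. s * a) ` R = (\<lambda>a. ?h * a) ` R"
    using s(2) tensor_power_stalk_toric[OF \<sigma>(1) R] by simp
  have "?h * 1 \<in> (\<lambda>a. s * a) ` R" using eq R.one_mem by blast
  then obtain r where r: "r \<in> R" "?h = s * r" by auto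
  have s0: "s \<noteq> 0" using r(2) h by auto
  then have p0: "p \<noteq> 0" using p(1) by auto
  define f where "f = of_laurent p / monomial ?l"
  have f0: "f \<noteq> 0" using p0 by (simp add: f_def)
  have "?h = g ^ k * (of_laurent p * r)" using r(2) p(1) by (simp add: mult.assoc)
  then have "monomial ?l = of_laurent p * r" using g by simp
  then have "1 / f = r" using p0 by (simp add: f_def)
  then have "1 / f \<in> R" using r(1) by simp
  have fA: "f \<in> ?A"
    unfolding f_def divide_monomial_mem_cone_algebra mem_dual_shift_iff
    using p(2) \<sigma>(1) by (auto simp: degree_points_def)
  then have "f \<notin> ?P"
    using \<open>1 / f \<in> R\<close> inverse_mem_localization_iff[OF subring_cone_algebra P fA f0] unfolding R_def by blast
  then have "worder w f \<le> 0" using fA f0 by auto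
  moreover have "worder w f = lorder w p - pairing ?l w"
    using p0 unfolding f_def by (subst worder_div) (simp_all add: worder_of_laurent worder_monomial)
  ultimately have "lorder w p \<le> pairing ?l w" by simp
  moreover obtain x where x: "x \<in> keys p" "pairing x w = lorder w p"
    using lorder_attained[OF p0] by metis
  ultimately have le: "pairing (x - ?l) w \<le> 0" by (simp add: pairing_diff)
  have xd: "x - ?l \<in> dual_cone \<sigma>"
    unfolding mem_dual_shift_iff using x(1) p(2) \<sigma>(1) by (auto simp: degree_points_def)
  then have "pairing (x - ?l) w = 0" using le w(1) by (auto simp: dual_cone_def intro: antisym)
  then have "x - ?l = 0" using w(2)[OF xd] \<sigma>(2) unfolding full_cone_def by blast
  then have "?l \<in> degree_points k" using x(1) p(2) by auto
  then show ?thesis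
    using k(1) by (auto simp: degree_points_def pairing_lattice_multiple)
qed

text \<open>The hull is already that of the \<open>m \<sigma>\<close> of full-dimensional cones.
  Functionals separating a point from it form a nonempty open set, which the lower-dimensional
  cones, being negligible, cannot cover. By completeness one such functional lies in a
  full-dimensional cone, and its \<open>m \<sigma>\<close> contradicts the inequality there.\<close>

lemma degree_points_hull:
  assumes j: "1 \<le> j" and x: "x \<in> degree_points j"
  shows "(1 / real j) *\<^sub>R lattice_vec x \<in> convex hull lattice_vec ` degree_points 1"
proof -
  define V where "V = (lattice_vec \<circ> m) ` {\<sigma> \<in> \<Sigma>. full_cone \<sigma>}"
  have finV: "finite V" using fan by (auto simp: V_def fan_def)
  have V: "V \<subseteq> lattice_vec ` degree_points 1" using vertex_in_degree_points by (auto simp: V_def)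
  let ?z = "(1 / real j) *\<^sub>R lattice_vec x"
  have "?z \<in> convex hull V"
  proof (rule ccontr)
    assume nz: "?z \<notin> convex hull V"
    have "closed (convex hull V)" using finV by (simp add: finite_imp_compact_convex_hull compact_imp_closed)
    then obtain a b where ab: "a \<bullet> ?z < b" "\<And>y. y \<in> convex hull V \<Longrightarrow> b < a \<bullet> y"
      using separating_hyperplane_closed_point[OF convex_convex_hull _ nz] by blast
    define U where "U = (\<Inter>y\<in>V. {a. (y - ?z) \<bullet> a > 0})"
    have "open U" unfolding U_def using finV by (intro open_INT) (auto intro: open_halfspace_gt)
    moreover have "a \<in> U"
    proof -
      have "0 < (y - ?z) \<bullet> a" if "y \<in> V" for y
        using ab(1) ab(2)[OF hull_inc[OF that]]
        by (simp only: inner_diff_left inner_commute[of y a] inner_commute[of ?z a] diff_gt_0_iff_gt)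
      then show ?thesis by (simp add: U_def)
    qed
    ultimately have nU: "\<not> negligible U" using open_not_negligible by blast
    have "negligible \<sigma>" if \<sigma>: "\<not> full_cone \<sigma>" for \<sigma>
    proof -
      obtain u where u: "\<And>v. v \<in> \<sigma> \<Longrightarrow> pairing u v = 0" "u \<noteq> 0"
        using \<sigma> unfolding full_cone_def by blast
      then have "\<sigma> \<subseteq> {v. lattice_vec u \<bullet> v = 0}" by (auto simp: pairing_eq_inner)
      moreover have "lattice_vec u \<noteq> 0"
        using u(2) injD[OF inj_lattice_vec, of u 0] by (auto simp: lattice_vec_zero)
      ultimately show ?thesis using negligible_hyperplane[of "lattice_vec u" 0] negligible_subset by blast
    qed
    then have "negligible (\<Union>{\<sigma> \<in> \<Sigma>. \<not> full_cone \<sigma>})"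
      using fan by (intro negligible_Union) (auto simp: fan_def)
    then obtain v where v: "v \<in> U" "v \<notin> \<Union>{\<sigma> \<in> \<Sigma>. \<not> full_cone \<sigma>}"
      using nU negligible_subset by blast
    obtain \<sigma> where \<sigma>: "\<sigma> \<in> \<Sigma>" "v \<in> \<sigma>" using complete by blast
    then have "full_cone \<sigma>" using v(2) by blast
    then have "lattice_vec (m \<sigma>) \<in> V" using \<sigma>(1) by (auto simp: V_def)
    then have "(lattice_vec (m \<sigma>) - ?z) \<bullet> v > 0" using v(1) by (auto simp: U_def)
    then have "pairing x v < real j * pairing (m \<sigma>) v"
      using j by (simp add: inner_diff_left pairing_eq_inner field_simps)
    moreover have "real j * pairing (m \<sigma>) v \<le> pairing x v"
      using x \<sigma> by (auto simp: degree_points_def)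
    ultimately show False by simp
  qed
  then show ?thesis using hull_mono[OF V] by blast
qed

text \<open>If \<open>P\<close> lay in a hyperplane orthogonal to \<open>v\<close>, all sections of
  the very ample power would, up to \<open>g ^ k\<close>, be homogeneous of the same degree, and
  their ratios would lie in the field of fractions of degree 0. This field would contain the generic
  local ring of a projective chart, hence all monomials of the chart of some cone; their exponents
  would be orthogonal to \<open>v\<close>, which strong convexity forbids.\<close>

lemma affine_hull_degree_points: "affine hull lattice_vec ` degree_points 1 = UNIV"
proof (rule ccontr)
  let ?V = "lattice_vec ` degree_points 1"
  assume "affine hull ?V \<noteq> UNIV"
  then have "aff_dim ?V \<noteq> DIM((real, 'a) vec)" using aff_dim_eq_full by blast
  then have "aff_dim ?V < DIM((real, 'a) vec)" using aff_dim_le_DIM[of ?V] by linarith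
  then obtain v c where v: "v \<noteq> 0" "?V \<subseteq> {x. v \<bullet> x = c}"
    using aff_lowdim_subset_hyperplane by blast
  have hom: "pairing x v = real j * c" if j: "1 \<le> j" and x: "x \<in> degree_points j" for j x
  proof -
    have "convex hull ?V \<subseteq> {x. v \<bullet> x = c}" using v(2) by (intro hull_minimal convex_hyperplane)
    then have "v \<bullet> ((1 / real j) *\<^sub>R lattice_vec x) = c" using degree_points_hull[OF j x] by blast
    then show ?thesis using j by (simp add: pairing_eq_inner inner_commute field_simps)
  qed
  obtain k where k: "1 \<le> k" "very_ample X (tensor_power L k)" using ample by (auto simp: ample_def)
  obtain S where S: "S \<subseteq> global_sections X (tensor_power L k)" "0 \<notin> S"
      "X = (\<Union>s\<in>S. nonvanishing_locus X (tensor_power L k) s)"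
      "\<And>s. s \<in> S \<Longrightarrow> nonvanishing_locus X (tensor_power L k) s = Spec (subalgebra hull {t / s |t. t \<in> S})"
    using k(2) by (rule very_ampleE) (rule that)
  have "S \<noteq> {}" using toric_variety_nonempty[OF fan] S(3) X by auto
  then obtain s where s: "s \<in> S" by blast
  define B where "B = subalgebra hull {t / s |t. t \<in> S}"
  have B: "subring_set B" unfolding B_def by (intro subring_subalgebra subalgebra_hull)
  have "t / s \<in> homogeneous_fractions v" if t: "t \<in> S" for t
  proof -
    obtain p where p: "t = g ^ k * of_laurent p" "keys p \<subseteq> degree_points k"
      using t S(1) unfolding global_sections_tensor_power by blast
    obtain q where q: "s = g ^ k * of_laurent q" "keys q \<subseteq> degree_points k"
      using s S(1) unfolding global_sections_tensor_power by blast
    have "of_laurent p / of_laurent q \<in> homogeneous_fractions v"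
      using p(2) q S(2) s hom[OF k(1)] by (intro homogeneous_fractionsI[where d = "real k * c"]) auto
    then show ?thesis using g by (simp add: p q)
  qed
  then have Bh: "B \<subseteq> homogeneous_fractions v"
    unfolding B_def by (intro hull_minimal subalgebra_homogeneous_fractions) blast
  have zero: "prime_in B {0}"
    using subring_set.zero_mem[OF B] by (simp add: prime_in_def ideal_in_def)
  have "localization B {0} \<in> X" using SpecI[OF B zero] S(3,4) s unfolding B_def by blast
  then obtain \<sigma> where \<sigma>: "\<sigma> \<in> \<Sigma>" "localization B {0} \<in> Spec (cone_algebra \<sigma>)" by (auto simp: in_X_iff)
  have "pairing x v = 0" if "x \<in> dual_cone \<sigma>" for x
  proof -
    have "monomial x \<in> localization B {0}"
      using that Spec_superset[OF \<sigma>(2) subring_cone_algebra] monomial_mem_cone_algebra by blast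
    then obtain a b where ab: "monomial x = a / b" "a \<in> B" "b \<in> B" by (auto simp: localization_def)
    have "monomial x \<in> homogeneous_fractions v"
      unfolding ab(1) using ab(2,3) Bh by (intro homogeneous_fractions_closed(3)) auto
    then show ?thesis by (rule monomial_homogeneous_fractions)
  qed
  then have "v = 0" using dual_cone_orthogonal cone \<sigma>(1) by blast
  with v(1) show False by simp
qed

end

theorem theorem4:
  fixes \<Sigma> :: "(real^'n::{finite,linorder}) set set"
    and X :: "'n ratfun set set"
    and L :: "'n ratfun subsheaf"
  assumes "CARD('n) \<ge> 3"
    and "fan \<Sigma>" and "X = toric_variety \<Sigma>" and "projective X"
    and "line_bundle X L" and "ample X L"
    and "ratfun.dim (global_sections X L) \<ge> CARD('n) + 2"
    and "ratfun.dim (global_sections X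
           (tensor (tensor_power L (CARD('n) - 1)) (dualizing_sheaf X))) = 1"
  shows "normally_generated X L"
proof -
  obtain g m where gm: "g \<noteq> 0"
      "\<And>\<sigma> S. \<sigma> \<in> \<Sigma> \<Longrightarrow> S \<in> Spec (cone_algebra \<sigma>) \<Longrightarrow> L S = (\<lambda>a. g * monomial (m \<sigma>) * a) ` S"
    by (rule line_bundle_toric[OF assms(2,3,5)]) (rule that)
  interpret ample_toric_line_bundle \<Sigma> X L g m
    using assms gm by unfold_locales auto
  \<comment> \<open>The zero vector is left out because its inequality can never be strict; in weak
    form it holds trivially.\<close>
  define D where "D = {(v, pairing (m \<sigma>) v) |v \<sigma>. \<sigma> \<in> \<Sigma> \<and> v \<in> \<sigma> \<and> v \<noteq> 0}"
  show ?thesis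
  proof (rule normally_generatedI)
    fix k :: nat and x assume k: "1 \<le> k" "x \<in> degree_points (k + 1)"
    show "\<exists>p\<in>degree_points 1. x - p \<in> degree_points k"
    proof (rule lattice_point_decomposition[OF assms(1), where D = D and S = degree_points and I = interior_points])
      have zero: "pairing y (0 :: (real, 'n) vec) = 0" for y by (simp add: pairing_eq_inner)
      show "degree_points j = {x. \<forall>(v, c)\<in>D. real j * c \<le> pairing x v}" for j
        unfolding degree_points_def D_def by (auto simp: zero) (metis zero mult_zero_right order_refl)
      show "interior_points j = {x. \<forall>(v, c)\<in>D. real j * c < pairing x v}" for j
        unfolding interior_points_def D_def by blast
      show "CARD('n) + 2 \<le> card (degree_points 1)"
        using assms(7) dim_global_sections_L by simp
      show "a = b" if "a \<in> interior_points (CARD('n) - 1)" "b \<in> interior_points (CARD('n) - 1)" for a b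
        using interior_points_unique[OF assms(8) interior_monomial_dualizing that] .
    qed (use k degree_points_hull affine_hull_degree_points in \<open>auto simp: D_def\<close>)
  qed
qed

end
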